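(* Let $K$ be a pathwise connected poset and let $a\in K$. Then the category $V_{net}(K)$ of finite-dimensional Hilbert net bundles over $K$ is equivalent to the category of unitary, finite-dimensional representations of $\pi_1(K,a)$, so that the ring $\mathbf{K}^0(K)$ is isomorphic to the representation ring of $\pi_1(K,a)$.
   Context: Homotopy of a poset $K$: a $1$-simplex $b=(|b|;\partial_0b,\partial_1b)$ consists of elements of $K$ with $\partial_0b,\partial_1b\leq|b|$. A $2$-simplex $c$ consists of $1$-simplices $\partial_0c,\partial_1c,\partial_2c$ and $|c|\in K$ with $|\partial_ic|\leq|c|$, satisfying $\partial_0\partial_1c=\partial_0\partial_0c$, $\partial_0\partial_2c=\partial_1\partial_0c$, $\partial_1\partial_2c=\partial_1\partial_1c$. A path is $p=b_n*\cdots*b_1$ with $\partial_0b_i=\partial_1b_{i+1}$, going from $\partial_1b_1$ to $\partial_0b_n$. $K$ is pathwise connected if any two elements are joined by a path. Homotopy of paths is generated by replacing a $1$-simplex $\partial_1c$ of a path by $\partial_0c*\partial_2c$, or conversely. $\pi_1(K,a)$ is the group of homotopy classes of closed paths at $a$ under concatenation. Hilbert net bundle over $K$: $\mathcal{E}=(E,\pi,J,K)$ with $\pi:E\to K$ surjective, each fibre $E_a=\pi^{-1}(a)$ a (complex) Hilbert space, and unitaries $J_{(a',a)}:E_a\to E_{a'}$ for $a\leq a'$ in $K$ with $J_{(a,a)}=\mathrm{id}$, $J_{(a'',a')}J_{(a',a)}=J_{(a'',a)}$. A morphism $T\in(\mathcal{E},\hat{\mathcal{E}})$ is a family of bounded linear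 maps $T_a:E_a\to\hat E_a$ with $T_{a'}J_{(a',a)}=\hat J_{(a',a)}T_a$ for $a\leq a'$. $V_{net}(K)$ is the category of Hilbert net bundles with finite-dimensional fibres. Direct sums and tensor products are defined fibrewise. $\mathbf{K}^0(K)$ is the Grothendieck ring of the semiring of isomorphism classes of finite-dimensional Hilbert net bundles under direct sum and tensor product. The representation ring of a group is the Grothendieck ring of the semiring of isomorphism classes of its finite-dimensional unitary representations; morphisms of representations are intertwiners. *)

theory Defs
  imports
    Complex_Main
    "HOL-Library.FuncSet"
    "HOL-Library.Equipollence"
    "HOL-Algebra.Module"
    "HOL-Algebra.QuotRing"
begin

section \<open>Homotopy of a poset\<close>

text \<open>The poset is the universe of a type \<open>'k\<close> of class \<^class>\<open>order\<close>.\<close>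

record 'k simplex1 =
  supp1 :: 'k
  bd0 :: 'k
  bd1 :: 'k

definition is_simplex1 :: "'k::order simplex1 \<Rightarrow> bool" where
  "is_simplex1 b \<longleftrightarrow> bd0 b \<le> supp1 b \<and> bd1 b \<le> supp1 b"

record 'k simplex2 =
  supp2 :: 'k
  face0 :: "'k simplex1"
  face1 :: "'k simplex1"
  face2 :: "'k simplex1"

definition is_simplex2 :: "'k::order simplex2 \<Rightarrow> bool" where
  "is_simplex2 c \<longleftrightarrow>
     is_simplex1 (face0 c) \<and> is_simplex1 (face1 c) \<and> is_simplex1 (face2 c) \<and>
     supp1 (face0 c) \<le> supp2 c \<and> supp1 (face1 c) \<le> supp2 c \<and> supp1 (face2 c) \<le> supp2 c \<and>
     bd0 (face1 c) = bd0 (face0 c) \<and>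
     bd0 (face2 c) = bd1 (face0 c) \<and>
     bd1 (face2 c) = bd1 (face1 c)"

text \<open>
  The path \<open>b\<^sub>n * \<dots> * b\<^sub>1\<close> (with \<open>n \<ge> 1\<close>) is the list \<open>[b\<^sub>n, \<dots>, b\<^sub>1]\<close>, in this order, so that
  concatenation of paths is concatenation of lists.
\<close>

definition is_path :: "'k::order simplex1 list \<Rightarrow> 'k \<Rightarrow> 'k \<Rightarrow> bool" where
  "is_path p x y \<longleftrightarrow>
     p \<noteq> [] \<and> (\<forall>b\<in>set p. is_simplex1 b) \<and>
     (\<forall>i. Suc i < length p \<longrightarrow> bd1 (p ! i) = bd0 (p ! Suc i)) \<and>
     bd1 (last p) = x \<and> bd0 (hd p) = y"

definition pathwise_connected :: "'k::order itself \<Rightarrow> bool" where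
  "pathwise_connected _ \<longleftrightarrow> (\<forall>x y :: 'k. \<exists>p. is_path p x y)"

inductive homotopy_step :: "'k::order simplex1 list \<Rightarrow> 'k simplex1 list \<Rightarrow> bool" where
  "is_simplex2 c \<Longrightarrow> homotopy_step (p @ [face1 c] @ q) (p @ [face0 c, face2 c] @ q)"

text \<open>
  A list homotopic to a path from \<open>x\<close> to \<open>y\<close> is again a path from \<open>x\<close> to \<open>y\<close>, so the relation
  need not be restricted to paths.
\<close>

definition homotopic :: "'k::order simplex1 list \<Rightarrow> 'k simplex1 list \<Rightarrow> bool" where
  "homotopic = equivclp homotopy_step"

definition homotopy_class :: "'k::order simplex1 list \<Rightarrow> 'k simplex1 list set" where
  "homotopy_class p = {q. homotopic p q}"

definition pi1 :: "'k::order \<Rightarrow> 'k simplex1 list set monoid" where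
  "pi1 a = \<lparr>
     carrier = homotopy_class ` {p. is_path p a a},
     mult = (\<lambda>A B. {r. \<exists>p\<in>A. \<exists>q\<in>B. homotopic (p @ q) r}),
     one = homotopy_class [\<lparr>supp1 = a, bd0 = a, bd1 = a\<rparr>]\<rparr>"


section \<open>Hilbert spaces\<close>

definition complex_ring :: "complex ring" where
  "complex_ring = \<lparr>carrier = UNIV, mult = (*), one = 1, zero = 0, add = (+)\<rparr>"

text \<open>
  The fields \<^const>\<open>mult\<close> and \<^const>\<open>one\<close> which a module record inherits from \<^type>\<open>ring_ext\<close> carry
  no information here.
\<close>

record 'v hilb = "(complex, 'v) module" +
  hinner :: "'v \<Rightarrow> 'v \<Rightarrow> complex"

definition hnorm :: "'v hilb \<Rightarrow> 'v \<Rightarrow> real" where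
  "hnorm H x = sqrt (Re (hinner H x x))"

text \<open>The inner product is antilinear in the first argument and linear in the second one.\<close>

locale hilbert_space = module complex_ring H for H :: "'v hilb" +
  assumes inner_add:
      "\<lbrakk>x \<in> carrier H; y \<in> carrier H; z \<in> carrier H\<rbrakk> \<Longrightarrow>
       hinner H x (y \<oplus>\<^bsub>H\<^esub> z) = hinner H x y + hinner H x z"
    and inner_smult:
      "\<lbrakk>x \<in> carrier H; y \<in> carrier H\<rbrakk> \<Longrightarrow> hinner H x (c \<odot>\<^bsub>H\<^esub> y) = c * hinner H x y"
    and inner_cnj:
      "\<lbrakk>x \<in> carrier H; y \<in> carrier H\<rbrakk> \<Longrightarrow> hinner H y x = cnj (hinner H x y)"
    and inner_pos:
      "\<lbrakk>x \<in> carrier H; x \<noteq> \<zero>\<^bsub>H\<^esub>\<rbrakk> \<Longrightarrow> Re (hinner H x x) > 0"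
    and complete:
      "\<lbrakk>\<And>n. s n \<in> carrier H;
        \<And>e. e > 0 \<Longrightarrow> \<exists>N. \<forall>m\<ge>N. \<forall>n\<ge>N. hnorm H (s m \<ominus>\<^bsub>H\<^esub> s n) < e\<rbrakk> \<Longrightarrow>
       \<exists>l\<in>carrier H. (\<lambda>n::nat. hnorm H (s n \<ominus>\<^bsub>H\<^esub> l)) \<longlonglongrightarrow> 0"

definition hspan :: "'v hilb \<Rightarrow> 'v set \<Rightarrow> 'v set" where
  "hspan H B = {finsum H (\<lambda>b. c b \<odot>\<^bsub>H\<^esub> b) A | c A. finite A \<and> A \<subseteq> B}"

definition finite_dim :: "'v hilb \<Rightarrow> bool" where
  "finite_dim H \<longleftrightarrow> (\<exists>B. finite B \<and> B \<subseteq> carrier H \<and> hspan H B = carrier H)"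

definition is_linear :: "'v hilb \<Rightarrow> 'w hilb \<Rightarrow> ('v \<Rightarrow> 'w) \<Rightarrow> bool" where
  "is_linear H K T \<longleftrightarrow>
     T \<in> carrier H \<rightarrow> carrier K \<and>
     (\<forall>x\<in>carrier H. \<forall>y\<in>carrier H. T (x \<oplus>\<^bsub>H\<^esub> y) = T x \<oplus>\<^bsub>K\<^esub> T y) \<and>
     (\<forall>c. \<forall>x\<in>carrier H. T (c \<odot>\<^bsub>H\<^esub> x) = c \<odot>\<^bsub>K\<^esub> T x)"

text \<open>
  Operators that occur as morphisms are extensional, so that equality of operators is equality of
  HOL functions.
\<close>

definition bounded_ops :: "'v hilb \<Rightarrow> 'w hilb \<Rightarrow> ('v \<Rightarrow> 'w) set" where
  "bounded_ops H K =
     {T \<in> extensional (carrier H). is_linear H K T \<and>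
        (\<exists>M. \<forall>x\<in>carrier H. hnorm K (T x) \<le> M * hnorm H x)}"

definition is_unitary :: "'v hilb \<Rightarrow> 'w hilb \<Rightarrow> ('v \<Rightarrow> 'w) \<Rightarrow> bool" where
  "is_unitary H K U \<longleftrightarrow>
     is_linear H K U \<and> bij_betw U (carrier H) (carrier K) \<and>
     (\<forall>x\<in>carrier H. \<forall>y\<in>carrier H. hinner K (U x) (U y) = hinner H x y)"

definition hilb_sum :: "'v hilb \<Rightarrow> 'w hilb \<Rightarrow> ('v \<times> 'w) hilb" where
  "hilb_sum H K = \<lparr>
     carrier = carrier H \<times> carrier K,
     mult = undefined, one = undefined,
     zero = (\<zero>\<^bsub>H\<^esub>, \<zero>\<^bsub>K\<^esub>),
     add = (\<lambda>(x, y) (x', y'). (x \<oplus>\<^bsub>H\<^esub> x', y \<oplus>\<^bsub>K\<^esub> y')),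
     smult = (\<lambda>c (x, y). (c \<odot>\<^bsub>H\<^esub> x, c \<odot>\<^bsub>K\<^esub> y)),
     hinner = (\<lambda>(x, y) (x', y'). hinner H x x' + hinner K y y')\<rparr>"

text \<open>
  \<open>(L, t)\<close> is a tensor product of the finite-dimensional Hilbert spaces \<open>H\<close> and \<open>K\<close>, with
  \<open>t x y\<close> in the role of the simple tensor \<open>x \<otimes> y\<close>. These properties determine \<open>(L, t)\<close> up to a
  unique unitary. No closure of the span is taken, as the spaces are finite-dimensional.
\<close>

definition is_hilb_tensor ::
    "'u hilb \<Rightarrow> 'v hilb \<Rightarrow> 'w hilb \<Rightarrow> ('u \<Rightarrow> 'v \<Rightarrow> 'w) \<Rightarrow> bool" where
  "is_hilb_tensor H K L t \<longleftrightarrow>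
     (\<forall>y\<in>carrier K. is_linear H L (\<lambda>x. t x y)) \<and>
     (\<forall>x\<in>carrier H. is_linear K L (t x)) \<and>
     (\<forall>x\<in>carrier H. \<forall>y\<in>carrier K. \<forall>x'\<in>carrier H. \<forall>y'\<in>carrier K.
        hinner L (t x y) (t x' y') = hinner H x x' * hinner K y y') \<and>
     hspan L {t x y | x y. x \<in> carrier H \<and> y \<in> carrier K} = carrier L"

definition complex_hilb :: "complex hilb" where
  "complex_hilb = \<lparr>carrier = UNIV, mult = undefined, one = undefined, zero = 0, add = (+),
     smult = (*), hinner = (\<lambda>x y. cnj x * y)\<rparr>"

definition zero_hilb :: "complex hilb" where
  "zero_hilb = complex_hilb\<lparr>carrier := {0}\<rparr>"


section \<open>Categories\<close>

record ('o, 'm) category =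
  Obj :: "'o set"
  Arr :: "'o \<Rightarrow> 'o \<Rightarrow> 'm set"
  Idt :: "'o \<Rightarrow> 'm"
  Cmp :: "'o \<Rightarrow> 'o \<Rightarrow> 'o \<Rightarrow> 'm \<Rightarrow> 'm \<Rightarrow> 'm"
  \<comment> \<open>\<open>Cmp C X Y Z g f\<close> is the composite \<open>g \<circ> f\<close> of \<open>f : X \<rightarrow> Y\<close> and \<open>g : Y \<rightarrow> Z\<close>\<close>

definition is_category :: "('o, 'm) category \<Rightarrow> bool" where
  "is_category C \<longleftrightarrow>
     (\<forall>X\<in>Obj C. Idt C X \<in> Arr C X X) \<and>
     (\<forall>X\<in>Obj C. \<forall>Y\<in>Obj C. \<forall>Z\<in>Obj C. \<forall>f\<in>Arr C X Y. \<forall>g\<in>Arr C Y Z.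
        Cmp C X Y Z g f \<in> Arr C X Z) \<and>
     (\<forall>X\<in>Obj C. \<forall>Y\<in>Obj C. \<forall>f\<in>Arr C X Y.
        Cmp C X X Y f (Idt C X) = f \<and> Cmp C X Y Y (Idt C Y) f = f) \<and>
     (\<forall>W\<in>Obj C. \<forall>X\<in>Obj C. \<forall>Y\<in>Obj C. \<forall>Z\<in>Obj C.
        \<forall>f\<in>Arr C W X. \<forall>g\<in>Arr C X Y. \<forall>h\<in>Arr C Y Z.
        Cmp C W Y Z h (Cmp C W X Y g f) = Cmp C W X Z (Cmp C X Y Z h g) f)"

definition is_functor ::
    "('o, 'm) category \<Rightarrow> ('p, 'n) category \<Rightarrow> ('o \<Rightarrow> 'p) \<Rightarrow> ('o \<Rightarrow> 'o \<Rightarrow> 'm \<Rightarrow> 'n) \<Rightarrow> bool" where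
  "is_functor C D Fo Fm \<longleftrightarrow>
     (\<forall>X\<in>Obj C. Fo X \<in> Obj D) \<and>
     (\<forall>X\<in>Obj C. \<forall>Y\<in>Obj C. \<forall>f\<in>Arr C X Y. Fm X Y f \<in> Arr D (Fo X) (Fo Y)) \<and>
     (\<forall>X\<in>Obj C. Fm X X (Idt C X) = Idt D (Fo X)) \<and>
     (\<forall>X\<in>Obj C. \<forall>Y\<in>Obj C. \<forall>Z\<in>Obj C. \<forall>f\<in>Arr C X Y. \<forall>g\<in>Arr C Y Z.
        Fm X Z (Cmp C X Y Z g f) = Cmp D (Fo X) (Fo Y) (Fo Z) (Fm Y Z g) (Fm X Y f))"

definition is_iso_arr :: "('o, 'm) category \<Rightarrow> 'o \<Rightarrow> 'o \<Rightarrow> 'm \<Rightarrow> bool" where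
  "is_iso_arr C X Y f \<longleftrightarrow>
     f \<in> Arr C X Y \<and>
     (\<exists>g\<in>Arr C Y X. Cmp C X Y X g f = Idt C X \<and> Cmp C Y X Y f g = Idt C Y)"

definition is_nat_iso ::
    "('o, 'm) category \<Rightarrow> ('p, 'n) category \<Rightarrow>
     ('o \<Rightarrow> 'p) \<Rightarrow> ('o \<Rightarrow> 'o \<Rightarrow> 'm \<Rightarrow> 'n) \<Rightarrow> ('o \<Rightarrow> 'p) \<Rightarrow> ('o \<Rightarrow> 'o \<Rightarrow> 'm \<Rightarrow> 'n) \<Rightarrow>
     ('o \<Rightarrow> 'n) \<Rightarrow> bool" where
  "is_nat_iso C D Fo Fm Go Gm \<eta> \<longleftrightarrow>
     (\<forall>X\<in>Obj C. is_iso_arr D (Fo X) (Go X) (\<eta> X)) \<and>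
     (\<forall>X\<in>Obj C. \<forall>Y\<in>Obj C. \<forall>f\<in>Arr C X Y.
        Cmp D (Fo X) (Fo Y) (Go Y) (\<eta> Y) (Fm X Y f) =
        Cmp D (Fo X) (Go X) (Go Y) (Gm X Y f) (\<eta> X))"

definition equivalent_categories :: "('o, 'm) category \<Rightarrow> ('p, 'n) category \<Rightarrow> bool" where
  "equivalent_categories C D \<longleftrightarrow>
     is_category C \<and> is_category D \<and>
     (\<exists>Fo Fm Go Gm \<eta> \<epsilon>.
        is_functor C D Fo Fm \<and> is_functor D C Go Gm \<and>
        is_nat_iso C C (\<lambda>X. X) (\<lambda>X Y f. f)
          (\<lambda>X. Go (Fo X)) (\<lambda>X Y f. Gm (Fo X) (Fo Y) (Fm X Y f)) \<eta> \<and>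
        is_nat_iso D D (\<lambda>X. Fo (Go X)) (\<lambda>X Y f. Fm (Go X) (Go Y) (Gm X Y f))
          (\<lambda>X. X) (\<lambda>X Y f. f) \<epsilon>)"


section \<open>Semirings of isomorphism classes and Grothendieck rings\<close>

text \<open>
  The direct sum of two objects of a fixed HOL type lives in another type, so the operations are
  supplied as predicates: \<open>is_sum X Y Z\<close> and \<open>is_tensor X Y Z\<close> mean that \<open>Z\<close> is isomorphic to the
  direct sum and to the tensor product of \<open>X\<close> and \<open>Y\<close>; similarly for \<open>is_zero\<close> and \<open>is_one\<close>.
\<close>

definition iso_class_semiring ::
    "'o set \<Rightarrow> ('o \<Rightarrow> 'o \<Rightarrow> bool) \<Rightarrow> ('o \<Rightarrow> 'o \<Rightarrow> 'o \<Rightarrow> bool) \<Rightarrow> ('o \<Rightarrow> 'o \<Rightarrow> 'o \<Rightarrow> bool) \<Rightarrow>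
     ('o \<Rightarrow> bool) \<Rightarrow> ('o \<Rightarrow> bool) \<Rightarrow> 'o set ring" where
  "iso_class_semiring Ob isom is_sum is_tensor is_zero is_one = \<lparr>
     carrier = (\<lambda>X. {Z \<in> Ob. isom X Z}) ` Ob,
     mult = (\<lambda>A B. {Z \<in> Ob. \<exists>X\<in>A. \<exists>Y\<in>B. is_tensor X Y Z}),
     one = {Z \<in> Ob. is_one Z},
     zero = {Z \<in> Ob. is_zero Z},
     add = (\<lambda>A B. {Z \<in> Ob. \<exists>X\<in>A. \<exists>Y\<in>B. is_sum X Y Z})\<rparr>"

text \<open>The pair \<open>(a, b)\<close> stands for the formal difference of \<open>a\<close> and \<open>b\<close>.\<close>

definition grothendieck_rel :: "'a ring \<Rightarrow> (('a \<times> 'a) \<times> ('a \<times> 'a)) set" where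
  "grothendieck_rel S =
     {((a, b), (c, d)). a \<in> carrier S \<and> b \<in> carrier S \<and> c \<in> carrier S \<and> d \<in> carrier S \<and>
        (\<exists>k\<in>carrier S. (a \<oplus>\<^bsub>S\<^esub> d) \<oplus>\<^bsub>S\<^esub> k = (c \<oplus>\<^bsub>S\<^esub> b) \<oplus>\<^bsub>S\<^esub> k)}"

definition grothendieck_ring :: "'a ring \<Rightarrow> ('a \<times> 'a) set ring" where
  "grothendieck_ring S = \<lparr>
     carrier = (carrier S \<times> carrier S) // grothendieck_rel S,
     mult = (\<lambda>A B. \<Union>(a, b)\<in>A. \<Union>(c, d)\<in>B. grothendieck_rel S ``
        {((a \<otimes>\<^bsub>S\<^esub> c) \<oplus>\<^bsub>S\<^esub> (b \<otimes>\<^bsub>S\<^esub> d), (a \<otimes>\<^bsub>S\<^esub> d) \<oplus>\<^bsub>S\<^esub> (b \<otimes>\<^bsub>S\<^esub> c))}),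
     one = grothendieck_rel S `` {(\<one>\<^bsub>S\<^esub>, \<zero>\<^bsub>S\<^esub>)},
     zero = grothendieck_rel S `` {(\<zero>\<^bsub>S\<^esub>, \<zero>\<^bsub>S\<^esub>)},
     add = (\<lambda>A B. \<Union>(a, b)\<in>A. \<Union>(c, d)\<in>B. grothendieck_rel S `` {(a \<oplus>\<^bsub>S\<^esub> c, b \<oplus>\<^bsub>S\<^esub> d)})\<rparr>"


section \<open>Hilbert net bundles\<close>

record ('k, 'e) net_bundle =
  tot_space :: "'e set"
  bundle_proj :: "'e \<Rightarrow> 'k"
  fibre :: "'k \<Rightarrow> 'e hilb"
  transport :: "'k \<Rightarrow> 'k \<Rightarrow> 'e \<Rightarrow> 'e"
  \<comment> \<open>\<open>transport X a' a\<close> is \<open>J\<^bsub>(a',a)\<^esub>\<close>; only its values on \<open>E\<^sub>a\<close> for \<open>a \<le> a'\<close> matter\<close>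

locale hilbert_net_bundle =
  fixes X :: "('k::order, 'e) net_bundle"
  assumes proj_surj: "bundle_proj X ` tot_space X = UNIV"
    and carrier_fibre: "carrier (fibre X a) = {x \<in> tot_space X. bundle_proj X x = a}"
    and hilbert_fibre: "hilbert_space (fibre X a)"
    and transport_unitary:
      "a \<le> a' \<Longrightarrow> is_unitary (fibre X a) (fibre X a') (transport X a' a)"
    and transport_id: "x \<in> carrier (fibre X a) \<Longrightarrow> transport X a a x = x"
    and transport_comp:
      "\<lbrakk>a \<le> a'; a' \<le> a''; x \<in> carrier (fibre X a)\<rbrakk> \<Longrightarrow>
       transport X a'' a' (transport X a' a x) = transport X a'' a x"

definition fd_net_bundles :: "('k::order, 'e) net_bundle set" where
  "fd_net_bundles = {X. hilbert_net_bundle X \<and> (\<forall>a. finite_dim (fibre X a))}"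

definition net_morphisms ::
    "('k::order, 'e) net_bundle \<Rightarrow> ('k, 'f) net_bundle \<Rightarrow> ('k \<Rightarrow> 'e \<Rightarrow> 'f) set" where
  "net_morphisms X Y =
     {T. (\<forall>a. T a \<in> bounded_ops (fibre X a) (fibre Y a)) \<and>
         (\<forall>a a'. a \<le> a' \<longrightarrow> (\<forall>x\<in>carrier (fibre X a).
            T a' (transport X a' a x) = transport Y a' a (T a x)))}"

definition net_id :: "('k, 'e) net_bundle \<Rightarrow> 'k \<Rightarrow> 'e \<Rightarrow> 'e" where
  "net_id X = (\<lambda>a. restrict id (carrier (fibre X a)))"

definition net_comp ::
    "('k, 'e) net_bundle \<Rightarrow> ('k \<Rightarrow> 'f \<Rightarrow> 'g) \<Rightarrow> ('k \<Rightarrow> 'e \<Rightarrow> 'f) \<Rightarrow> 'k \<Rightarrow> 'e \<Rightarrow> 'g" where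
  "net_comp X S T = (\<lambda>a. compose (carrier (fibre X a)) (S a) (T a))"

definition net_isomorphic ::
    "('k::order, 'e) net_bundle \<Rightarrow> ('k, 'f) net_bundle \<Rightarrow> bool" where
  "net_isomorphic X Y \<longleftrightarrow>
     (\<exists>T\<in>net_morphisms X Y. \<exists>S\<in>net_morphisms Y X.
        net_comp X S T = net_id X \<and> net_comp Y T S = net_id Y)"

text \<open>
  The type arguments of \<open>V_net\<close>, \<open>K0\<close> and of their analogues for representations below record the
  HOL type in which the total spaces, respectively the representation spaces, are taken. This type
  plays the role of a universe of sets: as fibres are disjoint and \<open>\<complex>\<^sup>n\<close> has the cardinality of
  \<open>\<complex>\<close>, a type of at least the cardinality of \<open>K \<times> \<complex>\<close> (respectively of \<open>\<complex>\<close>) contains an isomorphic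
  copy of every finite-dimensional bundle (respectively representation).
\<close>

definition V_net ::
    "'k::order itself \<Rightarrow> 'e itself \<Rightarrow> (('k, 'e) net_bundle, 'k \<Rightarrow> 'e \<Rightarrow> 'e) category" where
  "V_net _ _ = \<lparr>
     Obj = fd_net_bundles,
     Arr = net_morphisms,
     Idt = net_id,
     Cmp = (\<lambda>X Y Z. net_comp X)\<rparr>"

definition net_sum ::
    "('k, 'e) net_bundle \<Rightarrow> ('k, 'f) net_bundle \<Rightarrow> ('k, 'e \<times> 'f) net_bundle" where
  "net_sum X Y = \<lparr>
     tot_space = {(x, y). x \<in> tot_space X \<and> y \<in> tot_space Y \<and> bundle_proj X x = bundle_proj Y y},
     bundle_proj = (\<lambda>(x, y). bundle_proj X x),
     fibre = (\<lambda>a. hilb_sum (fibre X a) (fibre Y a)),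
     transport = (\<lambda>a' a (x, y). (transport X a' a x, transport Y a' a y))\<rparr>"

definition is_net_tensor ::
    "('k::order, 'e) net_bundle \<Rightarrow> ('k, 'f) net_bundle \<Rightarrow> ('k, 'g) net_bundle \<Rightarrow> bool" where
  "is_net_tensor X Y W \<longleftrightarrow>
     (\<exists>t. (\<forall>a. is_hilb_tensor (fibre X a) (fibre Y a) (fibre W a) (t a)) \<and>
          (\<forall>a a'. a \<le> a' \<longrightarrow> (\<forall>x\<in>carrier (fibre X a). \<forall>y\<in>carrier (fibre Y a).
             transport W a' a (t a x y) = t a' (transport X a' a x) (transport Y a' a y))))"

text \<open>The bundle \<open>K \<times> H\<close> with identical transport.\<close>

definition trivial_bundle :: "'v hilb \<Rightarrow> ('k, 'k \<times> 'v) net_bundle" where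
  "trivial_bundle H = \<lparr>
     tot_space = UNIV \<times> carrier H,
     bundle_proj = fst,
     fibre = (\<lambda>a. \<lparr>
       carrier = {a} \<times> carrier H,
       mult = undefined, one = undefined,
       zero = (a, \<zero>\<^bsub>H\<^esub>),
       add = (\<lambda>x y. (a, snd x \<oplus>\<^bsub>H\<^esub> snd y)),
       smult = (\<lambda>c x. (a, c \<odot>\<^bsub>H\<^esub> snd x)),
       hinner = (\<lambda>x y. hinner H (snd x) (snd y))\<rparr>),
     transport = (\<lambda>a' a x. (a', snd x))\<rparr>"

definition net_semiring ::
    "'k::order itself \<Rightarrow> 'e itself \<Rightarrow> ('k, 'e) net_bundle set ring" where
  "net_semiring _ _ = iso_class_semiring
     fd_net_bundles
     net_isomorphic
     (\<lambda>X Y Z. net_isomorphic (net_sum X Y) Z)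
     (\<lambda>X Y Z. \<exists>W\<in>fd_net_bundles :: ('k, 'e) net_bundle set.
        is_net_tensor X Y W \<and> net_isomorphic W Z)
     (\<lambda>Z. net_isomorphic (trivial_bundle zero_hilb) Z)
     (\<lambda>Z. net_isomorphic (trivial_bundle complex_hilb) Z)"

definition K0 ::
    "'k::order itself \<Rightarrow> 'e itself \<Rightarrow>
     (('k, 'e) net_bundle set \<times> ('k, 'e) net_bundle set) set ring" where
  "K0 k e = grothendieck_ring (net_semiring k e)"


section \<open>Unitary representations\<close>

record ('g, 'v) rep =
  space :: "'v hilb"
  act :: "'g \<Rightarrow> 'v \<Rightarrow> 'v"

locale unitary_rep =
  fixes G :: "'g monoid" and V :: "('g, 'v) rep"
  assumes hilbert: "hilbert_space (space V)"
    and act_unitary: "g \<in> carrier G \<Longrightarrow> is_unitary (space V) (space V) (act V g)"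
    and act_one: "x \<in> carrier (space V) \<Longrightarrow> act V \<one>\<^bsub>G\<^esub> x = x"
    and act_mult:
      "\<lbrakk>g \<in> carrier G; h \<in> carrier G; x \<in> carrier (space V)\<rbrakk> \<Longrightarrow>
       act V (g \<otimes>\<^bsub>G\<^esub> h) x = act V g (act V h x)"

definition fd_reps :: "'g monoid \<Rightarrow> ('g, 'v) rep set" where
  "fd_reps G = {V. unitary_rep G V \<and> finite_dim (space V)}"

definition intertwiners ::
    "'g monoid \<Rightarrow> ('g, 'v) rep \<Rightarrow> ('g, 'w) rep \<Rightarrow> ('v \<Rightarrow> 'w) set" where
  "intertwiners G V W =
     {T \<in> bounded_ops (space V) (space W).
        \<forall>g\<in>carrier G. \<forall>x\<in>carrier (space V). T (act V g x) = act W g (T x)}"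

definition rep_id :: "('g, 'v) rep \<Rightarrow> 'v \<Rightarrow> 'v" where
  "rep_id V = restrict id (carrier (space V))"

definition rep_comp :: "('g, 'u) rep \<Rightarrow> ('v \<Rightarrow> 'w) \<Rightarrow> ('u \<Rightarrow> 'v) \<Rightarrow> 'u \<Rightarrow> 'w" where
  "rep_comp V S T = compose (carrier (space V)) S T"

definition rep_isomorphic :: "'g monoid \<Rightarrow> ('g, 'v) rep \<Rightarrow> ('g, 'w) rep \<Rightarrow> bool" where
  "rep_isomorphic G V W \<longleftrightarrow>
     (\<exists>T\<in>intertwiners G V W. \<exists>S\<in>intertwiners G W V.
        rep_comp V S T = rep_id V \<and> rep_comp W T S = rep_id W)"

definition Rep :: "'g monoid \<Rightarrow> 'v itself \<Rightarrow> (('g, 'v) rep, 'v \<Rightarrow> 'v) category" where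
  "Rep G _ = \<lparr>
     Obj = fd_reps G,
     Arr = intertwiners G,
     Idt = rep_id,
     Cmp = (\<lambda>V W Z. rep_comp V)\<rparr>"

definition rep_sum :: "('g, 'v) rep \<Rightarrow> ('g, 'w) rep \<Rightarrow> ('g, 'v \<times> 'w) rep" where
  "rep_sum V W = \<lparr>
     space = hilb_sum (space V) (space W),
     act = (\<lambda>g (x, y). (act V g x, act W g y))\<rparr>"

definition is_rep_tensor ::
    "'g monoid \<Rightarrow> ('g, 'u) rep \<Rightarrow> ('g, 'v) rep \<Rightarrow> ('g, 'w) rep \<Rightarrow> bool" where
  "is_rep_tensor G U V W \<longleftrightarrow>
     (\<exists>t. is_hilb_tensor (space U) (space V) (space W) t \<and>
          (\<forall>g\<in>carrier G. \<forall>x\<in>carrier (space U). \<forall>y\<in>carrier (space V).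
             act W g (t x y) = t (act U g x) (act V g y)))"

definition trivial_rep :: "'v hilb \<Rightarrow> ('g, 'v) rep" where
  "trivial_rep H = \<lparr>space = H, act = (\<lambda>g x. x)\<rparr>"

definition rep_semiring :: "'g monoid \<Rightarrow> 'v itself \<Rightarrow> ('g, 'v) rep set ring" where
  "rep_semiring G _ = iso_class_semiring
     (fd_reps G)
     (rep_isomorphic G)
     (\<lambda>U V Z. rep_isomorphic G (rep_sum U V) Z)
     (\<lambda>U V Z. \<exists>W\<in>fd_reps G :: ('g, 'v) rep set.
        is_rep_tensor G U V W \<and> rep_isomorphic G W Z)
     (\<lambda>Z. rep_isomorphic G (trivial_rep zero_hilb) Z)
     (\<lambda>Z. rep_isomorphic G (trivial_rep complex_hilb) Z)"

definition representation_ring ::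
    "'g monoid \<Rightarrow> 'v itself \<Rightarrow> (('g, 'v) rep set \<times> ('g, 'v) rep set) set ring" where
  "representation_ring G v = grothendieck_ring (rep_semiring G v)"

end

(*
  Parallel transport along paths is invariant under homotopy, so a net bundle X has a holonomy
  representation of pi_1(K, a) on its fibre over a. Since K is connected, an intertwiner of
  holonomies (indeed any equivariant map) spreads along paths to a unique morphism of bundles, and
  a representation is the holonomy of the bundle whose transport J_(y,x) is the action of the loop
  obtained by closing up the edge x <= y with chosen paths from a; hence holonomy is an equivalence.
  For the rings, "holonomy of X is isomorphic to V" is a correspondence between bundles and
  representations that matches isomorphism, direct sums, tensor products and units on both sides.
  As a tensor product depends on the inner products, and not only on the isomorphism classes, that
  last point uses that each representation is even unitarily equivalent to a holonomy.
*)

theory Submission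
  imports Defs
begin

section \<open>The homotopy groupoid of a poset\<close>

text \<open>Two obstacles shape the proof. The first is that HOL types act as universes: the
  holonomy of a bundle lives on a fibre, in type \<open>'e\<close>, whereas \<open>Rep\<close> asks
  for spaces in type \<open>'v\<close>, and direct sums live in product types. A finite-dimensional
  space injects into the complex numbers, so an object can be copied unitarily into a prescribed
  type. Direct sums and trivial objects are handled instead through predicates weaker than the
  Hilbert space axioms (\<open>pre_hilb\<close>, \<open>isometric_net\<close>,
  \<open>act_closed\<close>), which suffice for transport and isomorphism. The second obstacle is
  that the semirings are given by predicates on objects rather than by closed operations; the ring
  isomorphism is therefore set up on all isomorphism-closed sets of objects. The chosen paths from
  \<open>a\<close> are arbitrary, and the one from \<open>a\<close> to itself may be an essential
  loop; this is met by showing independence of the path, or by conjugating with that loop.\<close>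

abbreviation edge :: "'k \<Rightarrow> 'k \<Rightarrow> 'k simplex1" where
  "edge y x \<equiv> \<lparr>supp1 = y, bd0 = y, bd1 = x\<rparr>"

section \<open>Paths, walks and reversal\<close>

definition rev_simplex :: "'k simplex1 \<Rightarrow> 'k simplex1" where
  "rev_simplex b = \<lparr>supp1 = supp1 b, bd0 = bd1 b, bd1 = bd0 b\<rparr>"

definition rev_path :: "'k simplex1 list \<Rightarrow> 'k simplex1 list" where
  "rev_path p = rev (map rev_simplex p)"

text \<open>Unlike \<open>is_path\<close>, this admits the empty list, so lists can be split at any
  point and treated by induction. The head of a list is the simplex traversed last, hence the
  recursion moves the end point \<open>y\<close> and keeps the start \<open>x\<close>.\<close>

fun walk :: "'k::order simplex1 list \<Rightarrow> 'k \<Rightarrow> 'k \<Rightarrow> bool" where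
  "walk [] x y \<longleftrightarrow> x = y"
| "walk (b # p) x y \<longleftrightarrow> is_simplex1 b \<and> bd0 b = y \<and> walk p x (bd1 b)"

lemma is_path_Cons:
  "is_path (b # p) x y \<longleftrightarrow>
     is_simplex1 b \<and> bd0 b = y \<and> (if p = [] then bd1 b = x else is_path p x (bd1 b))"
proof (cases p)
  case (Cons c q)
  have "(\<forall>i. Suc i < length (b # p) \<longrightarrow> bd1 ((b # p) ! i) = bd0 ((b # p) ! Suc i)) \<longleftrightarrow>
      bd1 b = bd0 c \<and> (\<forall>i. Suc i < length p \<longrightarrow> bd1 (p ! i) = bd0 (p ! Suc i))"
    \<comment> \<open>Splits off the index 0, which is the joint between \<open>b\<close> and
      \<open>c\<close>; the remaining indices are the joints of \<open>p\<close>.\<close>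
    using All_less_Suc2[of "length q" "\<lambda>i. bd1 ((b # p) ! i) = bd0 ((b # p) ! Suc i)"]
    by (simp add: Cons)
  then show ?thesis
    unfolding is_path_def using Cons by auto
qed (auto simp: is_path_def)

lemma is_path_iff_walk: "is_path p x y \<longleftrightarrow> p \<noteq> [] \<and> walk p x y"
proof (induction p arbitrary: y)
  case Nil
  then show ?case by (simp add: is_path_def)
next
  case (Cons b p)
  then show ?case by (cases "p = []") (auto simp: is_path_Cons)
qed

lemma walk_append: "walk (p @ q) x y \<longleftrightarrow> (\<exists>z. walk q x z \<and> walk p z y)"
  by (induction p arbitrary: y) auto

lemma is_path_append:
  "\<lbrakk>is_path q x z; is_path p z y\<rbrakk> \<Longrightarrow> is_path (p @ q) x y"
  by (auto simp: is_path_iff_walk walk_append)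

lemma is_path_simplex: "is_simplex1 b \<Longrightarrow> is_path [b] (bd1 b) (bd0 b)"
  by (simp add: is_path_iff_walk)

lemma is_path_edge: "x \<le> y \<Longrightarrow> is_path [edge y x] x y"
  by (simp add: is_path_iff_walk is_simplex1_def)

lemma walk_rev: "walk p x y \<Longrightarrow> walk (rev_path p) y x"
  by (induction p arbitrary: y)
    (auto simp: rev_path_def walk_append rev_simplex_def is_simplex1_def)

lemma is_path_rev: "is_path p x y \<Longrightarrow> is_path (rev_path p) y x"
  using walk_rev[of p x y] by (auto simp: is_path_iff_walk rev_path_def)

lemma rev_rev_path [simp]: "rev_path (rev_path p) = p"
  by (induction p) (auto simp: rev_path_def rev_simplex_def)

section \<open>Homotopy as a congruence on lists\<close>

lemma homotopic_refl [simp]: "homotopic p p"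
  by (simp add: homotopic_def)

lemma homotopic_sym: "homotopic p q \<Longrightarrow> homotopic q p"
  unfolding homotopic_def by (rule equivclp_sym)

lemma homotopic_trans [trans]: "\<lbrakk>homotopic p q; homotopic q r\<rbrakk> \<Longrightarrow> homotopic p r"
  unfolding homotopic_def by (rule equivclp_trans)

lemma homotopic_step: "is_simplex2 c \<Longrightarrow> homotopic [face1 c] [face0 c, face2 c]"
  unfolding homotopic_def
  using homotopy_step.intros[of c "[]" "[]"] by (simp add: r_into_equivclp)

text \<open>Homotopy is the least equivalence relation containing the elementary replacements in
  arbitrary context, so it is contained in any other such relation. Homotopy invariants are obtained
  in this way.\<close>

lemma homotopic_induct [consumes 1, case_names step symm refl trans]:
  assumes "homotopic p q"
    and step: "\<And>c u v. is_simplex2 c \<Longrightarrow> P (u @ [face1 c] @ v) (u @ [face0 c, face2 c] @ v)"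
    and symm: "\<And>p q. P p q \<Longrightarrow> P q p"
    and refl: "\<And>p. P p p"
    and trans: "\<And>p q r. P p q \<Longrightarrow> P q r \<Longrightarrow> P p r"
  shows "P p q"
  using assms(1) unfolding homotopic_def
proof (induction rule: equivclp_induct)
  case base
  show ?case by (rule refl)
next
  case (step q r)
  have "homotopy_step s t \<Longrightarrow> P s t" for s t
    by (auto elim!: homotopy_step.cases intro: assms(2)[simplified])
  then have "P q r"
    using step.hyps(2) symm by blast
  then show ?case by (rule trans[OF step.IH])
qed

lemma homotopic_context:
  assumes "homotopic p q" shows "homotopic (u @ p @ v) (u @ q @ v)"
  using assms
proof (induction rule: homotopic_induct)
  case (step c u' v')
  have "homotopy_step ((u @ u') @ [face1 c] @ (v' @ v)) ((u @ u') @ [face0 c, face2 c] @ (v' @ v))"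
    using step by (rule homotopy_step.intros)
  then show ?case
    unfolding homotopic_def by (simp add: r_into_equivclp)
qed (auto intro: homotopic_sym homotopic_trans)

lemma homotopic_append:
  assumes "homotopic p p'" "homotopic q q'" shows "homotopic (p @ q) (p' @ q')"
proof -
  have "homotopic (p @ q) (p' @ q)" "homotopic (p' @ q) (p' @ q')"
    using homotopic_context[OF assms(1), of "[]" q] homotopic_context[OF assms(2), of p' "[]"]
    by simp_all
  then show ?thesis by (rule homotopic_trans)
qed

text \<open>The faces of a 2-simplex fit together: face 0 after face 2 has the same ends as face 1,
  and the two match at the middle vertex. As only such segments are exchanged, the ends of the whole
  list persist.\<close>

lemma homotopic_is_path:
  assumes "homotopic p q" shows "is_path p x y \<longleftrightarrow> is_path q x y"
  using assms
proof (induction rule: homotopic_induct)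
  case (step c u v)
  then show ?case
    by (auto simp: is_path_iff_walk walk_append is_simplex2_def)
qed auto

text \<open>A triangle of 1-simplices whose supports have a common upper bound is the boundary of a
  2-simplex. The homotopies between explicit short paths below are instances.\<close>

lemma homotopic_refine:
  assumes "is_simplex1 b" "is_simplex1 b'" "is_simplex1 b''" "s \<ge> supp1 b" "s \<ge> supp1 b'" "s \<ge> supp1 b''"
    and "bd0 b' = bd0 b''" "bd1 b' = bd1 b" "bd0 b = bd1 b''"
  shows "homotopic [b'', b] [b']"
  using homotopic_step[of "\<lparr>supp2 = s, face0 = b'', face1 = b', face2 = b\<rparr>"] assms
  by (simp add: is_simplex2_def homotopic_sym)

text \<open>A null edge is absorbed by the simplex traversed right after it, via a degenerate
  triangle. That simplex exists because a path is non-empty; it stands at the end of the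
  list.\<close>

lemma homotopic_null_right:
  assumes "is_path p x y" shows "homotopic (p @ [edge x x]) p"
proof -
  define b where "b = last p"
  have p: "p = butlast p @ [b]"
    using assms by (simp add: is_path_def b_def)
  have b: "is_simplex1 b" "bd1 b = x"
    using assms unfolding is_path_iff_walk by (subst (asm) (2) p, auto simp: walk_append)+
  have "homotopic [b, edge x x] [b]"
    using b by (intro homotopic_refine[where s = "supp1 b"]) (auto simp: is_simplex1_def)
  from homotopic_context[OF this, of "butlast p" "[]"] show ?thesis
    using p by (metis append.assoc append_Cons append_Nil append_Nil2)
qed

lemma homotopic_null_left:
  assumes "is_path p x y" shows "homotopic ([edge y y] @ p) p"
proof -
  obtain b q where p: "p = b # q"
    using assms by (cases p) (auto simp: is_path_def)
  have "homotopic [edge y y, b] [b]"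
    using assms unfolding p is_path_Cons
    by (intro homotopic_refine[where s = "supp1 b"]) (auto simp: is_simplex1_def)
  from homotopic_context[OF this, of "[]" q] show ?thesis
    using p by simp
qed

lemma homotopic_rev_right:
  assumes "is_path p x y" shows "homotopic (p @ rev_path p) [edge y y]"
  using assms
proof (induction p arbitrary: y)
  case Nil
  then show ?case by (simp add: is_path_def)
next
  case (Cons b p)
  let ?b = "rev_simplex b"
  have b: "is_simplex1 b" "bd0 b = y"
    using Cons.prems by (auto simp: is_path_Cons)
  have bb: "homotopic ([b] @ [?b]) [edge y y]"
    unfolding append.simps using b
    by (intro homotopic_refine[where s = "supp1 b"]) (auto simp: is_simplex1_def rev_simplex_def)
  show ?case
  proof (cases "p = []")
    case True
    then show ?thesis using bb by (simp add: rev_path_def)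
  next
    case False
    then have p: "is_path p x (bd1 b)"
      using Cons.prems by (auto simp: is_path_Cons)
    \<comment> \<open>The inner backtracking contracts to a null edge at the vertex where
      \<open>b\<close> starts, and \<open>b\<close> absorbs it; what is left is \<open>b\<close>
      with its own reverse.\<close>
    have "homotopic ([b] @ (p @ rev_path p) @ [?b]) ([b] @ [edge (bd1 b) (bd1 b)] @ [?b])"
      by (intro homotopic_context Cons.IH p)
    also have "homotopic \<dots> ([b] @ [?b])"
      using homotopic_null_right[OF is_path_simplex[OF b(1)]]
      by (metis homotopic_append homotopic_refl append.assoc)
    also note bb
    finally show ?thesis
      by (simp add: rev_path_def)
  qed
qed

lemma homotopic_rev_left:
  assumes "is_path p x y" shows "homotopic (rev_path p @ p) [edge x x]"
  using homotopic_rev_right[OF is_path_rev[OF assms]] by simp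

lemma homotopic_edge_comp:
  assumes "x \<le> y" "y \<le> z" shows "homotopic ([edge z y] @ [edge y x]) [edge z x]"
  unfolding append.simps using assms
  by (intro homotopic_refine[where s = z]) (auto simp: is_simplex1_def)

text \<open>In the fundamental groupoid a simplex is thus the ascent from its start to its support
  followed by the reversed ascent from its end, in parallel with the formula for
  \<open>simplex_transport\<close>.\<close>

lemma homotopic_edge_simplex:
  assumes "is_simplex1 b"
  shows "homotopic ([edge (supp1 b) (bd0 b)] @ [b]) [edge (supp1 b) (bd1 b)]"
  unfolding append.simps using assms
  by (intro homotopic_refine[where s = "supp1 b"]) (auto simp: is_simplex1_def)

text \<open>The left context \<open>u\<close> is a path, so that it can absorb the null edge
  remaining after the cancellation; \<open>v\<close> is an arbitrary list.\<close>

lemma homotopic_cancel: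
  assumes "is_path p x y" "is_path u y z"
  shows "homotopic (u @ (p @ rev_path p) @ v) (u @ v)"
proof -
  have "homotopic (u @ (p @ rev_path p) @ v) (u @ [edge y y] @ v)"
    by (rule homotopic_context[OF homotopic_rev_right[OF assms(1)]])
  also have "homotopic \<dots> (u @ v)"
    using homotopic_append[OF homotopic_null_right[OF assms(2)] homotopic_refl[of v]] by simp
  finally show ?thesis .
qed

section \<open>The fundamental group\<close>

lemma homotopy_class_eq_iff: "homotopy_class p = homotopy_class q \<longleftrightarrow> homotopic p q"
  unfolding homotopy_class_def using homotopic_refl homotopic_sym homotopic_trans by blast

lemma homotopic_some_class: "homotopic p (SOME q. q \<in> homotopy_class p)"
  using someI[of "\<lambda>q. q \<in> homotopy_class p" p] by (simp add: homotopy_class_def)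

text \<open>The product set of two classes is a full class because homotopy is compatible with
  concatenation, for arbitrary lists.\<close>

lemma pi1_mult: "homotopy_class p \<otimes>\<^bsub>pi1 a\<^esub> homotopy_class q = homotopy_class (p @ q)"
  unfolding pi1_def homotopy_class_def
  by (auto intro: homotopic_append homotopic_trans) (meson homotopic_refl)

lemma pi1_one: "\<one>\<^bsub>pi1 a\<^esub> = homotopy_class [edge a a]"
  by (simp add: pi1_def)

lemma pi1_carrier: "carrier (pi1 a) = homotopy_class ` {p. is_path p a a}"
  by (simp add: pi1_def)

section \<open>Operators between Hilbert spaces\<close>

text \<open>
  The part of the Hilbert space axioms that survives without further proof in direct sums and in
  trivial bundles, and which suffices to compose bounded operators.
\<close>

definition pre_hilb :: "'v hilb \<Rightarrow> bool" where
  "pre_hilb H \<longleftrightarrow>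
     (\<forall>x\<in>carrier H. \<forall>y\<in>carrier H. x \<oplus>\<^bsub>H\<^esub> y \<in> carrier H) \<and>
     (\<forall>c. \<forall>x\<in>carrier H. c \<odot>\<^bsub>H\<^esub> x \<in> carrier H) \<and>
     (\<forall>x\<in>carrier H. 0 \<le> Re (hinner H x x))"

lemma carrier_complex_ring [simp]: "carrier complex_ring = UNIV"
  by (simp add: complex_ring_def)

lemma complex_ring_simps:
  "x \<oplus>\<^bsub>complex_ring\<^esub> y = x + y" "x \<otimes>\<^bsub>complex_ring\<^esub> y = x * y"
  "\<zero>\<^bsub>complex_ring\<^esub> = 0" "\<one>\<^bsub>complex_ring\<^esub> = 1"
  by (simp_all add: complex_ring_def)

lemma (in hilbert_space) inner_zero: "x \<in> carrier H \<Longrightarrow> hinner H x \<zero>\<^bsub>H\<^esub> = 0"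
  using inner_smult[of x "\<zero>\<^bsub>H\<^esub>" 0] smult_r_null[of 0] by simp

lemma (in hilbert_space) pre_hilb: "pre_hilb H"
  unfolding pre_hilb_def
proof (intro conjI ballI allI)
  fix x assume x: "x \<in> carrier H"
  show "0 \<le> Re (hinner H x x)"
    using inner_pos[OF x] inner_zero[OF x] by (cases "x = \<zero>\<^bsub>H\<^esub>") auto
qed auto

text \<open>\<open>bounded_ops\<close> without extensionality, so that composites can be formed as
  plain abstractions and restricted to the carrier at the very end.\<close>

definition bounded_lin :: "'v hilb \<Rightarrow> 'w hilb \<Rightarrow> ('v \<Rightarrow> 'w) \<Rightarrow> bool" where
  "bounded_lin H K T \<longleftrightarrow>
     is_linear H K T \<and> (\<exists>M. \<forall>x\<in>carrier H. hnorm K (T x) \<le> M * hnorm H x)"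

lemma bounded_ops_iff:
  "T \<in> bounded_ops H K \<longleftrightarrow> T \<in> extensional (carrier H) \<and> bounded_lin H K T"
  by (simp add: bounded_ops_def bounded_lin_def)

lemma is_linear_closed: "\<lbrakk>is_linear H K T; x \<in> carrier H\<rbrakk> \<Longrightarrow> T x \<in> carrier K"
  by (auto simp: is_linear_def)

lemma bounded_lin_closed: "\<lbrakk>bounded_lin H K T; x \<in> carrier H\<rbrakk> \<Longrightarrow> T x \<in> carrier K"
  by (auto simp: bounded_lin_def is_linear_closed)

lemma is_unitary_closed: "\<lbrakk>is_unitary H K T; x \<in> carrier H\<rbrakk> \<Longrightarrow> T x \<in> carrier K"
  by (auto simp: is_unitary_def is_linear_closed)

lemma is_linear_cong:
  assumes "pre_hilb H" "\<And>x. x \<in> carrier H \<Longrightarrow> T x = S x"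
  shows "is_linear H K T \<longleftrightarrow> is_linear H K S"
  using assms unfolding is_linear_def pre_hilb_def by (auto simp: Pi_def)

lemma bounded_lin_cong:
  assumes "pre_hilb H" "\<And>x. x \<in> carrier H \<Longrightarrow> T x = S x"
  shows "bounded_lin H K T \<longleftrightarrow> bounded_lin H K S"
  unfolding bounded_lin_def using is_linear_cong[OF assms] assms(2) by auto

lemma is_unitary_cong:
  assumes "pre_hilb H" "\<And>x. x \<in> carrier H \<Longrightarrow> T x = S x"
  shows "is_unitary H K T \<longleftrightarrow> is_unitary H K S"
proof -
  have "bij_betw T (carrier H) (carrier K) \<longleftrightarrow> bij_betw S (carrier H) (carrier K)"
    by (rule bij_betw_cong) (rule assms(2))
  then show ?thesis
    unfolding is_unitary_def using is_linear_cong[OF assms, where K = K] assms(2) by auto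
qed

lemma bounded_lin_restrict:
  "pre_hilb H \<Longrightarrow> bounded_lin H K (restrict T (carrier H)) \<longleftrightarrow> bounded_lin H K T"
  by (rule bounded_lin_cong) auto

lemma is_linear_compose:
  "\<lbrakk>is_linear H K T; is_linear K L S\<rbrakk> \<Longrightarrow> is_linear H L (\<lambda>x. S (T x))"
  by (auto simp: is_linear_def Pi_def)

lemma hnorm_nonneg: "\<lbrakk>pre_hilb H; x \<in> carrier H\<rbrakk> \<Longrightarrow> 0 \<le> hnorm H x"
  by (simp add: pre_hilb_def hnorm_def)

text \<open>Composing two estimates multiplies one of them by the constant of the other, which
  preserves the inequality if that constant is nonnegative; hence the passage to the absolute
  value.\<close>

lemma bounded_lin_nonneg_bound:
  assumes "pre_hilb H" "bounded_lin H K T"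
  obtains M where "0 \<le> M" "\<And>x. x \<in> carrier H \<Longrightarrow> hnorm K (T x) \<le> M * hnorm H x"
proof -
  obtain M where M: "\<forall>x\<in>carrier H. hnorm K (T x) \<le> M * hnorm H x"
    using assms by (auto simp: bounded_lin_def)
  have "hnorm K (T x) \<le> \<bar>M\<bar> * hnorm H x" if "x \<in> carrier H" for x
    using M hnorm_nonneg[OF assms(1) that] that
    by (meson abs_ge_self dual_order.trans mult_right_mono)
  then show thesis using that[of "\<bar>M\<bar>"] by auto
qed

lemma bounded_lin_compose:
  assumes "pre_hilb H" "pre_hilb K" "bounded_lin H K T" "bounded_lin K L S"
  shows "bounded_lin H L (\<lambda>x. S (T x))"
proof -
  obtain M N where M: "\<And>x. x \<in> carrier H \<Longrightarrow> hnorm K (T x) \<le> M * hnorm H x"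
    and N: "0 \<le> N" "\<And>x. x \<in> carrier K \<Longrightarrow> hnorm L (S x) \<le> N * hnorm K x"
    using assms bounded_lin_nonneg_bound by metis
  have "hnorm L (S (T x)) \<le> (N * M) * hnorm H x" if "x \<in> carrier H" for x
    using N(2)[OF bounded_lin_closed[OF assms(3) that]] mult_left_mono[OF M[OF that] N(1)]
    by (simp add: mult.assoc)
  then show ?thesis
    using assms is_linear_compose unfolding bounded_lin_def by blast
qed

lemma bounded_lin_id: "bounded_lin H H (\<lambda>x. x)"
  by (auto simp: bounded_lin_def is_linear_def intro: exI[of _ 1])

lemma is_unitary_id: "is_unitary H H (\<lambda>x. x)"
  by (auto simp: is_unitary_def is_linear_def bij_betw_def)

lemma is_unitary_bounded: "is_unitary H K U \<Longrightarrow> bounded_lin H K U"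
  by (auto simp: bounded_lin_def is_unitary_def hnorm_def intro: exI[of _ 1])

lemma is_unitary_compose:
  assumes "is_unitary H K T" "is_unitary K L S"
  shows "is_unitary H L (\<lambda>x. S (T x))"
  using assms is_linear_compose[of H K T L S] bij_betw_trans[of T _ _ S] is_unitary_closed[OF assms(1)]
  by (auto simp: is_unitary_def comp_def)

lemma is_unitary_inv_closed:
  "\<lbrakk>is_unitary H K U; y \<in> carrier K\<rbrakk> \<Longrightarrow> inv_into (carrier H) U y \<in> carrier H"
  by (auto simp: is_unitary_def bij_betw_def intro: inv_into_into)

lemma is_unitary_inv_left:
  "\<lbrakk>is_unitary H K U; x \<in> carrier H\<rbrakk> \<Longrightarrow> inv_into (carrier H) U (U x) = x"
  by (auto simp: is_unitary_def bij_betw_def)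

lemma is_unitary_inv_right:
  "\<lbrakk>is_unitary H K U; y \<in> carrier K\<rbrakk> \<Longrightarrow> U (inv_into (carrier H) U y) = y"
  by (auto simp: is_unitary_def bij_betw_def f_inv_into_f)

lemma is_unitary_inj:
  "\<lbrakk>is_unitary H K U; x \<in> carrier H; y \<in> carrier H; U x = U y\<rbrakk> \<Longrightarrow> x = y"
  by (auto simp: is_unitary_def bij_betw_def inj_on_def)

lemma is_unitary_ex:
  "\<lbrakk>is_unitary H K U; y \<in> carrier K\<rbrakk> \<Longrightarrow> \<exists>x\<in>carrier H. y = U x"
  by (metis is_unitary_inv_closed is_unitary_inv_right)

text \<open>Points of \<open>K\<close> are written as images under \<open>U\<close>, where linearity
  and isometry apply and the inverse cancels.\<close>

lemma is_unitary_inv: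
  assumes "pre_hilb H" and U: "is_unitary H K U"
  shows "is_unitary K H (inv_into (carrier H) U)"
proof -
  let ?V = "inv_into (carrier H) U"
  have lin: "\<And>x y. x \<in> carrier H \<Longrightarrow> y \<in> carrier H \<Longrightarrow> U (x \<oplus>\<^bsub>H\<^esub> y) = U x \<oplus>\<^bsub>K\<^esub> U y"
    "\<And>c x. x \<in> carrier H \<Longrightarrow> U (c \<odot>\<^bsub>H\<^esub> x) = c \<odot>\<^bsub>K\<^esub> U x"
    and iso: "\<And>x y. x \<in> carrier H \<Longrightarrow> y \<in> carrier H \<Longrightarrow> hinner K (U x) (U y) = hinner H x y"
    and bij: "bij_betw U (carrier H) (carrier K)"
    using U by (auto simp: is_unitary_def is_linear_def)
  have cl: "\<And>x y. x \<in> carrier H \<Longrightarrow> y \<in> carrier H \<Longrightarrow> x \<oplus>\<^bsub>H\<^esub> y \<in> carrier H"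
    "\<And>c x. x \<in> carrier H \<Longrightarrow> c \<odot>\<^bsub>H\<^esub> x \<in> carrier H"
    using assms(1) by (auto simp: pre_hilb_def)
  have "?V (x \<oplus>\<^bsub>K\<^esub> y) = ?V x \<oplus>\<^bsub>H\<^esub> ?V y" "hinner H (?V x) (?V y) = hinner K x y"
    if xyK: "x \<in> carrier K" "y \<in> carrier K" for x y
  proof -
    obtain x' y' where xy: "x' \<in> carrier H" "y' \<in> carrier H" "x = U x'" "y = U y'"
      using xyK is_unitary_ex[OF U, of x] is_unitary_ex[OF U, of y] by blast
    show "?V (x \<oplus>\<^bsub>K\<^esub> y) = ?V x \<oplus>\<^bsub>H\<^esub> ?V y" "hinner H (?V x) (?V y) = hinner K x y"
      using is_unitary_inv_left[OF U] xy cl(1)[of x' y'] lin(1)[of x' y', symmetric] iso by auto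
  qed
  moreover have "?V (c \<odot>\<^bsub>K\<^esub> x) = c \<odot>\<^bsub>H\<^esub> ?V x" if xK: "x \<in> carrier K" for c x
  proof -
    obtain x' where x: "x' \<in> carrier H" "x = U x'"
      using xK is_unitary_ex[OF U, of x] by blast
    show ?thesis
      using is_unitary_inv_left[OF U] x cl(2)[of x' c] lin(2)[of x' c, symmetric] by auto
  qed
  ultimately show ?thesis
    using bij_betw_inv_into[OF bij] is_unitary_inv_closed[OF U]
    by (auto simp: is_unitary_def is_linear_def)
qed

lemma pre_hilb_sum: "\<lbrakk>pre_hilb H; pre_hilb K\<rbrakk> \<Longrightarrow> pre_hilb (hilb_sum H K)"
  by (auto simp: pre_hilb_def hilb_sum_def)

lemma hilb_sum_simps [simp]:
  "carrier (hilb_sum H K) = carrier H \<times> carrier K"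
  "(x, y) \<oplus>\<^bsub>hilb_sum H K\<^esub> (x', y') = (x \<oplus>\<^bsub>H\<^esub> x', y \<oplus>\<^bsub>K\<^esub> y')"
  "c \<odot>\<^bsub>hilb_sum H K\<^esub> (x, y) = (c \<odot>\<^bsub>H\<^esub> x, c \<odot>\<^bsub>K\<^esub> y)"
  "hinner (hilb_sum H K) (x, y) (x', y') = hinner H x x' + hinner K y y'"
  by (simp_all add: hilb_sum_def)

text \<open>Squared norms add up in a direct sum, so the two estimates are squared, added and
  brought back by a square root.\<close>

lemma bounded_lin_sum:
  assumes H: "pre_hilb H" "pre_hilb H'" and K: "pre_hilb K" "pre_hilb K'"
    and T: "bounded_lin H H' T" and S: "bounded_lin K K' S"
  shows "bounded_lin (hilb_sum H K) (hilb_sum H' K') (\<lambda>(x, y). (T x, S y))"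
proof -
  obtain M N where M: "0 \<le> M" "\<And>x. x \<in> carrier H \<Longrightarrow> hnorm H' (T x) \<le> M * hnorm H x"
    and N: "0 \<le> N" "\<And>x. x \<in> carrier K \<Longrightarrow> hnorm K' (S x) \<le> N * hnorm K x"
    using T S H K bounded_lin_nonneg_bound by metis
  have "hnorm (hilb_sum H' K') (T x, S y) \<le> max M N * hnorm (hilb_sum H K) (x, y)"
    if x: "x \<in> carrier H" and y: "y \<in> carrier K" for x y
  proof -
    \<comment> \<open>The larger constant serves both summands and can be factored out of the
      sum.\<close>
    let ?m = "max M N"
    have sq: "(hnorm L z)\<^sup>2 = Re (hinner L z z)" if "pre_hilb L" "z \<in> carrier L" for L and z :: 'z
      using that by (auto simp: hnorm_def pre_hilb_def)
    have "hnorm H' (T x) \<le> ?m * hnorm H x" "hnorm K' (S y) \<le> ?m * hnorm K y"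
      using M(2)[OF x] N(2)[OF y] hnorm_nonneg[OF H(1) x] hnorm_nonneg[OF K(1) y]
      by (meson max.cobounded1 max.cobounded2 mult_right_mono order_trans)+
    then have "(hnorm H' (T x))\<^sup>2 \<le> (?m * hnorm H x)\<^sup>2" "(hnorm K' (S y))\<^sup>2 \<le> (?m * hnorm K y)\<^sup>2"
      using hnorm_nonneg[OF H(2) bounded_lin_closed[OF T x]]
        hnorm_nonneg[OF K(2) bounded_lin_closed[OF S y]] by (auto intro: power_mono)
    then have "Re (hinner H' (T x) (T x)) + Re (hinner K' (S y) (S y)) \<le>
        ?m\<^sup>2 * (Re (hinner H x x) + Re (hinner K y y))"
      using sq[OF H(1) x] sq[OF K(1) y] sq[OF H(2) bounded_lin_closed[OF T x]]
        sq[OF K(2) bounded_lin_closed[OF S y]]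
      by (simp add: power_mult_distrib distrib_left)
    from real_sqrt_le_mono[OF this]
    have "sqrt (Re (hinner H' (T x) (T x)) + Re (hinner K' (S y) (S y))) \<le>
        ?m * sqrt (Re (hinner H x x) + Re (hinner K y y))"
      using M(1) by (simp add: real_sqrt_mult)
    then show ?thesis by (simp add: hnorm_def)
  qed
  then have "\<forall>z\<in>carrier (hilb_sum H K).
      hnorm (hilb_sum H' K') (case z of (x, y) \<Rightarrow> (T x, S y)) \<le> max M N * hnorm (hilb_sum H K) z"
    by auto
  then show ?thesis
    using T S unfolding bounded_lin_def is_linear_def by fastforce
qed

section \<open>Transport of structure\<close>

text \<open>Transport of structure along an injection. It places a space in a prescribed type and,
  with a different injection for each point of the poset, makes fibres disjoint.\<close>

definition copy_hilb :: "('v \<Rightarrow> 'w) \<Rightarrow> 'v hilb \<Rightarrow> 'w hilb" where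
  "copy_hilb f H = (let i = inv_into (carrier H) f in \<lparr>
     carrier = f ` carrier H, mult = undefined, one = undefined, zero = f \<zero>\<^bsub>H\<^esub>,
     add = (\<lambda>x y. f (i x \<oplus>\<^bsub>H\<^esub> i y)), smult = (\<lambda>c x. f (c \<odot>\<^bsub>H\<^esub> i x)),
     hinner = (\<lambda>x y. hinner H (i x) (i y))\<rparr>)"

lemma carrier_copy [simp]: "carrier (copy_hilb f H) = f ` carrier H"
  by (simp add: copy_hilb_def Let_def)

lemma zero_copy [simp]: "\<zero>\<^bsub>copy_hilb f H\<^esub> = f \<zero>\<^bsub>H\<^esub>"
  by (simp add: copy_hilb_def Let_def)

lemma copy_hilb_simps:
  assumes "inj_on f (carrier H)" "x \<in> carrier H" "y \<in> carrier H"
  shows "f x \<oplus>\<^bsub>copy_hilb f H\<^esub> f y = f (x \<oplus>\<^bsub>H\<^esub> y)"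
    and "c \<odot>\<^bsub>copy_hilb f H\<^esub> f x = f (c \<odot>\<^bsub>H\<^esub> x)"
    and "hinner (copy_hilb f H) (f x) (f y) = hinner H x y"
  using assms by (simp_all add: copy_hilb_def Let_def)

lemma copy_unitary:
  assumes "inj_on f (carrier H)" shows "is_unitary H (copy_hilb f H) f"
  using assms by (auto simp: is_unitary_def is_linear_def copy_hilb_simps bij_betw_def)

context hilbert_space
begin

lemma copy_minus:
  assumes f: "inj_on f (carrier H)" and ab: "abelian_group (copy_hilb f H)"
    and x: "x \<in> carrier H" and y: "y \<in> carrier H"
  shows "f x \<ominus>\<^bsub>copy_hilb f H\<^esub> f y = f (x \<ominus>\<^bsub>H\<^esub> y)"
proof -
  interpret C: abelian_group "copy_hilb f H" by (rule ab)
  have "\<ominus>\<^bsub>copy_hilb f H\<^esub> f y = f (\<ominus>\<^bsub>H\<^esub> y)"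
    using f y by (intro C.minus_equality) (auto simp: copy_hilb_simps M.l_neg)
  then show ?thesis
    using f x y by (simp add: a_minus_def copy_hilb_simps)
qed

lemma copy_hilbert:
  assumes f: "inj_on f (carrier H)"
  shows "hilbert_space (copy_hilb f H)"
proof -
  let ?C = "copy_hilb f H"
  note s = copy_hilb_simps[OF f]
  have ab: "abelian_group ?C"
  proof (rule abelian_groupI)
    fix x assume "x \<in> carrier ?C"
    then obtain u where u: "u \<in> carrier H" "x = f u" by auto
    show "\<exists>y\<in>carrier ?C. y \<oplus>\<^bsub>?C\<^esub> x = \<zero>\<^bsub>?C\<^esub>"
      using u by (intro bexI[of _ "f (\<ominus>\<^bsub>H\<^esub> u)"]) (auto simp: s M.l_neg)
  qed (auto simp: s M.a_ac)
  have mod: "module complex_ring ?C"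
    by (rule moduleI[OF _ ab])
      (auto simp: s R.is_cring smult_l_distr smult_r_distr smult_assoc1)
  show ?thesis
  proof (intro hilbert_space.intro mod hilbert_space_axioms.intro)
    fix t :: "nat \<Rightarrow> _"
    assume t: "\<And>n. t n \<in> carrier ?C"
      and cauchy: "\<And>e. 0 < e \<Longrightarrow> \<exists>N. \<forall>m\<ge>N. \<forall>n\<ge>N. hnorm ?C (t m \<ominus>\<^bsub>?C\<^esub> t n) < e"
    \<comment> \<open>The Cauchy sequence is pulled back to \<open>H\<close>, where it has a limit;
      differences have the same norm on both sides.\<close>
    define r where "r n = inv_into (carrier H) f (t n)" for n
    have r: "r n \<in> carrier H" "t n = f (r n)" for n
      using t[of n] f by (auto simp: r_def inv_into_f_f)
    have d: "hnorm ?C (f u \<ominus>\<^bsub>?C\<^esub> f v) = hnorm H (u \<ominus>\<^bsub>H\<^esub> v)"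
      if "u \<in> carrier H" "v \<in> carrier H" for u v
      using that by (simp add: copy_minus[OF f ab] hnorm_def s)
    have "\<exists>l\<in>carrier H. (\<lambda>n. hnorm H (r n \<ominus>\<^bsub>H\<^esub> l)) \<longlonglongrightarrow> 0"
      using cauchy r by (intro complete) (auto simp: d)
    then obtain l where "l \<in> carrier H" "(\<lambda>n. hnorm H (r n \<ominus>\<^bsub>H\<^esub> l)) \<longlonglongrightarrow> 0" by blast
    then show "\<exists>l\<in>carrier ?C. (\<lambda>n. hnorm ?C (t n \<ominus>\<^bsub>?C\<^esub> l)) \<longlonglongrightarrow> 0"
      using r by (intro bexI[of _ "f l"]) (auto simp: d)
  next
    fix x y assume "x \<in> carrier ?C" "y \<in> carrier ?C"
    then show "hinner ?C y x = cnj (hinner ?C x y)"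
      by (auto simp: s intro: inner_cnj)
  qed (auto simp: s inner_add inner_smult intro: inner_pos)
qed

end

section \<open>Spanning sets and tensor products under unitaries\<close>

lemma linear_finsum:
  assumes H: "abelian_group H" and K: "abelian_group K" and U: "is_linear H K U"
    and zero: "U \<zero>\<^bsub>H\<^esub> = \<zero>\<^bsub>K\<^esub>" and A: "finite A" and g: "g \<in> A \<rightarrow> carrier H"
  shows "U (finsum H g A) = finsum K (\<lambda>x. U (g x)) A"
  using A g
proof (induction A)
  case empty
  then show ?case by (simp add: zero abelian_monoid.finsum_empty abelian_group.axioms(1) H K)
next
  case (insert x A)
  interpret H: abelian_group H by (rule H)
  interpret K: abelian_group K by (rule K)
  have "g x \<in> carrier H" "g \<in> A \<rightarrow> carrier H" "U (g x) \<in> carrier K" "(\<lambda>x. U (g x)) \<in> A \<rightarrow> carrier K"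
    using insert.prems is_linear_closed[OF U] by auto
  then show ?case
    using insert.hyps insert.IH U by (simp add: is_linear_def)
qed

lemma hspan_closed:
  assumes "module complex_ring H" "B \<subseteq> carrier H"
  shows "hspan H B \<subseteq> carrier H"
proof
  interpret module complex_ring H by (rule assms(1))
  fix x assume "x \<in> hspan H B"
  then obtain c A where "A \<subseteq> B" "x = finsum H (\<lambda>b. c b \<odot>\<^bsub>H\<^esub> b) A"
    by (auto simp: hspan_def)
  moreover from this have "A \<subseteq> carrier H" using assms(2) by blast
  ultimately show "x \<in> carrier H" by (auto intro!: M.finsum_closed)
qed

lemma hspan_image_subset:
  assumes H: "module complex_ring H" and K: "module complex_ring K"
    and U: "is_unitary H K U" and B: "B \<subseteq> carrier H"
  shows "U ` hspan H B \<subseteq> hspan K (U ` B)"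
proof clarify
  interpret H: module complex_ring H by (rule H)
  interpret K: module complex_ring K by (rule K)
  have lin: "is_linear H K U" using U by (simp add: is_unitary_def)
  have zero: "U \<zero>\<^bsub>H\<^esub> = \<zero>\<^bsub>K\<^esub>"
  proof -
    have "U (0 \<odot>\<^bsub>H\<^esub> \<zero>\<^bsub>H\<^esub>) = 0 \<odot>\<^bsub>K\<^esub> U \<zero>\<^bsub>H\<^esub>"
      using lin H.M.zero_closed unfolding is_linear_def by blast
    then show ?thesis
      using H.smult_l_null[unfolded complex_ring_simps, OF H.M.zero_closed]
        K.smult_l_null[unfolded complex_ring_simps, OF is_linear_closed[OF lin H.M.zero_closed]]
      by simp
  qed
  fix x assume "x \<in> hspan H B"
  then obtain c A where A: "finite A" "A \<subseteq> B" and x: "x = finsum H (\<lambda>b. c b \<odot>\<^bsub>H\<^esub> b) A"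
    by (auto simp: hspan_def)
  \<comment> \<open>Coefficients are indexed by the vectors themselves, so on the image of
    \<open>A\<close> they arise by composing \<open>c\<close> with the inverse of
    \<open>U\<close>.\<close>
  let ?V = "inv_into (carrier H) U"
  have AH: "A \<subseteq> carrier H" using A B by blast
  have inj: "inj_on U A"
    using U AH by (meson is_unitary_inj inj_onI subsetD)
  have "U x = finsum K (\<lambda>b. U (c b \<odot>\<^bsub>H\<^esub> b)) A"
    unfolding x using AH A
    by (intro linear_finsum lin zero H.abelian_group_axioms K.abelian_group_axioms) auto
  also have "\<dots> = finsum K (\<lambda>b. c (?V (U b)) \<odot>\<^bsub>K\<^esub> U b) A"
    using AH lin is_unitary_inv_left[OF U] is_linear_closed[OF lin]
    by (intro K.finsum_cong') (auto simp: is_linear_def subset_eq)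
  also have "\<dots> = finsum K (\<lambda>b. c (?V b) \<odot>\<^bsub>K\<^esub> b) (U ` A)"
    using AH inj is_linear_closed[OF lin] by (subst K.finsum_reindex) (auto simp: subset_eq)
  finally show "U x \<in> hspan K (U ` B)"
    unfolding hspan_def using A
    by (intro CollectI exI[of _ "\<lambda>b. c (?V b)"] exI[of _ "U ` A"]) auto
qed

lemma hspan_image:
  assumes H: "module complex_ring H" and K: "module complex_ring K"
    and U: "is_unitary H K U" and B: "B \<subseteq> carrier H" "hspan H B = carrier H"
  shows "hspan K (U ` B) = carrier K"
proof
  let ?V = "inv_into (carrier H) U"
  have UB: "U ` B \<subseteq> carrier K" using B is_unitary_closed[OF U] by blast
  show "hspan K (U ` B) \<subseteq> carrier K"
    using hspan_closed[OF K UB] .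
  have "carrier K = U ` carrier H"
    using U by (simp add: is_unitary_def bij_betw_def)
  then show "carrier K \<subseteq> hspan K (U ` B)"
    using hspan_image_subset[OF H K U B(1)] B(2) by simp
qed

lemma finite_dim_unitary:
  assumes "hilbert_space H" "hilbert_space K" "is_unitary H K U" "finite_dim H"
  shows "finite_dim K"
proof -
  obtain B where B: "finite B" "B \<subseteq> carrier H" "hspan H B = carrier H"
    using assms(4) by (auto simp: finite_dim_def)
  have "hspan K (U ` B) = carrier K"
    using assms B by (intro hspan_image[of H] hilbert_space.axioms(1)) auto
  then show ?thesis
    unfolding finite_dim_def using B is_unitary_closed[OF assms(3)]
    by (intro exI[of _ "U ` B"]) auto
qed

text \<open>The factors are changed contravariantly by \<open>A\<close> and \<open>B\<close>, the
  product covariantly by \<open>C\<close>. All three preserve inner products. Since \<open>A\<close>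
  and \<open>B\<close> are surjective, the new simple tensors are exactly the images under
  \<open>C\<close> of the old ones, which gives the span.\<close>

lemma is_hilb_tensor_unitary:
  assumes A: "is_unitary H' H A" and B: "is_unitary K' K B" and C: "is_unitary L L' C"
    and L: "hilbert_space L" and L': "hilbert_space L'" and t: "is_hilb_tensor H K L t"
  shows "is_hilb_tensor H' K' L' (\<lambda>x y. C (t (A x) (B y)))"
proof -
  have lin: "is_linear H' H A" "is_linear K' K B" "is_linear L L' C"
    using A B C by (auto simp: is_unitary_def)
  have t': "\<And>x. x \<in> carrier H \<Longrightarrow> is_linear K L (t x)"
    "\<And>y. y \<in> carrier K \<Longrightarrow> is_linear H L (\<lambda>x. t x y)"
    "\<And>x y x' y'. \<lbrakk>x \<in> carrier H; y \<in> carrier K; x' \<in> carrier H; y' \<in> carrier K\<rbrakk> \<Longrightarrow>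
       hinner L (t x y) (t x' y') = hinner H x x' * hinner K y y'"
    "hspan L {t x y | x y. x \<in> carrier H \<and> y \<in> carrier K} = carrier L"
    using t by (auto simp: is_hilb_tensor_def)
  have cl: "\<And>x. x \<in> carrier H' \<Longrightarrow> A x \<in> carrier H" "\<And>x. x \<in> carrier K' \<Longrightarrow> B x \<in> carrier K"
    "\<And>x y. x \<in> carrier H \<Longrightarrow> y \<in> carrier K \<Longrightarrow> t x y \<in> carrier L"
    using is_linear_closed lin t'(1) by metis+
  have im: "{C (t (A x) (B y)) | x y. x \<in> carrier H' \<and> y \<in> carrier K'} =
      C ` {t x y | x y. x \<in> carrier H \<and> y \<in> carrier K}" (is "?S' = C ` ?S")
  proof
    show "?S' \<subseteq> C ` ?S" using cl by blast
    show "C ` ?S \<subseteq> ?S'" using is_unitary_ex[OF A] is_unitary_ex[OF B] by blast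
  qed
  have "hspan L' ?S' = carrier L'"
    unfolding im using cl(3)
    by (intro hspan_image[OF hilbert_space.axioms(1)[OF L] hilbert_space.axioms(1)[OF L'] C _ t'(4)]) auto
  moreover have "is_linear H' L' (\<lambda>x. C (t (A x) (B y)))" if "y \<in> carrier K'" for y
    using is_linear_compose[OF is_linear_compose[OF lin(1) t'(2)] lin(3)] cl(2)[OF that] by simp
  moreover have "is_linear K' L' (\<lambda>y. C (t (A x) (B y)))" if "x \<in> carrier H'" for x
    using is_linear_compose[OF is_linear_compose[OF lin(2) t'(1)] lin(3)] cl(1)[OF that] by simp
  ultimately show ?thesis
    unfolding is_hilb_tensor_def using A B C cl t'(3)
    by (auto simp: is_unitary_def)
qed

section \<open>Cardinality of finite-dimensional spaces\<close>

lemma complex_times_lepoll: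
  includes cardinal_syntax
  shows "(UNIV :: (complex \<times> complex) set) \<lesssim> (UNIV :: complex set)"
proof -
  have "|(UNIV :: complex set) \<times> (UNIV :: complex set)| =o |UNIV :: complex set|"
    by (rule card_of_Times_same_infinite) (simp add: infinite_UNIV_char_0)
  then have "|(UNIV :: complex set) \<times> (UNIV :: complex set)| \<le>o |UNIV :: complex set|"
    by (rule ordIso_imp_ordLeq)
  then show ?thesis
    unfolding card_of_ordLeq[symmetric] lepoll_def by simp
qed

text \<open>Induction on the spanning set: a combination over \<open>insert b B\<close> is given by
  a coefficient of \<open>b\<close> and a combination over \<open>B\<close>, and the extra complex
  factor is absorbed because the complex plane is equipotent with its square.\<close>

lemma (in hilbert_space) hspan_lepoll:
  assumes "finite B" "B \<subseteq> carrier H"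
  shows "hspan H B \<lesssim> (UNIV :: complex set)"
  using assms
proof (induction B)
  case empty
  have "hspan H {} \<subseteq> {\<zero>\<^bsub>H\<^esub>}" by (auto simp: hspan_def)
  then have "hspan H {} \<lesssim> {0 :: complex}"
    by (metis finite.emptyI finite_insert card.empty card_insert_disjoint card_mono empty_iff
        lepoll_iff_card_le finite_subset)
  then show ?case
    using lepoll_trans subset_imp_lepoll by blast
next
  case (insert b B)
  have b: "b \<in> carrier H" "B \<subseteq> carrier H" using insert.prems by auto
  have span_closed: "x \<in> carrier H" if "x \<in> hspan H B" for x
    using that hspan_closed[OF module_axioms b(2)] by blast
  have "hspan H (insert b B) \<subseteq> (\<lambda>(c, x). (c \<odot>\<^bsub>H\<^esub> b) \<oplus>\<^bsub>H\<^esub> x) ` (UNIV \<times> hspan H B)"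
  proof
    fix y assume "y \<in> hspan H (insert b B)"
    then obtain c A where A: "finite A" "A \<subseteq> insert b B" and y: "y = finsum H (\<lambda>b. c b \<odot>\<^bsub>H\<^esub> b) A"
      by (auto simp: hspan_def)
    have A': "A - {b} \<subseteq> B" "finite (A - {b})" using A by auto
    let ?z = "finsum H (\<lambda>b. c b \<odot>\<^bsub>H\<^esub> b) (A - {b})"
    have z: "?z \<in> hspan H B" using A' unfolding hspan_def by blast
    show "y \<in> (\<lambda>(c, x). (c \<odot>\<^bsub>H\<^esub> b) \<oplus>\<^bsub>H\<^esub> x) ` (UNIV \<times> hspan H B)"
    proof (cases "b \<in> A")
      case True
      then have "A = insert b (A - {b})" by auto
      then have "y = finsum H (\<lambda>b. c b \<odot>\<^bsub>H\<^esub> b) (insert b (A - {b}))" using y by metis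
      also have "\<dots> = c b \<odot>\<^bsub>H\<^esub> b \<oplus>\<^bsub>H\<^esub> ?z"
        using A' b by (subst M.finsum_insert) auto
      finally show ?thesis using z by auto
    next
      \<comment> \<open>Here \<open>b\<close> does not occur in the combination and is added with
        coefficient 0.\<close>
      case False
      then have "y = 0 \<odot>\<^bsub>H\<^esub> b \<oplus>\<^bsub>H\<^esub> ?z"
        using y span_closed[OF z] smult_l_null[OF b(1)] by (simp add: complex_ring_simps)
      then show ?thesis using z by auto
    qed
  qed
  then have "hspan H (insert b B) \<lesssim> (UNIV :: complex set) \<times> hspan H B"
    by (meson lepoll_trans subset_imp_lepoll image_lepoll)
  also have "\<dots> \<lesssim> (UNIV :: complex set) \<times> (UNIV :: complex set)"
    using insert b by (intro times_lepoll_mono) auto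
  also have "\<dots> \<lesssim> (UNIV :: complex set)"
    using complex_times_lepoll by simp
  finally show ?case .
qed

lemma finite_dim_lepoll:
  assumes "hilbert_space H" "finite_dim H"
  shows "carrier H \<lesssim> (UNIV :: complex set)"
  using assms hilbert_space.hspan_lepoll unfolding finite_dim_def by metis

section \<open>Parallel transport and holonomy\<close>

text \<open>The part of a net bundle on which parallel transport rests. Direct sums and trivial
  bundles satisfy it directly, so holonomy is available for them too, in whatever type they
  live.\<close>

locale isometric_net =
  fixes X :: "('k::order, 'e) net_bundle"
  assumes pre_hilb_fibre: "pre_hilb (fibre X a)"
    and transport_unitary:
      "a \<le> a' \<Longrightarrow> is_unitary (fibre X a) (fibre X a') (transport X a' a)"
    and transport_id: "x \<in> carrier (fibre X a) \<Longrightarrow> transport X a a x = x"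
    and transport_comp:
      "\<lbrakk>a \<le> a'; a' \<le> a''; x \<in> carrier (fibre X a)\<rbrakk> \<Longrightarrow>
       transport X a'' a' (transport X a' a x) = transport X a'' a x"

lemma (in hilbert_net_bundle) isometric_net: "isometric_net X"
  by unfold_locales
    (auto simp: hilbert_space.pre_hilb hilbert_fibre transport_unitary transport_id transport_comp)

text \<open>Up from the start of \<open>b\<close> to its support, then down to its end by the
  inverse of a unitary.\<close>

definition simplex_transport :: "('k, 'e) net_bundle \<Rightarrow> 'k simplex1 \<Rightarrow> 'e \<Rightarrow> 'e" where
  "simplex_transport X b x =
     inv_into (carrier (fibre X (bd0 b))) (transport X (supp1 b) (bd0 b))
       (transport X (supp1 b) (bd1 b) x)"

definition path_transport :: "('k, 'e) net_bundle \<Rightarrow> 'k simplex1 list \<Rightarrow> 'e \<Rightarrow> 'e" where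
  "path_transport X p = foldr (simplex_transport X) p"

lemma path_transport_simps [simp]:
  "path_transport X [] v = v"
  "path_transport X (b # p) v = simplex_transport X b (path_transport X p v)"
  "path_transport X (p @ q) v = path_transport X p (path_transport X q v)"
  by (simp_all add: path_transport_def)

text \<open>A group element is a set of loops, from which one is picked arbitrarily. On the fibre
  over \<open>a\<close> the pick does not matter, by homotopy invariance; off the fibre the values
  may depend on it, hence the restriction to carriers in what follows.\<close>

definition holonomy ::
    "'k::order \<Rightarrow> ('k, 'e) net_bundle \<Rightarrow> ('k simplex1 list set, 'e) rep" where
  "holonomy a X = \<lparr>space = fibre X a, act = (\<lambda>c. path_transport X (SOME p. p \<in> c))\<rparr>"

lemma space_holonomy [simp]: "space (holonomy a X) = fibre X a"
  by (simp add: holonomy_def)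

section \<open>Transport along simplices and paths, and its homotopy invariance\<close>

context isometric_net
begin

lemma simplex_transport_unitary:
  assumes "is_simplex1 b"
  shows "is_unitary (fibre X (bd1 b)) (fibre X (bd0 b)) (simplex_transport X b)"
proof -
  have "simplex_transport X b = (\<lambda>x. inv_into (carrier (fibre X (bd0 b)))
      (transport X (supp1 b) (bd0 b)) (transport X (supp1 b) (bd1 b) x))"
    by (simp add: fun_eq_iff simplex_transport_def)
  then show ?thesis
    using assms unfolding is_simplex1_def
    by (auto intro!: is_unitary_compose[OF transport_unitary is_unitary_inv]
        pre_hilb_fibre transport_unitary)
qed

text \<open>Stated for any \<open>s\<close> above the support, so that the transports along the
  faces of a 2-simplex can be compared in one fibre, the one over the support of the
  2-simplex.\<close>

lemma simplex_transport_eq: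
  assumes b: "is_simplex1 b" "supp1 b \<le> s" and x: "x \<in> carrier (fibre X (bd1 b))"
  shows "transport X s (bd0 b) (simplex_transport X b x) = transport X s (bd1 b) x"
proof -
  have le: "bd0 b \<le> supp1 b" "bd1 b \<le> supp1 b"
    using b by (auto simp: is_simplex1_def)
  have y: "simplex_transport X b x \<in> carrier (fibre X (bd0 b))"
    using is_unitary_closed[OF simplex_transport_unitary[OF b(1)] x] .
  have "transport X (supp1 b) (bd0 b) (simplex_transport X b x) = transport X (supp1 b) (bd1 b) x"
    unfolding simplex_transport_def
    using is_unitary_closed[OF transport_unitary[OF le(2)] x]
    by (rule is_unitary_inv_right[OF transport_unitary[OF le(1)]])
  then show ?thesis
    using transport_comp[OF le(1) b(2) y] transport_comp[OF le(2) b(2) x] by simp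
qed

text \<open>Going up to \<open>s\<close> is injective, so the equation over \<open>s\<close>
  characterises the transport. Values of \<open>simplex_transport\<close> are computed in this way
  below.\<close>

lemma simplex_transport_eqI:
  assumes b: "is_simplex1 b" "supp1 b \<le> s" and x: "x \<in> carrier (fibre X (bd1 b))"
    and y: "y \<in> carrier (fibre X (bd0 b))"
    and eq: "transport X s (bd0 b) y = transport X s (bd1 b) x"
  shows "simplex_transport X b x = y"
proof (rule is_unitary_inj[OF transport_unitary])
  show "bd0 b \<le> s"
    using b by (auto simp: is_simplex1_def)
qed (use eq simplex_transport_eq[OF b x] is_unitary_closed[OF simplex_transport_unitary[OF b(1)] x] y in auto)

lemma simplex_transport_edge:
  assumes "x \<le> y" "v \<in> carrier (fibre X x)"
  shows "simplex_transport X (edge y x) v = transport X y x v"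
  by (rule simplex_transport_eqI[where s = y])
    (use assms is_unitary_closed[OF transport_unitary[OF assms(1)]] in
      \<open>auto simp: is_simplex1_def transport_id\<close>)

lemma walk_transport_unitary:
  "walk p x y \<Longrightarrow> is_unitary (fibre X x) (fibre X y) (path_transport X p)"
proof (induction p arbitrary: y)
  case Nil
  then show ?case
    using is_unitary_id[of "fibre X x"] by (simp add: path_transport_def id_def)
next
  case (Cons b p)
  then have "is_unitary (fibre X x) (fibre X y) (\<lambda>v. simplex_transport X b (path_transport X p v))"
    using simplex_transport_unitary by (auto intro: is_unitary_compose)
  then show ?case
    by (simp flip: path_transport_simps(2))
qed

lemma path_transport_unitary:
  "is_path p x y \<Longrightarrow> is_unitary (fibre X x) (fibre X y) (path_transport X p)"
  by (simp add: is_path_iff_walk walk_transport_unitary)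

lemma path_transport_closed:
  "\<lbrakk>is_path p x y; v \<in> carrier (fibre X x)\<rbrakk> \<Longrightarrow> path_transport X p v \<in> carrier (fibre X y)"
  using is_unitary_closed path_transport_unitary by metis

text \<open>Carried up to the fibre over \<open>supp2 c\<close>, both sides become the direct
  transport of \<open>v\<close>.\<close>

lemma simplex2_transport:
  assumes c: "is_simplex2 c" and v: "v \<in> carrier (fibre X (bd1 (face1 c)))"
  shows "simplex_transport X (face1 c) v = simplex_transport X (face0 c) (simplex_transport X (face2 c) v)"
proof -
  have s: "is_simplex1 (face0 c)" "is_simplex1 (face1 c)" "is_simplex1 (face2 c)"
    "supp1 (face0 c) \<le> supp2 c" "supp1 (face1 c) \<le> supp2 c" "supp1 (face2 c) \<le> supp2 c"
    and f: "bd0 (face1 c) = bd0 (face0 c)" "bd0 (face2 c) = bd1 (face0 c)" "bd1 (face2 c) = bd1 (face1 c)"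
    using c by (auto simp: is_simplex2_def)
  have v2: "v \<in> carrier (fibre X (bd1 (face2 c)))"
    using v f by simp
  have w: "simplex_transport X (face2 c) v \<in> carrier (fibre X (bd1 (face0 c)))"
    using is_unitary_closed[OF simplex_transport_unitary[OF s(3)] v2] f by simp
  show ?thesis
    using simplex_transport_eq[OF s(1,4) w] simplex_transport_eq[OF s(3,6) v2]
      is_unitary_closed[OF simplex_transport_unitary[OF s(1)] w] f
    by (intro simplex_transport_eqI[OF s(2,5) v]) auto
qed

lemma path_transport_homotopic:
  assumes "homotopic p q" "is_path p x y" "v \<in> carrier (fibre X x)"
  shows "path_transport X p v = path_transport X q v"
proof -
  \<comment> \<open>The formula carries along that both lists are paths with the same ends, which
    symmetry and transitivity use for the other list.\<close>
  have "(\<forall>x y. is_path p x y \<longleftrightarrow> is_path q x y) \<and>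
      (\<forall>x y. \<forall>v\<in>carrier (fibre X x). is_path p x y \<longrightarrow> path_transport X p v = path_transport X q v)"
    using assms(1)
  proof (induction rule: homotopic_induct)
    case (step c u w)
    have "path_transport X (u @ [face1 c] @ w) v = path_transport X (u @ [face0 c, face2 c] @ w) v"
      if v: "v \<in> carrier (fibre X x)" and p: "is_path (u @ [face1 c] @ w) x y" for x y v
    proof -
      \<comment> \<open>The segment traversed before the triangle may be empty, hence a walk; it
        brings \<open>v\<close> into the fibre where the 2-simplex applies.\<close>
      have "walk w x (bd1 (face1 c))"
        using p by (auto simp: is_path_iff_walk walk_append)
      from is_unitary_closed[OF walk_transport_unitary[OF this] v]
      show ?thesis
        by (simp add: simplex2_transport[OF step])
    qed
    moreover have "homotopic (u @ [face1 c] @ w) (u @ [face0 c, face2 c] @ w)"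
      using step by (intro homotopic_context homotopic_step)
    ultimately show ?case
      using homotopic_is_path by blast
  qed auto
  then show ?thesis using assms(2,3) by blast
qed

lemma path_transport_edge_same:
  "v \<in> carrier (fibre X x) \<Longrightarrow> path_transport X [edge x x] v = v"
  by (simp add: simplex_transport_edge transport_id)

lemma path_transport_rev:
  assumes "is_path p x y" "v \<in> carrier (fibre X x)"
  shows "path_transport X (rev_path p) (path_transport X p v) = v"
  using path_transport_homotopic[OF homotopic_rev_left[OF assms(1)] _ assms(2)]
    is_path_append[OF assms(1) is_path_rev[OF assms(1)]] path_transport_edge_same[OF assms(2)]
  by simp

lemma path_transport_rev':
  assumes "is_path p x y" "v \<in> carrier (fibre X y)"
  shows "path_transport X p (path_transport X (rev_path p) v) = v"
  using path_transport_rev[OF is_path_rev[OF assms(1)] assms(2)] by simp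

lemma act_holonomy:
  assumes "is_path p a a" "v \<in> carrier (fibre X a)"
  shows "act (holonomy a X) (homotopy_class p) v = path_transport X p v"
  using path_transport_homotopic[OF homotopic_some_class assms, symmetric]
  by (simp add: holonomy_def)

lemma act_holonomy_closed:
  assumes "g \<in> carrier (pi1 a)" "v \<in> carrier (fibre X a)"
  shows "act (holonomy a X) g v \<in> carrier (fibre X a)"
  using assms by (auto simp: pi1_carrier act_holonomy path_transport_closed)

end

text \<open>Naturality along \<open>x \<le> y\<close> passes to inverses of transports, hence to
  simplices and walks. \<open>T\<close> is an arbitrary natural family of maps, so the lemma applies
  to net morphisms, to the projections of a direct sum and to tensor maps alike.\<close>

lemma natural_path_transport:
  assumes "isometric_net X" "isometric_net Y"
    and closed: "\<And>x v. v \<in> carrier (fibre X x) \<Longrightarrow> T x v \<in> carrier (fibre Y x)"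
    and natural: "\<And>x y v. \<lbrakk>x \<le> y; v \<in> carrier (fibre X x)\<rbrakk> \<Longrightarrow>
      T y (transport X y x v) = transport Y y x (T x v)"
    and "walk p x y" "v \<in> carrier (fibre X x)"
  shows "T y (path_transport X p v) = path_transport Y p (T x v)"
  using assms(5)
proof (induction p arbitrary: y)
  case (Cons b p)
  interpret X: isometric_net X by fact
  interpret Y: isometric_net Y by fact
  have b: "is_simplex1 b" "bd0 b = y" "bd0 b \<le> supp1 b" "bd1 b \<le> supp1 b" and p: "walk p x (bd1 b)"
    using Cons.prems by (auto simp: is_simplex1_def)
  let ?w = "path_transport X p v"
  have w: "?w \<in> carrier (fibre X (bd1 b))"
    using is_unitary_closed[OF X.walk_transport_unitary[OF p] assms(6)] .
  have sw: "simplex_transport X b ?w \<in> carrier (fibre X (bd0 b))"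
    using is_unitary_closed[OF X.simplex_transport_unitary[OF b(1)] w] .
  \<comment> \<open>Both sides are compared after going up to the support of \<open>b\<close>, where
    only naturality for order relations is involved.\<close>
  have "simplex_transport Y b (T (bd1 b) ?w) = T (bd0 b) (simplex_transport X b ?w)"
    using X.simplex_transport_eq[OF b(1) order_refl w] natural[OF b(3) sw] natural[OF b(4) w]
    by (intro Y.simplex_transport_eqI[OF b(1) order_refl]) (auto intro: closed w sw)
  then show ?case
    using Cons.IH[OF p] b(2) by simp
qed simp

text \<open>One path per point, fixed once and for all. The path from \<open>a\<close> to
  \<open>a\<close> is chosen like the others and need not be null-homotopic.\<close>

definition base_path :: "'k::order \<Rightarrow> 'k \<Rightarrow> 'k simplex1 list" where
  "base_path a x = (SOME p. is_path p a x)"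

lemma is_path_base_path:
  assumes "pathwise_connected TYPE('k::order)"
  shows "is_path (base_path a x) a (x :: 'k)"
  using assms unfolding base_path_def pathwise_connected_def by (metis someI_ex)

definition spread ::
    "'k::order \<Rightarrow> ('k, 'e) net_bundle \<Rightarrow> ('k, 'f) net_bundle \<Rightarrow> ('e \<Rightarrow> 'f) \<Rightarrow> 'k \<Rightarrow> 'e \<Rightarrow> 'f" where
  "spread a X Y S x v =
     path_transport Y (base_path a x) (S (path_transport X (rev_path (base_path a x)) v))"

text \<open>
  No linearity is assumed of \<open>S\<close>: besides intertwiners, the lemmas also cover tensor products,
  viewed as maps from a direct sum.
\<close>

locale equivariant_map = X: isometric_net X + Y: isometric_net Y
  for X :: "('k::order, 'e) net_bundle" and Y :: "('k, 'f) net_bundle" +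
  fixes a :: 'k and S :: "'e \<Rightarrow> 'f"
  assumes connected: "pathwise_connected TYPE('k)"
    and closed: "v \<in> carrier (fibre X a) \<Longrightarrow> S v \<in> carrier (fibre Y a)"
    and equivariant: "\<lbrakk>is_path p a a; v \<in> carrier (fibre X a)\<rbrakk> \<Longrightarrow>
      S (path_transport X p v) = path_transport Y p (S v)"
begin

text \<open>The chosen path may be replaced by any other: going along \<open>p\<close> and back
  along the chosen path is a loop at \<open>a\<close>, and \<open>S\<close> commutes with transport
  along loops.\<close>

lemma spread_path:
  assumes p: "is_path p a x" and v: "v \<in> carrier (fibre X a)"
  shows "spread a X Y S x (path_transport X p v) = path_transport Y p (S v)"
proof -
  let ?q = "base_path a x"
  note q = is_path_base_path[OF connected, of a x]
  have l: "is_path (rev_path ?q @ p) a a"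
    using is_path_append[OF p is_path_rev[OF q]] .
  have "spread a X Y S x (path_transport X p v) = path_transport Y ?q (S (path_transport X (rev_path ?q @ p) v))"
    by (simp add: spread_def)
  also have "\<dots> = path_transport Y ?q (path_transport Y (rev_path ?q) (path_transport Y p (S v)))"
    by (subst equivariant[OF l v]) simp
  also have "\<dots> = path_transport Y p (S v)"
    using Y.path_transport_rev'[OF q Y.path_transport_closed[OF p closed[OF v]]] .
  finally show ?thesis .
qed

text \<open>The chosen path to \<open>x\<close> followed by the edge to \<open>y\<close> is a path
  to \<open>y\<close>, and by independence of the path it computes the value over
  \<open>y\<close>.\<close>

lemma spread_natural:
  assumes xy: "x \<le> y" and v: "v \<in> carrier (fibre X x)"
  shows "spread a X Y S y (transport X y x v) = transport Y y x (spread a X Y S x v)"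
proof -
  let ?p = "base_path a x"
  note p = is_path_base_path[OF connected, of a x]
  define w where "w = path_transport X (rev_path ?p) v"
  have w: "w \<in> carrier (fibre X a)" "v = path_transport X ?p w"
    using X.path_transport_closed[OF is_path_rev[OF p] v] X.path_transport_rev'[OF p v]
    by (auto simp: w_def)
  have "path_transport X ([edge y x] @ ?p) w = transport X y x v"
    "path_transport Y ([edge y x] @ ?p) (S w) = transport Y y x (path_transport Y ?p (S w))"
    using xy v w(2) Y.path_transport_closed[OF p closed[OF w(1)]]
    by (simp_all add: X.simplex_transport_edge Y.simplex_transport_edge)
  then show ?thesis
    using spread_path[OF is_path_append[OF p is_path_edge[OF xy]] w(1)] spread_path[OF p w(1)]
    by (simp add: w(2)[symmetric])
qed

text \<open>Computed with the null edge at \<open>a\<close> in place of the chosen loop, whose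
  transport may be nontrivial.\<close>

lemma spread_base:
  assumes "v \<in> carrier (fibre X a)" shows "spread a X Y S a v = S v"
  using spread_path[OF is_path_edge[OF order_refl] assms] assms closed[OF assms]
  by (simp add: X.simplex_transport_edge X.transport_id Y.simplex_transport_edge Y.transport_id)

end

section \<open>Isomorphisms\<close>

lemma intertwiners_iff:
  "T \<in> intertwiners G V W \<longleftrightarrow>
     T \<in> extensional (carrier (space V)) \<and> bounded_lin (space V) (space W) T \<and>
     (\<forall>g\<in>carrier G. \<forall>x\<in>carrier (space V). T (act V g x) = act W g (T x))"
  by (auto simp: intertwiners_def bounded_ops_iff)

text \<open>The counterpart of \<open>pre_hilb\<close> for representations, shared by unitary
  representations, their direct sums and the holonomy of any isometric net.\<close>

definition act_closed :: "'g monoid \<Rightarrow> ('g, 'v) rep \<Rightarrow> bool" where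
  "act_closed G V \<longleftrightarrow>
     pre_hilb (space V) \<and> (\<forall>g\<in>carrier G. \<forall>x\<in>carrier (space V). act V g x \<in> carrier (space V))"

lemma (in unitary_rep) act_closed: "act_closed G V"
  using hilbert act_unitary by (auto simp: act_closed_def hilbert_space.pre_hilb intro: is_unitary_closed)

definition intertwining :: "'g monoid \<Rightarrow> ('g, 'v) rep \<Rightarrow> ('g, 'w) rep \<Rightarrow> ('v \<Rightarrow> 'w) \<Rightarrow> bool" where
  "intertwining G V W T \<longleftrightarrow> bounded_lin (space V) (space W) T \<and>
     (\<forall>g\<in>carrier G. \<forall>x\<in>carrier (space V). T (act V g x) = act W g (T x))"

lemma intertwining_closed:
  "\<lbrakk>intertwining G V W T; x \<in> carrier (space V)\<rbrakk> \<Longrightarrow> T x \<in> carrier (space W)"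
  by (auto simp: intertwining_def intro: bounded_lin_closed)

lemma intertwining_compose:
  assumes "act_closed G U" "act_closed G V" "intertwining G U V T" "intertwining G V W S"
  shows "intertwining G U W (\<lambda>x. S (T x))"
  using assms bounded_lin_compose[of "space U" "space V" T "space W" S]
  by (auto simp: intertwining_def act_closed_def dest: bounded_lin_closed)

lemma restrict_intertwiners:
  assumes "act_closed G V" "intertwining G V W T"
  shows "restrict T (carrier (space V)) \<in> intertwiners G V W"
  using assms by (auto simp: intertwiners_iff intertwining_def act_closed_def bounded_lin_restrict)

text \<open>Lets isomorphisms be given by plain functions; the restrictions demanded by
  \<open>intertwiners\<close> are supplied here.\<close>

lemma rep_isomorphicI:
  assumes "act_closed G V" "act_closed G W" "intertwining G V W T" "intertwining G W V S"
    and "\<And>x. x \<in> carrier (space V) \<Longrightarrow> S (T x) = x" "\<And>y. y \<in> carrier (space W) \<Longrightarrow> T (S y) = y"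
  shows "rep_isomorphic G V W"
  unfolding rep_isomorphic_def
proof (intro bexI conjI)
  show "rep_comp V (restrict S (carrier (space W))) (restrict T (carrier (space V))) = rep_id V"
    "rep_comp W (restrict T (carrier (space V))) (restrict S (carrier (space W))) = rep_id W"
    using assms(5,6) intertwining_closed[OF assms(3)] intertwining_closed[OF assms(4)]
    by (auto simp: rep_comp_def rep_id_def compose_def fun_eq_iff)
qed (intro restrict_intertwiners assms)+

lemma rep_isomorphicE:
  assumes "rep_isomorphic G V W"
  obtains T S where "intertwining G V W T" "intertwining G W V S"
    "\<And>x. x \<in> carrier (space V) \<Longrightarrow> S (T x) = x" "\<And>y. y \<in> carrier (space W) \<Longrightarrow> T (S y) = y"
proof -
  obtain T S where TS: "T \<in> intertwiners G V W" "S \<in> intertwiners G W V"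
    "rep_comp V S T = rep_id V" "rep_comp W T S = rep_id W"
    using assms by (auto simp: rep_isomorphic_def)
  have "S (T x) = x" if "x \<in> carrier (space V)" for x
    using fun_cong[OF TS(3), of x] that by (simp add: rep_comp_def rep_id_def compose_def)
  moreover have "T (S y) = y" if "y \<in> carrier (space W)" for y
    using fun_cong[OF TS(4), of y] that by (simp add: rep_comp_def rep_id_def compose_def)
  ultimately show thesis
    using TS that by (auto simp: intertwiners_iff intertwining_def)
qed

lemma rep_isomorphic_sym: "rep_isomorphic G V W \<Longrightarrow> rep_isomorphic G W V"
  unfolding rep_isomorphic_def by blast

lemma rep_isomorphic_trans:
  assumes "act_closed G U" "act_closed G V" "act_closed G W"
    and "rep_isomorphic G U V" "rep_isomorphic G V W"
  shows "rep_isomorphic G U W"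
proof -
  obtain T S where T: "intertwining G U V T" "intertwining G V U S"
    "\<And>x. x \<in> carrier (space U) \<Longrightarrow> S (T x) = x" "\<And>y. y \<in> carrier (space V) \<Longrightarrow> T (S y) = y"
    using assms(4) by (rule rep_isomorphicE) blast
  obtain T' S' where T': "intertwining G V W T'" "intertwining G W V S'"
    "\<And>x. x \<in> carrier (space V) \<Longrightarrow> S' (T' x) = x" "\<And>y. y \<in> carrier (space W) \<Longrightarrow> T' (S' y) = y"
    using assms(5) by (rule rep_isomorphicE) blast
  show ?thesis
    using T T' assms(1-3) intertwining_closed[OF T(1)] intertwining_closed[OF T'(2)]
    by (intro rep_isomorphicI[where T = "\<lambda>x. T' (T x)" and S = "\<lambda>y. S (S' y)"])
      (auto intro: intertwining_compose)
qed

definition unitary_intertwiner ::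
    "'g monoid \<Rightarrow> ('g, 'v) rep \<Rightarrow> ('g, 'w) rep \<Rightarrow> ('v \<Rightarrow> 'w) \<Rightarrow> bool" where
  "unitary_intertwiner G V W U \<longleftrightarrow>
     is_unitary (space V) (space W) U \<and>
     (\<forall>g\<in>carrier G. \<forall>x\<in>carrier (space V). U (act V g x) = act W g (U x))"

lemma unitary_intertwiner_intertwining:
  "unitary_intertwiner G V W U \<Longrightarrow> intertwining G V W U"
  by (simp add: unitary_intertwiner_def intertwining_def is_unitary_bounded)

lemma unitary_intertwiner_inv:
  assumes V: "act_closed G V" and U: "unitary_intertwiner G V W U"
  shows "unitary_intertwiner G W V (inv_into (carrier (space V)) U)"
proof -
  have u: "is_unitary (space V) (space W) U"
    and e: "\<And>g x. \<lbrakk>g \<in> carrier G; x \<in> carrier (space V)\<rbrakk> \<Longrightarrow> U (act V g x) = act W g (U x)"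
    using U by (auto simp: unitary_intertwiner_def)
  have "inv_into (carrier (space V)) U (act W g y) = act V g (inv_into (carrier (space V)) U y)"
    if "g \<in> carrier G" "y \<in> carrier (space W)" for g y
  proof -
    let ?x = "inv_into (carrier (space V)) U y"
    have "?x \<in> carrier (space V)" "U ?x = y"
      using is_unitary_inv_closed[OF u] is_unitary_inv_right[OF u] that by auto
    then show ?thesis
      using e[OF that(1), of ?x, symmetric] V that(1) is_unitary_inv_left[OF u]
      by (simp add: act_closed_def)
  qed
  then show ?thesis
    using u V is_unitary_inv by (auto simp: unitary_intertwiner_def act_closed_def)
qed

lemma unitary_intertwiner_isomorphic:
  assumes V: "act_closed G V" "act_closed G W" and U: "unitary_intertwiner G V W U"
  shows "rep_isomorphic G V W"
  using U unitary_intertwiner_intertwining[OF U] is_unitary_inv_left is_unitary_inv_right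
    unitary_intertwiner_intertwining[OF unitary_intertwiner_inv[OF V(1) U]]
  by (intro rep_isomorphicI[OF V, where T = U and S = "inv_into (carrier (space V)) U"])
    (auto simp: unitary_intertwiner_def)

lemma rep_isomorphic_refl: "act_closed G V \<Longrightarrow> rep_isomorphic G V V"
  by (rule unitary_intertwiner_isomorphic[where U = "\<lambda>x. x"])
    (auto simp: unitary_intertwiner_def is_unitary_id)

lemma space_rep_sum [simp]: "space (rep_sum V W) = hilb_sum (space V) (space W)"
  and act_rep_sum [simp]: "act (rep_sum V W) g (x, y) = (act V g x, act W g y)"
  by (simp_all add: rep_sum_def)

lemma act_closed_sum: "\<lbrakk>act_closed G V; act_closed G W\<rbrakk> \<Longrightarrow> act_closed G (rep_sum V W)"
  by (auto simp: act_closed_def pre_hilb_sum)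

lemma intertwining_sum:
  assumes "act_closed G V" "act_closed G V'" "act_closed G W" "act_closed G W'"
    and "intertwining G V V' T" "intertwining G W W' S"
  shows "intertwining G (rep_sum V W) (rep_sum V' W') (\<lambda>(x, y). (T x, S y))"
  using assms by (auto simp: intertwining_def act_closed_def intro: bounded_lin_sum)

lemma rep_isomorphic_sum:
  assumes cl: "act_closed G V" "act_closed G V'" "act_closed G W" "act_closed G W'"
    and "rep_isomorphic G V V'" "rep_isomorphic G W W'"
  shows "rep_isomorphic G (rep_sum V W) (rep_sum V' W')"
proof -
  obtain T S where T: "intertwining G V V' T" "intertwining G V' V S"
    "\<And>x. x \<in> carrier (space V) \<Longrightarrow> S (T x) = x" "\<And>y. y \<in> carrier (space V') \<Longrightarrow> T (S y) = y"
    using assms(5) by (rule rep_isomorphicE) blast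
  obtain T' S' where T': "intertwining G W W' T'" "intertwining G W' W S'"
    "\<And>x. x \<in> carrier (space W) \<Longrightarrow> S' (T' x) = x" "\<And>y. y \<in> carrier (space W') \<Longrightarrow> T' (S' y) = y"
    using assms(6) by (rule rep_isomorphicE) blast
  show ?thesis
    using T T' cl
    by (intro rep_isomorphicI[where T = "\<lambda>(x, y). (T x, T' y)" and S = "\<lambda>(x, y). (S x, S' y)"])
      (auto intro: intertwining_sum act_closed_sum)
qed

section \<open>Holonomy is fully faithful\<close>

lemma net_morphisms_iff:
  "T \<in> net_morphisms X Y \<longleftrightarrow>
     (\<forall>x. T x \<in> extensional (carrier (fibre X x)) \<and> bounded_lin (fibre X x) (fibre Y x) (T x)) \<and>
     (\<forall>x y. x \<le> y \<longrightarrow> (\<forall>v\<in>carrier (fibre X x).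
        T y (transport X y x v) = transport Y y x (T x v)))"
  by (auto simp: net_morphisms_def bounded_ops_iff)

lemma (in isometric_net) act_closed_holonomy: "act_closed (pi1 a) (holonomy a X)"
  by (simp add: act_closed_def pre_hilb_fibre act_holonomy_closed)

lemma net_morphism_path_transport:
  assumes "isometric_net X" "isometric_net Y" "T \<in> net_morphisms X Y"
    and "is_path p x y" "v \<in> carrier (fibre X x)"
  shows "T y (path_transport X p v) = path_transport Y p (T x v)"
  using assms(3-5) by (intro natural_path_transport[OF assms(1,2)])
    (auto simp: net_morphisms_iff is_path_iff_walk intro: bounded_lin_closed)

lemma net_morphism_fibre:
  assumes X: "isometric_net X" and Y: "isometric_net Y" and T: "T \<in> net_morphisms X Y"
  shows "T a \<in> intertwiners (pi1 a) (holonomy a X) (holonomy a Y)"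
proof -
  have "T a (act (holonomy a X) g v) = act (holonomy a Y) g (T a v)"
    if "g \<in> carrier (pi1 a)" "v \<in> carrier (fibre X a)" for g v
  proof -
    have "T a v \<in> carrier (fibre Y a)"
      using T that by (auto simp: net_morphisms_iff intro: bounded_lin_closed)
    then show ?thesis
      using that net_morphism_path_transport[OF X Y T]
      by (auto simp: pi1_carrier isometric_net.act_holonomy[OF X] isometric_net.act_holonomy[OF Y])
  qed
  then show ?thesis
    using T by (auto simp: intertwiners_iff net_morphisms_iff)
qed

text \<open>Every vector over \<open>x\<close> is the transport of a vector over \<open>a\<close>,
  so the component at \<open>a\<close> determines the others; outside the fibres extensionality
  fixes the values.\<close>

lemma net_morphism_eqI:
  assumes conn: "pathwise_connected TYPE('k::order)"
    and X: "isometric_net X" and Y: "isometric_net Y"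
    and T: "T \<in> net_morphisms X Y" and S: "S \<in> net_morphisms X Y"
    and eq: "\<And>v. v \<in> carrier (fibre X (a :: 'k)) \<Longrightarrow> T a v = S a v"
  shows "T = S"
proof (intro ext)
  interpret X: isometric_net X by (rule X)
  fix x v
  show "T x v = S x v"
  proof (cases "v \<in> carrier (fibre X x)")
    case True
    note p = is_path_base_path[OF conn, of a x]
    let ?w = "path_transport X (rev_path (base_path a x)) v"
    have w: "?w \<in> carrier (fibre X a)" "path_transport X (base_path a x) ?w = v"
      using X.path_transport_closed[OF is_path_rev[OF p] True] X.path_transport_rev'[OF p True] by auto
    show ?thesis
      using net_morphism_path_transport[OF X Y T p w(1)] net_morphism_path_transport[OF X Y S p w(1)]
        w eq by simp
  next
    case False
    then show ?thesis
      using T S by (auto simp: net_morphisms_iff extensional_def)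
  qed
qed

lemma intertwining_equivariant_map:
  assumes "pathwise_connected TYPE('k::order)" "isometric_net X" "isometric_net Y"
    and S: "intertwining (pi1 a) (holonomy a X) (holonomy a Y) S"
  shows "equivariant_map X Y (a :: 'k) S"
proof -
  interpret X: isometric_net X by fact
  interpret Y: isometric_net Y by fact
  have cl: "S v \<in> carrier (fibre Y a)" if "v \<in> carrier (fibre X a)" for v
    using intertwining_closed[OF S] that by simp
  have "S (path_transport X p v) = path_transport Y p (S v)"
    if "is_path p a a" "v \<in> carrier (fibre X a)" for p v
  proof -
    have "S (act (holonomy a X) (homotopy_class p) v) = act (holonomy a Y) (homotopy_class p) (S v)"
      using S that by (auto simp: intertwining_def pi1_carrier)
    then show ?thesis
      using X.act_holonomy[OF that] Y.act_holonomy[OF that(1) cl[OF that(2)]] by simp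
  qed
  then show ?thesis
    using assms cl by unfold_locales
qed

lemma spread_morphism:
  assumes conn: "pathwise_connected TYPE('k::order)" and X: "isometric_net X" and Y: "isometric_net Y"
    and S: "intertwining (pi1 a) (holonomy a X) (holonomy a Y) S"
  defines "T \<equiv> \<lambda>x. restrict (spread (a :: 'k) X Y S x) (carrier (fibre X x))"
  shows "T \<in> net_morphisms X Y" and "v \<in> carrier (fibre X a) \<Longrightarrow> T a v = S v"
proof -
  interpret equivariant_map X Y a S
    by (rule intertwining_equivariant_map[OF conn X Y S])
  \<comment> \<open>Over \<open>x\<close> the map is \<open>S\<close> between two unitary
    transports.\<close>
  have "bounded_lin (fibre X x) (fibre Y x) (spread a X Y S x)" for x
  proof -
    note p = is_path_base_path[OF conn, of a x]
    have "bounded_lin (fibre X a) (fibre Y a) S"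
      using S by (simp add: intertwining_def)
    from bounded_lin_compose[OF X.pre_hilb_fibre X.pre_hilb_fibre
        is_unitary_bounded[OF X.path_transport_unitary[OF is_path_rev[OF p]]] this]
    have "bounded_lin (fibre X x) (fibre Y a)
        (\<lambda>v. S (path_transport X (rev_path (base_path a x)) v))" .
    from bounded_lin_compose[OF X.pre_hilb_fibre Y.pre_hilb_fibre this
        is_unitary_bounded[OF Y.path_transport_unitary[OF p]]]
    show ?thesis by (simp add: spread_def[abs_def])
  qed
  then show "T \<in> net_morphisms X Y"
    using spread_natural is_unitary_closed[OF X.transport_unitary]
    by (auto simp: net_morphisms_iff T_def bounded_lin_restrict X.pre_hilb_fibre)
  show "T a v = S v" if "v \<in> carrier (fibre X a)"
    using spread_base that by (simp add: T_def)
qed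

lemma net_morphisms_bij:
  assumes conn: "pathwise_connected TYPE('k::order)" and X: "isometric_net X" and Y: "isometric_net Y"
  shows "bij_betw (\<lambda>T. T (a :: 'k)) (net_morphisms X Y)
    (intertwiners (pi1 a) (holonomy a X) (holonomy a Y))"
  unfolding bij_betw_def
proof (intro conjI inj_onI subset_antisym subsetI)
  fix S assume S: "S \<in> intertwiners (pi1 a) (holonomy a X) (holonomy a Y)"
  then have S': "intertwining (pi1 a) (holonomy a X) (holonomy a Y) S"
    by (auto simp: intertwiners_iff intertwining_def)
  let ?T = "\<lambda>x. restrict (spread a X Y S x) (carrier (fibre X x))"
  have "S = ?T a"
    using S spread_morphism(2)[OF conn X Y S'] by (auto simp: intertwiners_iff fun_eq_iff extensional_def)
  then show "S \<in> (\<lambda>T. T a) ` net_morphisms X Y"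
    using spread_morphism(1)[OF conn X Y S'] by (rule image_eqI)
qed (use net_morphism_eqI[OF conn X Y, where a = a] net_morphism_fibre[OF X Y] in auto)

lemma net_id_morphism:
  assumes "isometric_net X" shows "net_id X \<in> net_morphisms X X"
proof -
  interpret isometric_net X by fact
  show ?thesis
    using bounded_lin_id is_unitary_closed[OF transport_unitary]
    by (auto simp: net_morphisms_iff net_id_def bounded_lin_restrict pre_hilb_fibre id_def)
qed

lemma net_comp_morphism:
  assumes "isometric_net X" "isometric_net Y" and T: "T \<in> net_morphisms X Y" and S: "S \<in> net_morphisms Y Z"
  shows "net_comp X S T \<in> net_morphisms X Z"
proof -
  interpret X: isometric_net X by fact
  interpret Y: isometric_net Y by fact
  have "bounded_lin (fibre X x) (fibre Z x) (\<lambda>v. S x (T x v))" for x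
    using T S bounded_lin_compose[OF X.pre_hilb_fibre[of x] Y.pre_hilb_fibre[of x],
        where T = "T x" and S = "S x" and L = "fibre Z x"]
    by (simp add: net_morphisms_iff)
  moreover have "T x v \<in> carrier (fibre Y x)" if "v \<in> carrier (fibre X x)" for x v
    using T that by (auto simp: net_morphisms_iff intro: bounded_lin_closed)
  ultimately show ?thesis
    using T S is_unitary_closed[OF X.transport_unitary]
    by (auto simp: net_morphisms_iff net_comp_def compose_def bounded_lin_restrict X.pre_hilb_fibre)
qed

text \<open>The total spaces may have different types, so direct sums and trivial bundles can be
  compared with bundles of the universe. From right to left, the composites of the spread maps agree
  with the identities at \<open>a\<close>, hence everywhere.\<close>

lemma net_isomorphic_iff:
  assumes conn: "pathwise_connected TYPE('k::order)" and X: "isometric_net X" and Y: "isometric_net Y"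
  shows "net_isomorphic X Y \<longleftrightarrow> rep_isomorphic (pi1 a) (holonomy (a :: 'k) X) (holonomy a Y)"
proof
  assume "net_isomorphic X Y"
  then obtain T S where TS: "T \<in> net_morphisms X Y" "S \<in> net_morphisms Y X"
    "net_comp X S T = net_id X" "net_comp Y T S = net_id Y"
    by (auto simp: net_isomorphic_def)
  then have "net_comp X S T a = net_id X a" "net_comp Y T S a = net_id Y a"
    by simp_all
  then have "rep_comp (holonomy a X) (S a) (T a) = rep_id (holonomy a X)"
    "rep_comp (holonomy a Y) (T a) (S a) = rep_id (holonomy a Y)"
    by (simp_all add: rep_comp_def rep_id_def net_comp_def net_id_def)
  then show "rep_isomorphic (pi1 a) (holonomy a X) (holonomy a Y)"
    unfolding rep_isomorphic_def
    using net_morphism_fibre[OF X Y TS(1)] net_morphism_fibre[OF Y X TS(2)] by blast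
next
  assume "rep_isomorphic (pi1 a) (holonomy a X) (holonomy a Y)"
  then obtain T S where T: "intertwining (pi1 a) (holonomy a X) (holonomy a Y) T"
    and S: "intertwining (pi1 a) (holonomy a Y) (holonomy a X) S"
    and "\<And>x. x \<in> carrier (fibre X a) \<Longrightarrow> S (T x) = x" "\<And>y. y \<in> carrier (fibre Y a) \<Longrightarrow> T (S y) = y"
    by (elim rep_isomorphicE) auto
  moreover obtain T' where T': "T' \<in> net_morphisms X Y" "\<And>v. v \<in> carrier (fibre X a) \<Longrightarrow> T' a v = T v"
    using spread_morphism[OF conn X Y T] by blast
  moreover obtain S' where S': "S' \<in> net_morphisms Y X" "\<And>v. v \<in> carrier (fibre Y a) \<Longrightarrow> S' a v = S v"
    using spread_morphism[OF conn Y X S] by blast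
  ultimately have "net_comp X S' T' = net_id X" "net_comp Y T' S' = net_id Y"
    using intertwining_closed[OF T] intertwining_closed[OF S]
    by (intro net_morphism_eqI[OF conn X X, where a = a] net_morphism_eqI[OF conn Y Y, where a = a]
        net_comp_morphism[OF X Y] net_comp_morphism[OF Y X] net_id_morphism X Y;
      simp add: net_comp_def net_id_def compose_def)+
  then show "net_isomorphic X Y"
    unfolding net_isomorphic_def using T'(1) S'(1) by blast
qed

section \<open>Holonomy of sums, tensor products and trivial bundles\<close>

lemma net_sum_simps [simp]:
  "fibre (net_sum X Y) x = hilb_sum (fibre X x) (fibre Y x)"
  "transport (net_sum X Y) y x (v, w) = (transport X y x v, transport Y y x w)"
  by (simp_all add: net_sum_def)

lemma isometric_net_sum:
  fixes X :: "('k::order, 'e) net_bundle"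
  assumes "isometric_net X" "isometric_net Y" shows "isometric_net (net_sum X Y)"
proof -
  interpret X: isometric_net X by fact
  interpret Y: isometric_net Y by fact
  show ?thesis
  proof
    fix x y :: 'k assume le: "x \<le> y"
    have X: "is_unitary (fibre X x) (fibre X y) (transport X y x)"
      and Y: "is_unitary (fibre Y x) (fibre Y y) (transport Y y x)"
      using X.transport_unitary Y.transport_unitary le by auto
    have "bij_betw (map_prod (transport X y x) (transport Y y x))
        (carrier (fibre X x) \<times> carrier (fibre Y x)) (carrier (fibre X y) \<times> carrier (fibre Y y))"
      using X Y by (auto simp: is_unitary_def intro: bij_betw_map_prod)
    then have "bij_betw (transport (net_sum X Y) y x)
        (carrier (fibre X x) \<times> carrier (fibre Y x)) (carrier (fibre X y) \<times> carrier (fibre Y y))"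
      by (simp add: net_sum_def map_prod_def)
    then show "is_unitary (fibre (net_sum X Y) x) (fibre (net_sum X Y) y) (transport (net_sum X Y) y x)"
      using X Y by (auto simp: is_unitary_def is_linear_def)
  qed (auto simp: X.pre_hilb_fibre Y.pre_hilb_fibre pre_hilb_sum X.transport_id Y.transport_id
      X.transport_comp Y.transport_comp)
qed

text \<open>The projections of a direct sum are natural families, so each of them commutes with
  parallel transport.\<close>

lemma net_sum_path_transport:
  assumes X: "isometric_net X" and Y: "isometric_net Y" and p: "is_path p x y"
    and v: "v \<in> carrier (fibre X x)" and w: "w \<in> carrier (fibre Y x)"
  shows "path_transport (net_sum X Y) p (v, w) = (path_transport X p v, path_transport Y p w)"
proof -
  note S = isometric_net_sum[OF X Y]
  have "fst (path_transport (net_sum X Y) p (v, w)) = path_transport X p (fst (v, w))"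
    "snd (path_transport (net_sum X Y) p (v, w)) = path_transport Y p (snd (v, w))"
    using p v w natural_path_transport[OF S X, of "\<lambda>_. fst" p x y "(v, w)"]
      natural_path_transport[OF S Y, of "\<lambda>_. snd" p x y "(v, w)"]
    by (auto simp: is_path_iff_walk)
  then show ?thesis by (simp add: prod_eq_iff)
qed

text \<open>Both representations have the same space, and the identity intertwines them. The actions
  are compared only on carriers, hence an isomorphism rather than an equation.\<close>

lemma holonomy_sum:
  assumes X: "isometric_net X" and Y: "isometric_net Y"
  shows "rep_isomorphic (pi1 a) (holonomy a (net_sum X Y)) (rep_sum (holonomy a X) (holonomy a Y))"
proof (rule unitary_intertwiner_isomorphic[where U = "\<lambda>x. x"])
  note S = isometric_net_sum[OF X Y]
  show "act_closed (pi1 a) (holonomy a (net_sum X Y))"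
    "act_closed (pi1 a) (rep_sum (holonomy a X) (holonomy a Y))"
    using X Y S by (auto intro: act_closed_sum isometric_net.act_closed_holonomy)
  show "unitary_intertwiner (pi1 a) (holonomy a (net_sum X Y)) (rep_sum (holonomy a X) (holonomy a Y)) (\<lambda>x. x)"
    using X Y S by (auto simp: unitary_intertwiner_def is_unitary_id pi1_carrier
        isometric_net.act_holonomy net_sum_path_transport)
qed

text \<open>Read on pairs, the tensor maps are a natural family from the direct sum to
  \<open>W\<close>, bilinear rather than linear in each fibre, so the general form of
  \<open>natural_path_transport\<close> applies.\<close>

lemma net_tensor_holonomy:
  assumes X: "isometric_net X" and Y: "isometric_net Y" and W: "isometric_net W"
    and "is_net_tensor X Y W"
  shows "is_rep_tensor (pi1 a) (holonomy a X) (holonomy a Y) (holonomy a W)"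
proof -
  obtain t where t: "\<And>x. is_hilb_tensor (fibre X x) (fibre Y x) (fibre W x) (t x)"
    and nat: "\<And>x y v w. \<lbrakk>x \<le> y; v \<in> carrier (fibre X x); w \<in> carrier (fibre Y x)\<rbrakk> \<Longrightarrow>
      transport W y x (t x v w) = t y (transport X y x v) (transport Y y x w)"
    using assms(4) unfolding is_net_tensor_def by blast
  have cl: "t x v w \<in> carrier (fibre W x)" if "v \<in> carrier (fibre X x)" "w \<in> carrier (fibre Y x)" for x v w
    using t[of x] that by (auto simp: is_hilb_tensor_def intro: is_linear_closed)
  have "t a (path_transport X p v) (path_transport Y p w) = path_transport W p (t a v w)"
    if p: "is_path p a a" and v: "v \<in> carrier (fibre X a)" and w: "w \<in> carrier (fibre Y a)" for p v w
    using natural_path_transport[OF isometric_net_sum[OF X Y] W, where T = "\<lambda>x. case_prod (t x)"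
        and x = a and y = a and p = p and v = "(v, w)"] cl nat that
    by (auto simp: is_path_iff_walk net_sum_path_transport[OF X Y p v w])
  then show ?thesis
    unfolding is_rep_tensor_def using t X Y W cl
    by (intro exI[of _ "t a"]) (auto simp: pi1_carrier isometric_net.act_holonomy)
qed

text \<open>The tensor map over \<open>a\<close> is equivariant on pairs and is spread out like an
  intertwiner. Over each \<open>x\<close> it is again a tensor product, since it is composed only
  with unitary transports.\<close>

lemma holonomy_tensor_net:
  assumes conn: "pathwise_connected TYPE('k::order)"
    and X: "isometric_net X" and Y: "isometric_net Y" and W: "hilbert_net_bundle W"
    and "is_rep_tensor (pi1 (a :: 'k)) (holonomy a X) (holonomy a Y) (holonomy a W)"
  shows "is_net_tensor X Y W"
proof -
  interpret W: hilbert_net_bundle W by (rule W)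
  note W' = W.isometric_net
  obtain t where t: "is_hilb_tensor (fibre X a) (fibre Y a) (fibre W a) t"
    and eq: "\<And>g v w. \<lbrakk>g \<in> carrier (pi1 a); v \<in> carrier (fibre X a); w \<in> carrier (fibre Y a)\<rbrakk> \<Longrightarrow>
      act (holonomy a W) g (t v w) = t (act (holonomy a X) g v) (act (holonomy a Y) g w)"
    using assms(5) by (auto simp: is_rep_tensor_def)
  have cl: "t v w \<in> carrier (fibre W a)" if "v \<in> carrier (fibre X a)" "w \<in> carrier (fibre Y a)" for v w
    using t that by (auto simp: is_hilb_tensor_def intro: is_linear_closed)
  let ?S = "net_sum X Y" and ?t = "case_prod t"
  interpret equivariant_map ?S W a ?t
  proof (intro equivariant_map.intro equivariant_map_axioms.intro isometric_net_sum X Y W' conn)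
    fix p z assume p: "is_path p a a" and z: "z \<in> carrier (fibre ?S a)"
    obtain v w where vw: "z = (v, w)" "v \<in> carrier (fibre X a)" "w \<in> carrier (fibre Y a)"
      using z by auto
    show "?t (path_transport ?S p z) = path_transport W p (?t z)"
      using eq[of "homotopy_class p" v w] vw p cl
      by (simp add: net_sum_path_transport[OF X Y p] pi1_carrier isometric_net.act_holonomy[OF W' p]
          isometric_net.act_holonomy[OF X p] isometric_net.act_holonomy[OF Y p])
  qed (auto simp: cl)
  let ?q = "\<lambda>x. rev_path (base_path a x)"
  have sp: "spread a ?S W ?t x (v, w) = path_transport W (base_path a x)
      (t (path_transport X (?q x) v) (path_transport Y (?q x) w))"
    if "v \<in> carrier (fibre X x)" "w \<in> carrier (fibre Y x)" for x v w
    using net_sum_path_transport[OF X Y is_path_rev[OF is_path_base_path[OF conn]] that]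
    by (simp add: spread_def)
  \<comment> \<open>A curried copy of the spread map, equal to it on the fibres, in the shape that
    \<open>is_hilb_tensor_unitary\<close> produces.\<close>
  define T where "T x v w = path_transport W (base_path a x)
      (t (path_transport X (?q x) v) (path_transport Y (?q x) w))" for x v w
  have "is_hilb_tensor (fibre X x) (fibre Y x) (fibre W x) (T x)" for x
    unfolding T_def[abs_def]
    by (intro is_hilb_tensor_unitary[OF _ _ _ _ _ t] W.hilbert_fibre is_path_rev
        isometric_net.path_transport_unitary[OF X] isometric_net.path_transport_unitary[OF Y]
        isometric_net.path_transport_unitary[OF W'] is_path_base_path[OF conn])
  moreover have "transport W y x (T x v w) = T y (transport X y x v) (transport Y y x w)"
    if "x \<le> y" "v \<in> carrier (fibre X x)" "w \<in> carrier (fibre Y x)" for x y v w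
    using spread_natural[OF that(1), of "(v, w)"] that sp
      is_unitary_closed[OF isometric_net.transport_unitary[OF X that(1)]]
      is_unitary_closed[OF isometric_net.transport_unitary[OF Y that(1)]]
    by (simp add: T_def)
  ultimately show ?thesis
    unfolding is_net_tensor_def by blast
qed

section \<open>Trivial bundles\<close>

lemma trivial_bundle_simps [simp]:
  "carrier (fibre (trivial_bundle H) x) = {x} \<times> carrier H"
  "(x, v) \<oplus>\<^bsub>fibre (trivial_bundle H) x\<^esub> (x, w) = (x, v \<oplus>\<^bsub>H\<^esub> w)"
  "c \<odot>\<^bsub>fibre (trivial_bundle H) x\<^esub> (x, v) = (x, c \<odot>\<^bsub>H\<^esub> v)"
  "hinner (fibre (trivial_bundle H) x) (x, v) (x, w) = hinner H v w"
  "transport (trivial_bundle H) y x (x, v) = (y, v)"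
  by (simp_all add: trivial_bundle_def)

lemma isometric_net_trivial:
  assumes "pre_hilb H" shows "isometric_net (trivial_bundle H :: ('k::order, 'k \<times> 'v) net_bundle)"
proof
  fix x y :: 'k assume "x \<le> y"
  have "bij_betw (transport (trivial_bundle H) y x) ({x} \<times> carrier H) ({y} \<times> carrier H)"
    by (auto simp: bij_betw_def inj_on_def image_iff)
  then show "is_unitary (fibre (trivial_bundle H) x) (fibre (trivial_bundle H) y)
      (transport (trivial_bundle H) y x)"
    by (auto simp: is_unitary_def is_linear_def)
qed (use assms in \<open>auto simp: pre_hilb_def\<close>)

lemma trivial_path_transport:
  assumes "pre_hilb H" "v \<in> carrier H" "walk p x y"
  shows "path_transport (trivial_bundle H) p (x, v) = (y, v)"
  using assms(3)
proof (induction p arbitrary: y)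
  case (Cons b p)
  have "simplex_transport (trivial_bundle H) b (bd1 b, v) = (y, v)"
    using Cons.prems assms(2) by (intro isometric_net.simplex_transport_eqI[OF isometric_net_trivial[OF assms(1)], where s = "supp1 b"]) auto
  then show ?case
    using Cons.IH[of "bd1 b"] Cons.prems by simp
qed simp

text \<open>Transport changes only the first component, so \<open>snd\<close> turns the holonomy
  into the identity action.\<close>

lemma holonomy_trivial:
  assumes H: "pre_hilb H"
  shows "rep_isomorphic (pi1 a) (holonomy a (trivial_bundle H)) (trivial_rep H)"
proof (rule unitary_intertwiner_isomorphic[where U = snd])
  note T = isometric_net_trivial[OF H]
  show "act_closed (pi1 a) (holonomy a (trivial_bundle H))" "act_closed (pi1 a) (trivial_rep H)"
    using isometric_net.act_closed_holonomy[OF T] H by (auto simp: act_closed_def trivial_rep_def)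
  have "bij_betw snd ({a} \<times> carrier H) (carrier H)"
    by (auto simp: bij_betw_def inj_on_def image_iff)
  then show "unitary_intertwiner (pi1 a) (holonomy a (trivial_bundle H)) (trivial_rep H) snd"
    using H by (auto simp: unitary_intertwiner_def is_unitary_def is_linear_def trivial_rep_def pi1_carrier
        isometric_net.act_holonomy[OF T] trivial_path_transport is_path_iff_walk)
qed

lemma pre_hilb_complex: "pre_hilb complex_hilb"
  by (auto simp: pre_hilb_def complex_hilb_def)

lemma pre_hilb_zero: "pre_hilb zero_hilb"
  by (auto simp: pre_hilb_def complex_hilb_def zero_hilb_def)

section \<open>Essential surjectivity\<close>

definition copy_rep :: "('v \<Rightarrow> 'w) \<Rightarrow> ('g, 'v) rep \<Rightarrow> ('g, 'w) rep" where
  "copy_rep f V = \<lparr>space = copy_hilb f (space V),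
     act = (\<lambda>g x. f (act V g (inv_into (carrier (space V)) f x)))\<rparr>"

lemma copy_rep:
  assumes V: "V \<in> fd_reps G" and f: "inj_on f (carrier (space V))"
  shows "copy_rep f V \<in> fd_reps G" and "unitary_intertwiner G V (copy_rep f V) f"
proof -
  interpret unitary_rep G V
    using V by (simp add: fd_reps_def)
  interpret H: hilbert_space "space V" by (rule hilbert)
  have act: "act (copy_rep f V) g (f x) = f (act V g x)" if "x \<in> carrier (space V)" for g x
    using f that by (simp add: copy_rep_def)
  have sp: "space (copy_rep f V) = copy_hilb f (space V)"
    by (simp add: copy_rep_def)
  note u = copy_unitary[OF f]
  show "unitary_intertwiner G V (copy_rep f V) f"
    using u by (simp add: unitary_intertwiner_def sp act)
  have "unitary_rep G (copy_rep f V)"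
  proof (rule unitary_rep.intro)
    fix g assume g: "g \<in> carrier G"
    have "is_unitary (copy_hilb f (space V)) (copy_hilb f (space V)) (\<lambda>x. f (act V g (inv_into (carrier (space V)) f x)))"
      by (rule is_unitary_compose[OF is_unitary_compose[OF is_unitary_inv[OF H.pre_hilb u] act_unitary[OF g]] u])
    then show "is_unitary (space (copy_rep f V)) (space (copy_rep f V)) (act (copy_rep f V) g)"
      by (simp add: copy_rep_def)
  next
    fix g h x
    assume "g \<in> carrier G" "h \<in> carrier G" "x \<in> carrier (space (copy_rep f V))"
    then show "act (copy_rep f V) (g \<otimes>\<^bsub>G\<^esub> h) x = act (copy_rep f V) g (act (copy_rep f V) h x)"
      using is_unitary_closed[OF act_unitary] by (auto simp: sp act act_mult)
  qed (auto simp: sp act act_one intro: H.copy_hilbert f)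
  moreover have "finite_dim (space (copy_rep f V))"
    using V finite_dim_unitary[OF hilbert H.copy_hilbert[OF f] u] by (simp add: sp fd_reps_def)
  ultimately show "copy_rep f V \<in> fd_reps G"
    by (simp add: fd_reps_def)
qed

lemma fd_rep_copy:
  assumes large: "(UNIV :: complex set) \<lesssim> (UNIV :: 'w set)" and V: "V \<in> fd_reps G"
  shows "\<exists>W\<in>fd_reps G :: ('g, 'w) rep set. \<exists>U. unitary_intertwiner G V W U"
proof -
  have "hilbert_space (space V)" "finite_dim (space V)"
    using V by (auto simp: fd_reps_def unitary_rep_def)
  then have "carrier (space V) \<lesssim> (UNIV :: 'w set)"
    using finite_dim_lepoll large lepoll_trans by blast
  then obtain f :: "_ \<Rightarrow> 'w" where "inj_on f (carrier (space V))"
    by (auto simp: lepoll_def)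
  then show ?thesis
    using copy_rep[OF V] by blast
qed

lemma (in hilbert_net_bundle) holonomy_unitary_rep: "unitary_rep (pi1 a) (holonomy a X)"
proof (rule unitary_rep.intro)
  interpret isometric_net X by (rule isometric_net)
  show "hilbert_space (space (holonomy a X))"
    using hilbert_fibre by simp
  show "is_unitary (space (holonomy a X)) (space (holonomy a X)) (act (holonomy a X) g)"
    if g: "g \<in> carrier (pi1 a)" for g
  proof -
    obtain p where p: "is_path p a a" "g = homotopy_class p"
      using g by (auto simp: pi1_carrier)
    show ?thesis
      using path_transport_unitary[OF p(1)] act_holonomy[OF p(1)]
        is_unitary_cong[OF pre_hilb_fibre[of a], where T = "act (holonomy a X) g"
          and S = "path_transport X p"] p(2)
      by simp
  qed
  show "act (holonomy a X) \<one>\<^bsub>pi1 a\<^esub> x = x" if "x \<in> carrier (space (holonomy a X))" for x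
    using that act_holonomy[OF is_path_edge[OF order_refl]] path_transport_edge_same
    by (simp add: pi1_one)
  show "act (holonomy a X) (g \<otimes>\<^bsub>pi1 a\<^esub> h) x = act (holonomy a X) g (act (holonomy a X) h x)"
    if "g \<in> carrier (pi1 a)" "h \<in> carrier (pi1 a)" "x \<in> carrier (space (holonomy a X))" for g h x
    using that by (auto simp: pi1_carrier pi1_mult act_holonomy is_path_append path_transport_closed)
qed

lemma holonomy_fd: "X \<in> fd_net_bundles \<Longrightarrow> holonomy a X \<in> fd_reps (pi1 a)"
  by (simp add: fd_net_bundles_def fd_reps_def hilbert_net_bundle.holonomy_unitary_rep)

text \<open>
  A representation \<open>V\<close> of the fundamental group is spread out over \<open>K\<close>: every fibre is a copy
  of \<open>V\<close>, the one over \<open>x\<close> being thought of as identified with \<open>V\<close> by transport along the chosen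
  path from \<open>a\<close> to \<open>x\<close>.
\<close>

locale rep_bundle = unitary_rep "pi1 a" V
  for a :: "'k::order" and V :: "('k simplex1 list set, 'v) rep" +
  fixes i :: "'v \<Rightarrow> complex" and j :: "'k \<times> complex \<Rightarrow> 'e"
  assumes connected: "pathwise_connected TYPE('k)"
    and finite_dim: "finite_dim (space V)"
    and inj_i: "inj_on i (carrier (space V))"
    and inj_j: "inj j"
begin

text \<open>The label \<open>x\<close> makes the fibres disjoint, \<open>i\<close> embeds the
  representation space into the complex numbers and \<open>j\<close> moves the pair into the type of
  total spaces.\<close>

definition point :: "'k \<Rightarrow> 'v \<Rightarrow> 'e" where
  "point x v = j (x, i v)"

definition holo :: "'k simplex1 list \<Rightarrow> 'v \<Rightarrow> 'v" where
  "holo p = act V (homotopy_class p)"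

text \<open>Defined for arbitrary paths, because the parallel transport along any path, not only
  along an edge, is the action of the closed-up path.\<close>

definition closed_up :: "'k \<Rightarrow> 'k \<Rightarrow> 'k simplex1 list \<Rightarrow> 'k simplex1 list" where
  "closed_up y x p = rev_path (base_path a y) @ p @ base_path a x"

definition assoc_bundle :: "('k, 'e) net_bundle" where
  "assoc_bundle = \<lparr>
     tot_space = {point x v | x v. v \<in> carrier (space V)},
     bundle_proj = (\<lambda>e. fst (inv_into UNIV j e)),
     fibre = (\<lambda>x. copy_hilb (point x) (space V)),
     transport = (\<lambda>y x e. point y (holo (closed_up y x [edge y x])
        (inv_into (carrier (space V)) (point x) e)))\<rparr>"

sublocale H: hilbert_space "space V"
  by (rule hilbert)

lemma point_eq_iff:
  "\<lbrakk>v \<in> carrier (space V); w \<in> carrier (space V)\<rbrakk> \<Longrightarrow> point x v = point y w \<longleftrightarrow> x = y \<and> v = w"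
  using inj_i inj_j by (auto simp: point_def inj_on_def inj_def)

lemma inj_point: "inj_on (point x) (carrier (space V))"
  by (simp add: inj_on_def point_eq_iff)

section \<open>Closed-up paths and the transports of the associated bundle\<close>

lemma base_path: "is_path (base_path a x) a x"
  by (rule is_path_base_path[OF connected])

lemma is_path_closed_up: "is_path p x y \<Longrightarrow> is_path (closed_up y x p) a a"
  unfolding closed_up_def using base_path by (meson is_path_append is_path_rev)

lemma holo_unitary: "is_path p a a \<Longrightarrow> is_unitary (space V) (space V) (holo p)"
  unfolding holo_def by (rule act_unitary) (auto simp: pi1_carrier)

lemma holo_closed: "\<lbrakk>is_path p a a; v \<in> carrier (space V)\<rbrakk> \<Longrightarrow> holo p v \<in> carrier (space V)"
  using is_unitary_closed[OF holo_unitary] .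

lemma holo_homotopic: "homotopic p q \<Longrightarrow> holo p = holo q"
  unfolding holo_def using homotopy_class_eq_iff by metis

lemma holo_append:
  "\<lbrakk>is_path p a a; is_path q a a; v \<in> carrier (space V)\<rbrakk> \<Longrightarrow> holo (p @ q) v = holo p (holo q v)"
  unfolding holo_def using act_mult[of "homotopy_class p" "homotopy_class q" v]
  by (auto simp: pi1_mult pi1_carrier)

lemma homotopic_closed_up: "homotopic p q \<Longrightarrow> homotopic (closed_up y x p) (closed_up y x q)"
  unfolding closed_up_def by (rule homotopic_context)

text \<open>The chosen path to \<open>y\<close> and its reverse meet in the middle and cancel, so
  closing up respects composition.\<close>

lemma closed_up_append:
  assumes "is_path p x y" "is_path q y z"
  shows "homotopic (closed_up z y q @ closed_up y x p) (closed_up z x (q @ p))"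
proof -
  have "is_path (rev_path (base_path a z) @ q) y a"
    using assms(2) base_path by (meson is_path_append is_path_rev)
  from homotopic_cancel[OF base_path this, of "p @ base_path a x"] show ?thesis
    by (simp add: closed_up_def)
qed

lemma holo_closed_up_append:
  assumes "is_path p x y" "is_path q y z" "v \<in> carrier (space V)"
  shows "holo (closed_up z y q) (holo (closed_up y x p) v) = holo (closed_up z x (q @ p)) v"
  using holo_append[OF is_path_closed_up[OF assms(2)] is_path_closed_up[OF assms(1)] assms(3)]
    holo_homotopic[OF closed_up_append[OF assms(1,2)]] by simp

lemma holo_null:
  assumes "v \<in> carrier (space V)" shows "holo (closed_up x x [edge x x]) v = v"
proof -
  have "homotopic (closed_up x x [edge x x]) (rev_path (base_path a x) @ base_path a x)"
    unfolding closed_up_def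
    by (intro homotopic_append homotopic_refl homotopic_null_left[OF base_path])
  also have "homotopic \<dots> [edge a a]"
    by (rule homotopic_rev_left[OF base_path])
  finally have "holo (closed_up x x [edge x x]) = holo [edge a a]"
    by (rule holo_homotopic)
  then show ?thesis
    using act_one[OF assms] by (simp add: holo_def pi1_one)
qed

lemma assoc_bundle_simps [simp]:
  "fibre assoc_bundle x = copy_hilb (point x) (space V)"
  "v \<in> carrier (space V) \<Longrightarrow>
     transport assoc_bundle y x (point x v) = point y (holo (closed_up y x [edge y x]) v)"
  using inj_point[of x] by (simp_all add: assoc_bundle_def)

lemma hilbert_net_bundle: "hilbert_net_bundle assoc_bundle"
proof (rule hilbert_net_bundle.intro)
  have proj: "bundle_proj assoc_bundle (point x v) = x" for x v
    using inj_j by (simp add: assoc_bundle_def point_def)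
  show "bundle_proj assoc_bundle ` tot_space assoc_bundle = UNIV"
  proof (intro equalityI subsetI)
    fix x :: 'k
    \<comment> \<open>The zero vector shows that no fibre is empty.\<close>
    have "point x \<zero>\<^bsub>space V\<^esub> \<in> tot_space assoc_bundle"
      by (auto simp: assoc_bundle_def)
    then show "x \<in> bundle_proj assoc_bundle ` tot_space assoc_bundle"
      using proj by (metis imageI)
  qed simp
  show "carrier (fibre assoc_bundle x) = {e \<in> tot_space assoc_bundle. bundle_proj assoc_bundle e = x}" for x
    using proj by (auto simp: assoc_bundle_def)
  show "hilbert_space (fibre assoc_bundle x)" for x
    by (simp add: H.copy_hilbert inj_point)
  show "is_unitary (fibre assoc_bundle x) (fibre assoc_bundle y) (transport assoc_bundle y x)" if "x \<le> y" for x y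
  proof -
    have "is_unitary (space V) (space V) (holo (closed_up y x [edge y x]))"
      by (rule holo_unitary[OF is_path_closed_up[OF is_path_edge[OF that]]])
    from is_unitary_compose[OF is_unitary_compose[OF
          is_unitary_inv[OF H.pre_hilb copy_unitary[OF inj_point]] this] copy_unitary[OF inj_point]]
    show ?thesis by (simp add: assoc_bundle_def)
  qed
  show "transport assoc_bundle x x e = e" if "e \<in> carrier (fibre assoc_bundle x)" for x e
    using that by (auto simp: holo_null)
  show "transport assoc_bundle z y (transport assoc_bundle y x e) = transport assoc_bundle z x e"
    if xy: "x \<le> y" and yz: "y \<le> z" and e: "e \<in> carrier (fibre assoc_bundle x)" for x y z e
  proof -
    obtain v where v: "v \<in> carrier (space V)" "e = point x v"
      using e by auto
    \<comment> \<open>The cocycle identity for transports comes from the homotopy between two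
      successive edges and the direct one.\<close>
    have "holo (closed_up z x ([edge z y] @ [edge y x])) = holo (closed_up z x [edge z x])"
      by (intro holo_homotopic homotopic_closed_up homotopic_edge_comp xy yz)
    then show ?thesis
      using holo_closed_up_append[OF is_path_edge[OF xy] is_path_edge[OF yz] v(1)] v
        holo_closed[OF is_path_closed_up[OF is_path_edge[OF xy]] v(1)] by simp
  qed
qed

text \<open>By \<open>homotopic_edge_simplex\<close>, going along \<open>b\<close> and then up to
  its support is the direct ascent, which is the equation that determines the transport along
  \<open>b\<close>.\<close>

lemma simplex_transport_bundle:
  assumes b: "is_simplex1 b" and v: "v \<in> carrier (space V)"
  shows "simplex_transport assoc_bundle b (point (bd1 b) v) = point (bd0 b) (holo (closed_up (bd0 b) (bd1 b) [b]) v)"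
proof (rule isometric_net.simplex_transport_eqI[OF hilbert_net_bundle.isometric_net[OF hilbert_net_bundle] b order_refl])
  have le: "bd0 b \<le> supp1 b" using b by (simp add: is_simplex1_def)
  let ?w = "holo (closed_up (bd0 b) (bd1 b) [b]) v"
  have w: "?w \<in> carrier (space V)"
    by (intro holo_closed is_path_closed_up is_path_simplex b v)
  then show "point (bd0 b) ?w \<in> carrier (fibre assoc_bundle (bd0 b))"
    by simp
  have "holo (closed_up (supp1 b) (bd0 b) [edge (supp1 b) (bd0 b)]) ?w =
      holo (closed_up (supp1 b) (bd1 b) ([edge (supp1 b) (bd0 b)] @ [b])) v"
    by (rule holo_closed_up_append[OF is_path_simplex[OF b] is_path_edge[OF le] v])
  also have "\<dots> = holo (closed_up (supp1 b) (bd1 b) [edge (supp1 b) (bd1 b)]) v"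
    by (subst holo_homotopic[OF homotopic_closed_up[OF homotopic_edge_simplex[OF b]]]) simp
  finally show "transport assoc_bundle (supp1 b) (bd0 b) (point (bd0 b) ?w) =
      transport assoc_bundle (supp1 b) (bd1 b) (point (bd1 b) v)"
    using v w by simp
qed (use v in simp)

lemma path_transport_bundle:
  assumes "is_path p x y" "v \<in> carrier (space V)"
  shows "path_transport assoc_bundle p (point x v) = point y (holo (closed_up y x p) v)"
  using assms(1)
proof (induction p arbitrary: y)
  case Nil
  then show ?case by (simp add: is_path_def)
next
  case (Cons b p)
  show ?case
  proof (cases "p = []")
    case True
    then show ?thesis
      using Cons.prems simplex_transport_bundle[OF _ assms(2)] by (auto simp: is_path_Cons)
  next
    case False
    then have b: "is_simplex1 b" "bd0 b = y" and p: "is_path p x (bd1 b)"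
      using Cons.prems by (auto simp: is_path_Cons)
    show ?thesis
      using Cons.IH[OF p] simplex_transport_bundle[OF b(1) holo_closed[OF is_path_closed_up[OF p] assms(2)]]
        holo_closed_up_append[OF p is_path_simplex[OF b(1)] assms(2)] b(2) by simp
  qed
qed

text \<open>With \<open>q\<close> the chosen loop at \<open>a\<close>, the holonomy along
  \<open>p\<close> is the action of \<open>q^-1 p q\<close>. The action of \<open>q\<close>
  conjugates it into that of \<open>p\<close>, which accounts for the factor
  \<open>holo (base_path a a)\<close>.\<close>

lemma holonomy_bundle:
  "unitary_intertwiner (pi1 a) (holonomy a assoc_bundle) V
     (\<lambda>e. holo (base_path a a) (inv_into (carrier (space V)) (point a) e))"
proof -
  interpret B: isometric_net assoc_bundle
    by (rule hilbert_net_bundle.isometric_net[OF hilbert_net_bundle])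
  note q = base_path[of a]
  have "holo (base_path a a) (holo (closed_up a a p) v) = holo p (holo (base_path a a) v)"
    if p: "is_path p a a" and v: "v \<in> carrier (space V)" for p v
  proof -
    let ?q = "base_path a a"
    have "homotopic ((?q @ rev_path ?q) @ (p @ ?q)) ([edge a a] @ (p @ ?q))"
      by (rule homotopic_append[OF homotopic_rev_right[OF q] homotopic_refl])
    also have "homotopic \<dots> (p @ ?q)"
      by (rule homotopic_null_left[OF is_path_append[OF q p]])
    finally have "homotopic (?q @ closed_up a a p) (p @ ?q)"
      by (simp add: closed_up_def)
    from holo_homotopic[OF this] show ?thesis
      using holo_append[OF q is_path_closed_up[OF p] v] holo_append[OF p q v] by simp
  qed
  then show ?thesis
    unfolding unitary_intertwiner_def
    using is_unitary_compose[OF is_unitary_inv[OF H.pre_hilb copy_unitary[OF inj_point]] holo_unitary[OF q]]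
      inj_point[of a]
    by (auto simp: pi1_carrier B.act_holonomy path_transport_bundle inv_into_f_f holo_def[symmetric]
        holo_closed is_path_closed_up)
qed

lemma assoc_bundle_fd: "assoc_bundle \<in> fd_net_bundles"
  using hilbert_net_bundle finite_dim_unitary[OF hilbert H.copy_hilbert[OF inj_point]
      copy_unitary[OF inj_point] finite_dim]
  by (simp add: fd_net_bundles_def)

end

lemma holonomy_ess_surj:
  fixes a :: "'k::order"
  assumes conn: "pathwise_connected TYPE('k)"
    and large: "(UNIV :: ('k \<times> complex) set) \<lesssim> (UNIV :: 'e set)"
    and V: "V \<in> fd_reps (pi1 a)"
  shows "\<exists>X\<in>fd_net_bundles :: ('k, 'e) net_bundle set. \<exists>U. unitary_intertwiner (pi1 a) (holonomy a X) V U"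
proof -
  have H: "unitary_rep (pi1 a) V" "hilbert_space (space V)" "finite_dim (space V)"
    using V by (auto simp: fd_reps_def unitary_rep_def)
  obtain i :: "_ \<Rightarrow> complex" where i: "inj_on i (carrier (space V))"
    using finite_dim_lepoll[OF H(2,3)] by (auto simp: lepoll_def)
  obtain j :: "'k \<times> complex \<Rightarrow> 'e" where j: "inj j"
    using large by (auto simp: lepoll_def)
  interpret rep_bundle a V i j
    by (intro rep_bundle.intro rep_bundle_axioms.intro H i j conn)
  show ?thesis
    using assoc_bundle_fd holonomy_bundle by blast
qed

section \<open>Fully faithful and essentially surjective functors\<close>

lemma is_nat_isoI:
  assumes "\<And>X. X \<in> Obj C \<Longrightarrow> is_iso_arr D (Fo X) (Go X) (\<eta> X)"
    and "\<And>X Y f. \<lbrakk>X \<in> Obj C; Y \<in> Obj C; f \<in> Arr C X Y\<rbrakk> \<Longrightarrow>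
      Cmp D (Fo X) (Fo Y) (Go Y) (\<eta> Y) (Fm X Y f) = Cmp D (Fo X) (Go X) (Go Y) (Gm X Y f) (\<eta> X)"
  shows "is_nat_iso C D Fo Fm Go Gm \<eta>"
  using assms by (simp add: is_nat_iso_def)

locale fully_faithful_functor =
  fixes C :: "('o, 'm) category" and D :: "('p, 'n) category"
    and Fo :: "'o \<Rightarrow> 'p" and Fm :: "'o \<Rightarrow> 'o \<Rightarrow> 'm \<Rightarrow> 'n"
  assumes C: "is_category C" and D: "is_category D" and F: "is_functor C D Fo Fm"
    and bij: "\<lbrakk>X \<in> Obj C; Y \<in> Obj C\<rbrakk> \<Longrightarrow> bij_betw (Fm X Y) (Arr C X Y) (Arr D (Fo X) (Fo Y))"
begin

lemma C_simps:
  "X \<in> Obj C \<Longrightarrow> Idt C X \<in> Arr C X X"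
  "\<lbrakk>X \<in> Obj C; Y \<in> Obj C; Z \<in> Obj C; f \<in> Arr C X Y; g \<in> Arr C Y Z\<rbrakk> \<Longrightarrow> Cmp C X Y Z g f \<in> Arr C X Z"
  using C by (auto simp: is_category_def)

lemma D_simps:
  "V \<in> Obj D \<Longrightarrow> Idt D V \<in> Arr D V V"
  "\<lbrakk>U \<in> Obj D; V \<in> Obj D; W \<in> Obj D; f \<in> Arr D U V; g \<in> Arr D V W\<rbrakk> \<Longrightarrow> Cmp D U V W g f \<in> Arr D U W"
  "\<lbrakk>U \<in> Obj D; V \<in> Obj D; f \<in> Arr D U V\<rbrakk> \<Longrightarrow> Cmp D U U V f (Idt D U) = f"
  "\<lbrakk>U \<in> Obj D; V \<in> Obj D; f \<in> Arr D U V\<rbrakk> \<Longrightarrow> Cmp D U V V (Idt D V) f = f"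
  using D by (auto simp: is_category_def)

lemma D_assoc:
  "\<lbrakk>U \<in> Obj D; V \<in> Obj D; W \<in> Obj D; Z \<in> Obj D; f \<in> Arr D U V; g \<in> Arr D V W; h \<in> Arr D W Z\<rbrakk> \<Longrightarrow>
   Cmp D U V Z (Cmp D V W Z h g) f = Cmp D U W Z h (Cmp D U V W g f)"
  using D by (simp add: is_category_def)

lemma F_simps:
  "X \<in> Obj C \<Longrightarrow> Fo X \<in> Obj D"
  "\<lbrakk>X \<in> Obj C; Y \<in> Obj C; f \<in> Arr C X Y\<rbrakk> \<Longrightarrow> Fm X Y f \<in> Arr D (Fo X) (Fo Y)"
  "X \<in> Obj C \<Longrightarrow> Fm X X (Idt C X) = Idt D (Fo X)"
  "\<lbrakk>X \<in> Obj C; Y \<in> Obj C; Z \<in> Obj C; f \<in> Arr C X Y; g \<in> Arr C Y Z\<rbrakk> \<Longrightarrow>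
   Fm X Z (Cmp C X Y Z g f) = Cmp D (Fo X) (Fo Y) (Fo Z) (Fm Y Z g) (Fm X Y f)"
  using F by (auto simp: is_functor_def)

lemma F_eqI:
  "\<lbrakk>X \<in> Obj C; Y \<in> Obj C; f \<in> Arr C X Y; g \<in> Arr C X Y; Fm X Y f = Fm X Y g\<rbrakk> \<Longrightarrow> f = g"
  using bij[of X Y] by (auto simp: bij_betw_def inj_on_def)

definition lift :: "'o \<Rightarrow> 'o \<Rightarrow> 'n \<Rightarrow> 'm" where
  "lift X Y = inv_into (Arr C X Y) (Fm X Y)"

lemma lift:
  assumes "X \<in> Obj C" "Y \<in> Obj C" "k \<in> Arr D (Fo X) (Fo Y)"
  shows "lift X Y k \<in> Arr C X Y" "Fm X Y (lift X Y k) = k"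
  using bij[OF assms(1,2)] assms(3) unfolding lift_def bij_betw_def
  by (metis inv_into_into, metis f_inv_into_f)

text \<open>Identities between arrows of \<open>C\<close> are checked in \<open>D\<close> by
  faithfulness, where the chosen isomorphisms \<open>e V\<close> from \<open>Fo (Go V)\<close> to
  \<open>V\<close> are available.\<close>

lemma equivalent:
  assumes surj: "\<And>V. V \<in> Obj D \<Longrightarrow> \<exists>X\<in>Obj C. \<exists>f. is_iso_arr D (Fo X) V f"
  shows "equivalent_categories C D"
proof -
  obtain Go e where G: "\<And>V. V \<in> Obj D \<Longrightarrow> Go V \<in> Obj C"
    and e_iso: "\<And>V. V \<in> Obj D \<Longrightarrow> is_iso_arr D (Fo (Go V)) V (e V)"
    using surj by metis
  obtain d where e: "\<And>V. V \<in> Obj D \<Longrightarrow> e V \<in> Arr D (Fo (Go V)) V"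
    and d: "\<And>V. V \<in> Obj D \<Longrightarrow> d V \<in> Arr D V (Fo (Go V))"
    and de: "\<And>V. V \<in> Obj D \<Longrightarrow> Cmp D (Fo (Go V)) V (Fo (Go V)) (d V) (e V) = Idt D (Fo (Go V))"
    and ed: "\<And>V. V \<in> Obj D \<Longrightarrow> Cmp D V (Fo (Go V)) V (e V) (d V) = Idt D V"
    using e_iso unfolding is_iso_arr_def by metis
  \<comment> \<open>The image under the given functor that the quasi-inverse of \<open>g\<close>
    must have: \<open>d W\<close> after \<open>g\<close> after \<open>e V\<close>, with
    \<open>d\<close> inverse to \<open>e\<close>. Fullness lifts it to \<open>C\<close>.\<close>
  define Gd where "Gd V W g = Cmp D (Fo (Go V)) V (Fo (Go W)) (Cmp D V W (Fo (Go W)) (d W) g) (e V)" for V W g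
  define Gm where "Gm V W g = lift (Go V) (Go W) (Gd V W g)" for V W g
  note F_functor = F and F = F_simps(1,2) G
  have Gd: "Gd V W g \<in> Arr D (Fo (Go V)) (Fo (Go W))" if "V \<in> Obj D" "W \<in> Obj D" "g \<in> Arr D V W" for V W g
    unfolding Gd_def using that by (intro D_simps(2)[of _ V] D_simps(2)[of _ W] F e d)
  have Gm: "Gm V W g \<in> Arr C (Go V) (Go W)" "Fm (Go V) (Go W) (Gm V W g) = Gd V W g"
    if "V \<in> Obj D" "W \<in> Obj D" "g \<in> Arr D V W" for V W g
    unfolding Gm_def using lift[OF G G Gd] that by auto
  have Gd_id: "Gd V V (Idt D V) = Idt D (Fo (Go V))" if "V \<in> Obj D" for V
    using that by (simp add: Gd_def D_simps F d de)
  \<comment> \<open>Naturality of \<open>e\<close>, which also moves \<open>e\<close> through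
    composites in the proof of functoriality.\<close>
  have eGd: "Cmp D (Fo (Go V)) (Fo (Go W)) W (e W) (Gd V W g) = Cmp D (Fo (Go V)) V W g (e V)"
    if V: "V \<in> Obj D" "W \<in> Obj D" and g: "g \<in> Arr D V W" for V W g
  proof -
    have "Gd V W g = Cmp D (Fo (Go V)) W (Fo (Go W)) (d W) (Cmp D (Fo (Go V)) V W g (e V))"
      using V g by (simp add: Gd_def D_assoc F e d)
    moreover have ge: "Cmp D (Fo (Go V)) V W g (e V) \<in> Arr D (Fo (Go V)) W"
      using V g by (intro D_simps(2)[of _ V] F e)
    ultimately show ?thesis
      using D_assoc[OF _ _ _ _ ge d[OF V(2)] e[OF V(2)], symmetric] V by (simp add: F ed D_simps)
  qed
  have Gd_comp: "Gd U W (Cmp D U V W g f) = Cmp D (Fo (Go U)) (Fo (Go V)) (Fo (Go W)) (Gd V W g) (Gd U V f)"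
    if U: "U \<in> Obj D" "V \<in> Obj D" "W \<in> Obj D" and f: "f \<in> Arr D U V" and g: "g \<in> Arr D V W" for U V W f g
  proof -
    have dg: "Cmp D V W (Fo (Go W)) (d W) g \<in> Arr D V (Fo (Go W))"
      using U g by (intro D_simps(2)[of _ W] F d)
    have "Cmp D (Fo (Go U)) (Fo (Go V)) (Fo (Go W)) (Gd V W g) (Gd U V f) =
        Cmp D (Fo (Go U)) V (Fo (Go W)) (Cmp D V W (Fo (Go W)) (d W) g)
          (Cmp D (Fo (Go U)) (Fo (Go V)) V (e V) (Gd U V f))"
      unfolding Gd_def[of V W] using U f by (intro D_assoc F Gd e dg)
    also have "\<dots> = Cmp D (Fo (Go U)) V (Fo (Go W)) (Cmp D V W (Fo (Go W)) (d W) g)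
          (Cmp D (Fo (Go U)) U V f (e U))"
      using U f by (simp add: eGd)
    also have "\<dots> = Cmp D (Fo (Go U)) U (Fo (Go W)) (Cmp D U V (Fo (Go W)) (Cmp D V W (Fo (Go W)) (d W) g) f) (e U)"
      using U f by (intro D_assoc[symmetric] F e dg)
    also have "Cmp D U V (Fo (Go W)) (Cmp D V W (Fo (Go W)) (d W) g) f = Cmp D U W (Fo (Go W)) (d W) (Cmp D U V W g f)"
      using U f g by (intro D_assoc F d)
    finally show ?thesis by (simp add: Gd_def)
  qed
  have G_functor: "is_functor D C Go Gm"
    unfolding is_functor_def
  proof (intro conjI ballI)
    fix V assume V: "V \<in> Obj D"
    show "Go V \<in> Obj C" by (rule G[OF V])
    show "Gm V V (Idt D V) = Idt C (Go V)"
      using V Gm[OF V V D_simps(1)[OF V]]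
      by (intro F_eqI[OF G[OF V] G[OF V]]) (auto simp: C_simps G F_simps Gd_id)
  next
    fix U V W f g
    assume U: "U \<in> Obj D" "V \<in> Obj D" "W \<in> Obj D" and f: "f \<in> Arr D U V" and g: "g \<in> Arr D V W"
    have gf: "Cmp D U V W g f \<in> Arr D U W"
      using U f g by (intro D_simps(2)[of _ V])
    show "Gm U W (Cmp D U V W g f) = Cmp C (Go U) (Go V) (Go W) (Gm V W g) (Gm U V f)"
      using U Gm[OF U(1,2) f] Gm[OF U(2,3) g] Gm[OF U(1,3) gf]
      by (intro F_eqI[OF G[OF U(1)] G[OF U(3)]])
        (auto simp: F_simps G Gd_comp[OF U f g] intro: C_simps(2))
  qed (rule Gm)
  have counit: "is_nat_iso D D (\<lambda>X. Fo (Go X)) (\<lambda>X Y f. Fm (Go X) (Go Y) (Gm X Y f)) (\<lambda>X. X) (\<lambda>X Y f. f) e"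
    by (rule is_nat_isoI) (auto simp: e_iso Gm eGd)
  \<comment> \<open>The unit and its inverse are the lifts of \<open>d\<close> and \<open>e\<close>
    at the objects \<open>Fo X\<close>.\<close>
  define h where "h X = lift X (Go (Fo X)) (d (Fo X))" for X
  define k where "k X = lift (Go (Fo X)) X (e (Fo X))" for X
  have h: "h X \<in> Arr C X (Go (Fo X))" "Fm X (Go (Fo X)) (h X) = d (Fo X)"
    and k: "k X \<in> Arr C (Go (Fo X)) X" "Fm (Go (Fo X)) X (k X) = e (Fo X)" if "X \<in> Obj C" for X
    unfolding h_def k_def using that by (auto intro!: lift F d e)
  have unit: "is_nat_iso C C (\<lambda>X. X) (\<lambda>X Y f. f) (\<lambda>X. Go (Fo X)) (\<lambda>X Y f. Gm (Fo X) (Fo Y) (Fm X Y f)) h"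
  proof (rule is_nat_isoI)
    fix X assume X: "X \<in> Obj C"
    note GX = G[OF F_simps(1)[OF X]]
    have "Cmp C X (Go (Fo X)) X (k X) (h X) = Idt C X"
      using X GX h k by (intro F_eqI[OF X X]) (auto simp: F_simps C_simps ed intro: C_simps(2))
    moreover have "Cmp C (Go (Fo X)) X (Go (Fo X)) (h X) (k X) = Idt C (Go (Fo X))"
      using X GX h k by (intro F_eqI[OF GX GX]) (auto simp: F_simps C_simps de intro: C_simps(2))
    ultimately show "is_iso_arr C X (Go (Fo X)) (h X)"
      unfolding is_iso_arr_def using h k X by blast
  next
    fix X Y f assume X: "X \<in> Obj C" "Y \<in> Obj C" and f: "f \<in> Arr C X Y"
    let ?X = "Fo X" and ?Y = "Fo Y" and ?f = "Fm X Y f"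
    have D: "?X \<in> Obj D" "?Y \<in> Obj D" "?f \<in> Arr D ?X ?Y" and G': "Go ?X \<in> Obj C" "Go ?Y \<in> Obj C"
      using X f by (auto intro: F)
    have df: "Cmp D ?X ?Y (Fo (Go ?Y)) (d ?Y) ?f \<in> Arr D ?X (Fo (Go ?Y))"
      using D G' X f by (intro D_simps(2)[of _ ?Y] F d)
    have "Cmp D ?X (Fo (Go ?X)) (Fo (Go ?Y)) (Gd ?X ?Y ?f) (d ?X) =
        Cmp D ?X ?X (Fo (Go ?Y)) (Cmp D ?X ?Y (Fo (Go ?Y)) (d ?Y) ?f) (Cmp D ?X (Fo (Go ?X)) ?X (e ?X) (d ?X))"
      unfolding Gd_def using D G' X f by (intro D_assoc F e d df)
    also have "\<dots> = Cmp D ?X ?Y (Fo (Go ?Y)) (d ?Y) ?f"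
      using D df G' by (simp add: ed D_simps F)
    finally have eq: "Cmp D ?X ?Y (Fo (Go ?Y)) (d ?Y) ?f =
        Cmp D ?X (Fo (Go ?X)) (Fo (Go ?Y)) (Gd ?X ?Y ?f) (d ?X)" ..
    note m = Gm[OF D]
    show "Cmp C X Y (Go ?Y) (h Y) f = Cmp C X (Go ?X) (Go ?Y) (Gm ?X ?Y ?f) (h X)"
    proof (rule F_eqI[OF X(1) G'(2)])
      show "Cmp C X Y (Go ?Y) (h Y) f \<in> Arr C X (Go ?Y)"
        by (rule C_simps(2)[OF X G'(2) f h(1)[OF X(2)]])
      show "Cmp C X (Go ?X) (Go ?Y) (Gm ?X ?Y ?f) (h X) \<in> Arr C X (Go ?Y)"
        by (rule C_simps(2)[OF X(1) G' h(1)[OF X(1)] m(1)])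
      show "Fm X (Go ?Y) (Cmp C X Y (Go ?Y) (h Y) f) = Fm X (Go ?Y) (Cmp C X (Go ?X) (Go ?Y) (Gm ?X ?Y ?f) (h X))"
        using eq by (simp add: F_simps(4)[OF X G'(2) f h(1)[OF X(2)]]
            F_simps(4)[OF X(1) G' h(1)[OF X(1)] m(1)] h X m(2))
    qed
  qed
  show ?thesis
    unfolding equivalent_categories_def
    using C D F_functor G_functor unit counit by blast
qed

end

section \<open>Isomorphisms of Grothendieck rings\<close>

text \<open>
  The operations on \<open>S\<close> and \<open>T\<close> are not assumed to be closed on the carriers; a larger domain \<open>E\<close>
  on which \<open>\<phi>\<close> is compatible with them is enough. This makes it unnecessary to realise
  direct sums and tensor products in the given universes.
\<close>

lemma grothendieck_ring_iso:
  fixes S :: "'a ring" and T :: "'b ring" and \<phi> :: "'a \<Rightarrow> 'b"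
  assumes sub: "carrier S \<subseteq> E" and inj: "inj_on \<phi> E"
    and closed: "\<And>x y. \<lbrakk>x \<in> E; y \<in> E\<rbrakk> \<Longrightarrow> x \<oplus>\<^bsub>S\<^esub> y \<in> E" "\<And>x y. \<lbrakk>x \<in> E; y \<in> E\<rbrakk> \<Longrightarrow> x \<otimes>\<^bsub>S\<^esub> y \<in> E"
    and hom: "\<And>x y. \<lbrakk>x \<in> E; y \<in> E\<rbrakk> \<Longrightarrow> \<phi> (x \<oplus>\<^bsub>S\<^esub> y) = \<phi> x \<oplus>\<^bsub>T\<^esub> \<phi> y"
      "\<And>x y. \<lbrakk>x \<in> E; y \<in> E\<rbrakk> \<Longrightarrow> \<phi> (x \<otimes>\<^bsub>S\<^esub> y) = \<phi> x \<otimes>\<^bsub>T\<^esub> \<phi> y"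
    and units: "\<zero>\<^bsub>S\<^esub> \<in> E" "\<one>\<^bsub>S\<^esub> \<in> E" "\<phi> \<zero>\<^bsub>S\<^esub> = \<zero>\<^bsub>T\<^esub>" "\<phi> \<one>\<^bsub>S\<^esub> = \<one>\<^bsub>T\<^esub>"
    and image: "\<phi> ` carrier S = carrier T"
  shows "grothendieck_ring S \<simeq> grothendieck_ring T"
proof -
  define f where "f = map_prod \<phi> \<phi>"
  have f [simp]: "f (x, y) = (\<phi> x, \<phi> y)" for x y
    by (simp add: f_def)
  have mem: "\<phi> x \<in> carrier T \<longleftrightarrow> x \<in> carrier S" if "x \<in> E" for x
    unfolding image[symmetric] by (rule inj_on_image_mem_iff[OF inj that sub])
  have inE: "x \<in> E" if "x \<in> carrier S" for x
    using that sub by blast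
  have injf: "inj_on f (E \<times> E)"
    using inj by (auto simp: inj_on_def)
  \<comment> \<open>Each \<open>k\<close> in \<open>carrier T\<close> is the image of one in
    \<open>carrier S\<close>, so cancellation witnesses can be moved across; injectivity on
    \<open>E\<close> then removes \<open>\<phi>\<close>.\<close>
  have rel: "(f p, f q) \<in> grothendieck_rel T \<longleftrightarrow> (p, q) \<in> grothendieck_rel S"
    if "p \<in> E \<times> E" "q \<in> E \<times> E" for p q
  proof -
    obtain x y z w where p: "p = (x, y)" "q = (z, w)" by (metis surj_pair)
    then have E: "x \<in> E" "y \<in> E" "z \<in> E" "w \<in> E" using that by auto
    have "(\<exists>k\<in>carrier T. \<phi> x \<oplus>\<^bsub>T\<^esub> \<phi> w \<oplus>\<^bsub>T\<^esub> k = \<phi> z \<oplus>\<^bsub>T\<^esub> \<phi> y \<oplus>\<^bsub>T\<^esub> k) \<longleftrightarrow>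
        (\<exists>k\<in>carrier S. \<phi> (x \<oplus>\<^bsub>S\<^esub> w \<oplus>\<^bsub>S\<^esub> k) = \<phi> (z \<oplus>\<^bsub>S\<^esub> y \<oplus>\<^bsub>S\<^esub> k))"
      unfolding image[symmetric] using E inE by (simp add: hom closed)
    also have "\<dots> \<longleftrightarrow> (\<exists>k\<in>carrier S. x \<oplus>\<^bsub>S\<^esub> w \<oplus>\<^bsub>S\<^esub> k = z \<oplus>\<^bsub>S\<^esub> y \<oplus>\<^bsub>S\<^esub> k)"
      using E inE by (simp add: inj_on_eq_iff[OF inj] closed)
    finally show ?thesis
      using E by (simp add: p grothendieck_rel_def mem)
  qed
  have rel_sub: "grothendieck_rel R \<subseteq> (carrier R \<times> carrier R) \<times> (carrier R \<times> carrier R)" for R :: "'z ring"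
    by (auto simp: grothendieck_rel_def)
  \<comment> \<open>Pairs outside \<open>carrier S\<close> are included: their class is empty, and
    so is that of their image. This matters because results of the operations are only known to lie
    in \<open>E\<close>.\<close>
  have cls: "grothendieck_rel T `` {f p} = f ` (grothendieck_rel S `` {p})" if p: "p \<in> E \<times> E" for p
  proof (intro equalityI subsetI)
    fix q' assume q': "q' \<in> grothendieck_rel T `` {f p}"
    then have "q' \<in> carrier T \<times> carrier T" using rel_sub by blast
    then obtain q where q: "q \<in> carrier S \<times> carrier S" "q' = f q"
      unfolding image[symmetric] by auto
    then show "q' \<in> f ` (grothendieck_rel S `` {p})"
      using rel[OF p, of q] q' inE by auto
  next
    fix q' assume "q' \<in> f ` (grothendieck_rel S `` {p})"
    then obtain q where q: "(p, q) \<in> grothendieck_rel S" "q' = f q" by auto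
    then have "q \<in> E \<times> E" using rel_sub sub by blast
    then show "q' \<in> grothendieck_rel T `` {f p}"
      using rel[OF p] q by auto
  qed
  have GS: "A \<subseteq> E \<times> E" if "A \<in> carrier (grothendieck_ring S)" for A
    using that rel_sub[of S] sub by (auto simp: grothendieck_ring_def quotient_def)
  have Gcar: "carrier (grothendieck_ring T) = image f ` carrier (grothendieck_ring S)"
  proof -
    have "carrier T \<times> carrier T = f ` (carrier S \<times> carrier S)"
      unfolding image[symmetric] by force
    then have "carrier (grothendieck_ring T) = (\<lambda>p. grothendieck_rel T `` {f p}) ` (carrier S \<times> carrier S)"
      by (auto simp: grothendieck_ring_def quotient_def)
    also have "\<dots> = (\<lambda>p. f ` (grothendieck_rel S `` {p})) ` (carrier S \<times> carrier S)"
      by (intro image_cong refl cls) (use sub in auto)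
    also have "\<dots> = image f ` carrier (grothendieck_ring S)"
      by (auto simp: grothendieck_ring_def quotient_def)
    finally show ?thesis .
  qed
  have "image f \<in> ring_iso (grothendieck_ring S) (grothendieck_ring T)"
  proof (rule ring_iso_memI)
    show "bij_betw (image f) (carrier (grothendieck_ring S)) (carrier (grothendieck_ring T))"
      unfolding bij_betw_def Gcar using inj_on_image_eq_iff[OF injf] GS
      by (auto intro!: inj_onI)
    show "f ` \<one>\<^bsub>grothendieck_ring S\<^esub> = \<one>\<^bsub>grothendieck_ring T\<^esub>"
      using cls[of "(\<one>\<^bsub>S\<^esub>, \<zero>\<^bsub>S\<^esub>)"] by (simp add: grothendieck_ring_def units)
  next
    fix A B
    assume A: "A \<in> carrier (grothendieck_ring S)" and B: "B \<in> carrier (grothendieck_ring S)"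
    show "f ` A \<in> carrier (grothendieck_ring T)"
      using A Gcar by blast
    have E: "x \<in> E" "y \<in> E" "z \<in> E" "w \<in> E" if "(x, y) \<in> A" "(z, w) \<in> B" for x y z w
      using that GS[OF A] GS[OF B] by auto
    \<comment> \<open>Treats sum and product at once: \<open>g\<close> is the formula for the
      resulting pair in terms of \<open>S\<close>, \<open>g'\<close> the same formula in terms of
      \<open>T\<close>.\<close>
    have un: "f ` (\<Union>(a, b)\<in>A. \<Union>(c, d)\<in>B. grothendieck_rel S `` {g a b c d}) =
        (\<Union>(a, b)\<in>f ` A. \<Union>(c, d)\<in>f ` B. grothendieck_rel T `` {g' a b c d})"
      if g: "\<And>a b c d. \<lbrakk>(a, b) \<in> A; (c, d) \<in> B\<rbrakk> \<Longrightarrow>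
        g a b c d \<in> E \<times> E \<and> f (g a b c d) = g' (\<phi> a) (\<phi> b) (\<phi> c) (\<phi> d)" for g g'
    proof -
      have each: "f ` (grothendieck_rel S `` {g a b c d}) = grothendieck_rel T `` {g' (\<phi> a) (\<phi> b) (\<phi> c) (\<phi> d)}"
        if "(a, b) \<in> A" "(c, d) \<in> B" for a b c d
        using cls[of "g a b c d"] g[OF that] by simp
      have "f ` (\<Union>(a, b)\<in>A. \<Union>(c, d)\<in>B. grothendieck_rel S `` {g a b c d}) =
          (\<Union>(a, b)\<in>A. \<Union>(c, d)\<in>B. f ` (grothendieck_rel S `` {g a b c d}))"
        by (simp add: image_UN case_prod_unfold)
      also have "\<dots> = (\<Union>(a, b)\<in>A. \<Union>(c, d)\<in>B. grothendieck_rel T `` {g' (\<phi> a) (\<phi> b) (\<phi> c) (\<phi> d)})"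
        by (simp add: case_prod_unfold each cong: SUP_cong)
      also have "\<dots> = (\<Union>(a, b)\<in>f ` A. \<Union>(c, d)\<in>f ` B. grothendieck_rel T `` {g' a b c d})"
        by (simp add: case_prod_unfold f_def)
      finally show ?thesis .
    qed
    show "f ` (A \<otimes>\<^bsub>grothendieck_ring S\<^esub> B) = f ` A \<otimes>\<^bsub>grothendieck_ring T\<^esub> f ` B"
      unfolding grothendieck_ring_def monoid.simps ring.simps
      by (rule un) (simp add: E hom closed)
    show "f ` (A \<oplus>\<^bsub>grothendieck_ring S\<^esub> B) = f ` A \<oplus>\<^bsub>grothendieck_ring T\<^esub> f ` B"
      unfolding grothendieck_ring_def monoid.simps ring.simps
      by (rule un) (simp add: E hom closed)
  qed
  then show ?thesis
    by (auto simp: is_ring_iso_def)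
qed

text \<open>A relation rather than a map, since a bundle realises a whole isomorphism class of
  representations. The equivalence laws are asked of \<open>isom'\<close>; what is used of
  \<open>isom\<close> is derived through \<open>R\<close>.\<close>

locale class_correspondence =
  fixes Ob :: "'o set" and isom :: "'o \<Rightarrow> 'o \<Rightarrow> bool"
    and Ob' :: "'p set" and isom' :: "'p \<Rightarrow> 'p \<Rightarrow> bool"
    and R :: "'o \<Rightarrow> 'p \<Rightarrow> bool"
  assumes total: "X \<in> Ob \<Longrightarrow> \<exists>V\<in>Ob'. R X V"
    and surj: "V \<in> Ob' \<Longrightarrow> \<exists>X\<in>Ob. R X V"
    and isom_iff: "\<lbrakk>X \<in> Ob; Y \<in> Ob; V \<in> Ob'; W \<in> Ob'; R X V; R Y W\<rbrakk> \<Longrightarrow> isom X Y \<longleftrightarrow> isom' V W"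
    and R_isom': "\<lbrakk>X \<in> Ob; V \<in> Ob'; W \<in> Ob'; R X V; isom' V W\<rbrakk> \<Longrightarrow> R X W"
    and refl': "V \<in> Ob' \<Longrightarrow> isom' V V"
    and sym': "\<lbrakk>V \<in> Ob'; W \<in> Ob'; isom' V W\<rbrakk> \<Longrightarrow> isom' W V"
    and trans': "\<lbrakk>U \<in> Ob'; V \<in> Ob'; W \<in> Ob'; isom' U V; isom' V W\<rbrakk> \<Longrightarrow> isom' U W"
begin

lemma R_isom: "\<lbrakk>X \<in> Ob; Y \<in> Ob; V \<in> Ob'; R X V; isom X Y\<rbrakk> \<Longrightarrow> R Y V"
  using total[of Y] isom_iff[of X Y V] R_isom' sym' by meson

lemma isom_R: "\<lbrakk>X \<in> Ob; Y \<in> Ob; V \<in> Ob'; R X V; R Y V\<rbrakk> \<Longrightarrow> isom X Y"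
  using isom_iff[of X Y V V] refl' by simp

lemma isom'_R: "\<lbrakk>X \<in> Ob; V \<in> Ob'; W \<in> Ob'; R X V; R X W\<rbrakk> \<Longrightarrow> isom' V W"
  using isom_iff[of X X V W] isom_R[of X X V] by simp

text \<open>The domain \<open>E\<close> for \<open>grothendieck_ring_iso\<close>. Besides
  isomorphism classes it contains their unions and the empty set and, by \<open>matches_op\<close>,
  the values of matched operations on such sets.\<close>

definition saturated :: "'o set set" where
  "saturated = {A. A \<subseteq> Ob \<and> (\<forall>X\<in>A. \<forall>Y\<in>Ob. isom X Y \<longrightarrow> Y \<in> A)}"

definition \<Phi> :: "'o set \<Rightarrow> 'p set" where
  "\<Phi> A = {V \<in> Ob'. \<exists>X\<in>A. R X V}"

text \<open>All objects related to \<open>V\<close> are isomorphic, so for a saturated set a single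
  related pair settles the existential quantifier in \<open>\<Phi>\<close>.\<close>

lemma \<Phi>_iff:
  assumes "A \<in> saturated" "X \<in> Ob" "V \<in> Ob'" "R X V"
  shows "V \<in> \<Phi> A \<longleftrightarrow> X \<in> A"
  using assms isom_R unfolding saturated_def \<Phi>_def by blast

lemma inj_\<Phi>: "inj_on \<Phi> saturated"
proof (rule inj_onI)
  fix A B assume AB: "A \<in> saturated" "B \<in> saturated" "\<Phi> A = \<Phi> B"
  have "X \<in> A \<longleftrightarrow> X \<in> B" if X: "X \<in> Ob" for X
    using total[OF X] \<Phi>_iff[OF AB(1) X] \<Phi>_iff[OF AB(2) X] AB(3) by auto
  then show "A = B"
    using AB by (auto simp: saturated_def)
qed

lemma \<Phi>_eqI:
  assumes "A \<in> saturated" "B \<subseteq> Ob'" "\<And>X V. \<lbrakk>X \<in> Ob; V \<in> Ob'; R X V\<rbrakk> \<Longrightarrow> V \<in> B \<longleftrightarrow> X \<in> A"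
  shows "\<Phi> A = B"
proof (rule Set.set_eqI)
  fix V
  show "V \<in> \<Phi> A \<longleftrightarrow> V \<in> B"
  proof (cases "V \<in> Ob'")
    case True
    then obtain X where "X \<in> Ob" "R X V" using surj by blast
    then show ?thesis using True \<Phi>_iff[OF assms(1)] assms(3) by blast
  qed (use assms(2) in \<open>auto simp: \<Phi>_def\<close>)
qed

lemma saturated_class:
  assumes "X \<in> Ob" shows "{Z \<in> Ob. isom X Z} \<in> saturated"
proof -
  obtain V where "V \<in> Ob'" "R X V" using total[OF assms] by blast
  then have "isom X Z \<longleftrightarrow> R Z V" if "Z \<in> Ob" for Z
    using that assms isom_R R_isom by blast
  then show ?thesis
    unfolding saturated_def using R_isom \<open>V \<in> Ob'\<close> by auto
qed

lemma \<Phi>_class: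
  assumes "X \<in> Ob" "V \<in> Ob'" "R X V"
  shows "\<Phi> {Z \<in> Ob. isom X Z} = {W \<in> Ob'. isom' V W}"
  by (rule \<Phi>_eqI[OF saturated_class]) (use assms isom_iff in auto)

lemma \<Phi>_classes: "\<Phi> ` ((\<lambda>X. {Z \<in> Ob. isom X Z}) ` Ob) = (\<lambda>V. {W \<in> Ob'. isom' V W}) ` Ob'"
proof (intro equalityI subsetI)
  fix B assume "B \<in> \<Phi> ` ((\<lambda>X. {Z \<in> Ob. isom X Z}) ` Ob)"
  then obtain X where "X \<in> Ob" "B = \<Phi> {Z \<in> Ob. isom X Z}" by auto
  moreover from this obtain V where "V \<in> Ob'" "R X V" using total by blast
  ultimately show "B \<in> (\<lambda>V. {W \<in> Ob'. isom' V W}) ` Ob'"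
    using \<Phi>_class by (intro image_eqI[of _ _ V]) auto
next
  fix B assume "B \<in> (\<lambda>V. {W \<in> Ob'. isom' V W}) ` Ob'"
  then obtain V where "V \<in> Ob'" "B = {W \<in> Ob'. isom' V W}" by auto
  moreover from this obtain X where "X \<in> Ob" "R X V" using surj by blast
  ultimately show "B \<in> \<Phi> ` ((\<lambda>X. {Z \<in> Ob. isom X Z}) ` Ob)"
    using \<Phi>_class by (intro image_eqI[of _ _ "{Z \<in> Ob. isom X Z}"]) auto
qed

text \<open>Partners of a triple are only asked to exist, because a tensor product is carried along
  unitary intertwiners and the partners must be picked accordingly. Invariance in the last argument
  makes up for the choice of the result.\<close>

definition matches :: "('o \<Rightarrow> 'o \<Rightarrow> 'o \<Rightarrow> bool) \<Rightarrow> ('p \<Rightarrow> 'p \<Rightarrow> 'p \<Rightarrow> bool) \<Rightarrow> bool" where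
  "matches P P' \<longleftrightarrow>
     (\<forall>X\<in>Ob. \<forall>Y\<in>Ob. \<forall>Z\<in>Ob. P X Y Z \<longrightarrow>
        (\<exists>U\<in>Ob'. \<exists>V\<in>Ob'. \<exists>W\<in>Ob'. R X U \<and> R Y V \<and> R Z W \<and> P' U V W)) \<and>
     (\<forall>U\<in>Ob'. \<forall>V\<in>Ob'. \<forall>W\<in>Ob'. P' U V W \<longrightarrow>
        (\<exists>X\<in>Ob. \<exists>Y\<in>Ob. \<exists>Z\<in>Ob. R X U \<and> R Y V \<and> R Z W \<and> P X Y Z)) \<and>
     (\<forall>X\<in>Ob. \<forall>Y\<in>Ob. \<forall>Z\<in>Ob. \<forall>Z'\<in>Ob. P X Y Z \<and> isom Z Z' \<longrightarrow> P X Y Z') \<and>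
     (\<forall>U\<in>Ob'. \<forall>V\<in>Ob'. \<forall>W\<in>Ob'. \<forall>W'\<in>Ob'. P' U V W \<and> isom' W W' \<longrightarrow> P' U V W')"

lemma matches_op:
  assumes m: "matches P P'" and A: "A \<in> saturated" and B: "B \<in> saturated"
  defines "C \<equiv> {Z \<in> Ob. \<exists>X\<in>A. \<exists>Y\<in>B. P X Y Z}"
  shows "C \<in> saturated" and "\<Phi> C = {W \<in> Ob'. \<exists>U\<in>\<Phi> A. \<exists>V\<in>\<Phi> B. P' U V W}"
proof -
  have Ob: "A \<subseteq> Ob" "B \<subseteq> Ob" using A B by (auto simp: saturated_def)
  show C: "C \<in> saturated"
    using m Ob unfolding saturated_def C_def matches_def by blast
  show "\<Phi> C = {W \<in> Ob'. \<exists>U\<in>\<Phi> A. \<exists>V\<in>\<Phi> B. P' U V W}"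
  proof (rule \<Phi>_eqI[OF C])
    fix Z W assume Z: "Z \<in> Ob" and W: "W \<in> Ob'" and ZW: "R Z W"
    have "\<exists>U\<in>\<Phi> A. \<exists>V\<in>\<Phi> B. P' U V W" if ZC: "Z \<in> C"
    proof -
      obtain X Y where XY: "X \<in> A" "Y \<in> B" "P X Y Z" using ZC by (auto simp: C_def)
      then obtain U V W' where U: "U \<in> Ob'" "V \<in> Ob'" "W' \<in> Ob'" "R X U" "R Y V" "R Z W'" "P' U V W'"
        using m Ob Z unfolding matches_def by (meson subsetD)
      \<comment> \<open>The matched result \<open>W'\<close> and the given \<open>W\<close> are both
        related to \<open>Z\<close>, so one may be replaced by the other.\<close>
      moreover have "isom' W' W" using isom'_R Z U W ZW by blast
      ultimately have "P' U V W" using m W unfolding matches_def by blast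
      then show ?thesis using XY U by (auto simp: \<Phi>_def)
    qed
    moreover have "Z \<in> C" if uv: "U \<in> \<Phi> A" "V \<in> \<Phi> B" "P' U V W" for U V
    proof -
      have UV: "U \<in> Ob'" "V \<in> Ob'" using uv by (auto simp: \<Phi>_def)
      then obtain X Y Z' where X: "X \<in> Ob" "Y \<in> Ob" "Z' \<in> Ob" "R X U" "R Y V" "R Z' W" "P X Y Z'"
        using m W uv(3) unfolding matches_def by meson
      moreover have "isom Z' Z" using isom_R Z X W ZW by blast
      ultimately have "P X Y Z" using m Z unfolding matches_def by blast
      moreover have "X \<in> A" "Y \<in> B"
        using \<Phi>_iff[OF A X(1) UV(1) X(4)] \<Phi>_iff[OF B X(2) UV(2) X(5)] uv by auto
      ultimately show ?thesis using Z by (auto simp: C_def)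
    qed
    ultimately show "W \<in> {W \<in> Ob'. \<exists>U\<in>\<Phi> A. \<exists>V\<in>\<Phi> B. P' U V W} \<longleftrightarrow> Z \<in> C"
      using W by blast
  qed auto
qed

lemma matches_unit:
  assumes m: "\<And>Z W. \<lbrakk>Z \<in> Ob; W \<in> Ob'; R Z W\<rbrakk> \<Longrightarrow> p Z \<longleftrightarrow> p' W"
  shows "{Z \<in> Ob. p Z} \<in> saturated" and "\<Phi> {Z \<in> Ob. p Z} = {W \<in> Ob'. p' W}"
proof -
  have "p Y" if "X \<in> Ob" "p X" "Y \<in> Ob" "isom X Y" for X Y
    using total[OF that(1)] m that R_isom by blast
  then show s: "{Z \<in> Ob. p Z} \<in> saturated"
    unfolding saturated_def by blast
  show "\<Phi> {Z \<in> Ob. p Z} = {W \<in> Ob'. p' W}"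
    by (rule \<Phi>_eqI[OF s]) (use m in auto)
qed

lemma grothendieck_rings_isomorphic:
  assumes "matches is_sum is_sum'" "matches is_tensor is_tensor'"
    and "\<And>Z W. \<lbrakk>Z \<in> Ob; W \<in> Ob'; R Z W\<rbrakk> \<Longrightarrow> is_zero Z \<longleftrightarrow> is_zero' W"
    and "\<And>Z W. \<lbrakk>Z \<in> Ob; W \<in> Ob'; R Z W\<rbrakk> \<Longrightarrow> is_one Z \<longleftrightarrow> is_one' W"
  shows "grothendieck_ring (iso_class_semiring Ob isom is_sum is_tensor is_zero is_one) \<simeq>
    grothendieck_ring (iso_class_semiring Ob' isom' is_sum' is_tensor' is_zero' is_one')"
  using saturated_class \<Phi>_classes matches_op[OF assms(1)] matches_op[OF assms(2)]
    matches_unit[of is_zero is_zero', OF assms(3)] matches_unit[of is_one is_one', OF assms(4)]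
  by (intro grothendieck_ring_iso[where E = saturated and \<phi> = \<Phi>] inj_\<Phi>)
    (auto simp: iso_class_semiring_def)

end

section \<open>The equivalence and the isomorphism of rings\<close>

lemma fd_net_isometric: "X \<in> fd_net_bundles \<Longrightarrow> isometric_net X"
  by (simp add: fd_net_bundles_def hilbert_net_bundle.isometric_net)

lemma fd_rep_act_closed: "V \<in> fd_reps G \<Longrightarrow> act_closed G V"
  by (simp add: fd_reps_def unitary_rep.act_closed)

lemma intertwiners_closed:
  "\<lbrakk>T \<in> intertwiners G V W; x \<in> carrier (space V)\<rbrakk> \<Longrightarrow> T x \<in> carrier (space W)"
  by (auto simp: intertwiners_iff intro: bounded_lin_closed)

lemma net_morphisms_closed:
  "\<lbrakk>T \<in> net_morphisms X Y; v \<in> carrier (fibre X x)\<rbrakk> \<Longrightarrow> T x v \<in> carrier (fibre Y x)"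
  by (auto simp: net_morphisms_iff intro: bounded_lin_closed)

lemma rep_id_intertwiner: "act_closed G V \<Longrightarrow> rep_id V \<in> intertwiners G V V"
  by (auto simp: intertwiners_iff rep_id_def act_closed_def bounded_lin_restrict bounded_lin_id id_def)

lemma rep_comp_intertwiner:
  assumes "act_closed G U" "act_closed G V" "T \<in> intertwiners G U V" "S \<in> intertwiners G V W"
  shows "rep_comp U S T \<in> intertwiners G U W"
proof -
  have "intertwining G U V T" "intertwining G V W S"
    using assms(3,4) by (auto simp: intertwining_def intertwiners_iff)
  from restrict_intertwiners[OF assms(1) intertwining_compose[OF assms(1,2) this]] show ?thesis
    by (simp add: rep_comp_def compose_def)
qed

section \<open>The two categories\<close>

lemma is_category_V_net: "is_category (V_net TYPE('k::order) TYPE('e))"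
  unfolding is_category_def V_net_def category.simps
proof (intro conjI ballI)
  fix X Y Z :: "('k, 'e) net_bundle" and f g
  assume "X \<in> fd_net_bundles" "Y \<in> fd_net_bundles" "f \<in> net_morphisms X Y" "g \<in> net_morphisms Y Z"
  then show "net_comp X g f \<in> net_morphisms X Z"
    by (intro net_comp_morphism[of X Y] fd_net_isometric)
next
  fix X Y :: "('k, 'e) net_bundle" and f
  assume f: "f \<in> net_morphisms X Y"
  have ext: "f x \<in> extensional (carrier (fibre X x))" for x
    using f by (simp add: net_morphisms_iff)
  show "net_comp X f (net_id X) = f" "net_comp X (net_id Y) f = f"
    using net_morphisms_closed[OF f] extensional_arb[OF ext]
    by (auto simp: net_comp_def net_id_def compose_def fun_eq_iff)
next
  fix W X Y Z :: "('k, 'e) net_bundle" and f g h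
  assume "f \<in> net_morphisms W X"
  then show "net_comp W h (net_comp W g f) = net_comp W (net_comp X h g) f"
    using net_morphisms_closed by (fastforce simp: net_comp_def compose_def fun_eq_iff)
qed (simp add: net_id_morphism fd_net_isometric)

lemma is_category_Rep: "is_category (Rep G TYPE('v))"
  unfolding is_category_def Rep_def category.simps
proof (intro conjI ballI)
  fix X Y Z :: "('a, 'v) rep" and f g
  assume "X \<in> fd_reps G" "Y \<in> fd_reps G" "f \<in> intertwiners G X Y" "g \<in> intertwiners G Y Z"
  then show "rep_comp X g f \<in> intertwiners G X Z"
    by (intro rep_comp_intertwiner[of G X Y] fd_rep_act_closed)
next
  fix X Y :: "('a, 'v) rep" and f
  assume f: "f \<in> intertwiners G X Y"
  have ext: "f \<in> extensional (carrier (space X))"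
    using f by (simp add: intertwiners_iff)
  show "rep_comp X f (rep_id X) = f" "rep_comp X (rep_id Y) f = f"
    using intertwiners_closed[OF f] extensional_arb[OF ext]
    by (auto simp: rep_comp_def rep_id_def compose_def fun_eq_iff)
next
  fix W X Y Z :: "('a, 'v) rep" and f g h
  assume "f \<in> intertwiners G W X"
  then show "rep_comp W h (rep_comp W g f) = rep_comp W (rep_comp X h g) f"
    using intertwiners_closed by (fastforce simp: rep_comp_def compose_def fun_eq_iff)
qed (simp add: rep_id_intertwiner fd_rep_act_closed)

text \<open>The operator \<open>U' T U^-1\<close>, restricted to be extensional. It carries
  morphisms between holonomies over to their copies in another type.\<close>

definition conj_op ::
    "('g, 'v) rep \<Rightarrow> ('g, 'v') rep \<Rightarrow> ('v \<Rightarrow> 'v') \<Rightarrow> ('w \<Rightarrow> 'w') \<Rightarrow> ('v \<Rightarrow> 'w) \<Rightarrow> 'v' \<Rightarrow> 'w'" where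
  "conj_op V V' U U' T =
     restrict (\<lambda>x. U' (T (inv_into (carrier (space V)) U x))) (carrier (space V'))"

lemma conj_op_intertwiner:
  assumes cl: "act_closed G V" "act_closed G V'" "act_closed G W"
    and U: "unitary_intertwiner G V V' U" and U': "unitary_intertwiner G W W' U'"
    and T: "T \<in> intertwiners G V W"
  shows "conj_op V V' U U' T \<in> intertwiners G V' W'"
proof -
  have "intertwining G V W T"
    using T by (auto simp: intertwining_def intertwiners_iff)
  with unitary_intertwiner_intertwining[OF unitary_intertwiner_inv[OF cl(1) U]]
  have "intertwining G V' W (\<lambda>x. T (inv_into (carrier (space V)) U x))"
    by (rule intertwining_compose[OF cl(2,1)])
  from intertwining_compose[OF cl(2,3) this unitary_intertwiner_intertwining[OF U']]
  show ?thesis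
    unfolding conj_op_def by (rule restrict_intertwiners[OF cl(2)])
qed

lemma conj_op_bij:
  assumes cl: "act_closed G V" "act_closed G V'" "act_closed G W" "act_closed G W'"
    and U: "unitary_intertwiner G V V' U" and U': "unitary_intertwiner G W W' U'"
  shows "bij_betw (conj_op V V' U U') (intertwiners G V W) (intertwiners G V' W')"
proof -
  let ?V = "inv_into (carrier (space V)) U" and ?V' = "inv_into (carrier (space W)) U'"
  have u: "is_unitary (space V) (space V') U" and u': "is_unitary (space W) (space W') U'"
    using U U' by (auto simp: unitary_intertwiner_def)
  define unconj where "unconj S = restrict (\<lambda>x. ?V' (S (U x))) (carrier (space V))" for S
  have unconj: "unconj S \<in> intertwiners G V W" if S: "S \<in> intertwiners G V' W'" for S
  proof -
    have "intertwining G V' W' S"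
      using S by (auto simp: intertwining_def intertwiners_iff)
    from intertwining_compose[OF cl(1,2) unitary_intertwiner_intertwining[OF U] this]
    have "intertwining G V W' (\<lambda>x. S (U x))" .
    from intertwining_compose[OF cl(1,4) this
        unitary_intertwiner_intertwining[OF unitary_intertwiner_inv[OF cl(3) U']]]
    show ?thesis
      unfolding unconj_def by (rule restrict_intertwiners[OF cl(1)])
  qed
  have bc: "unconj (conj_op V V' U U' T) = T" if T: "T \<in> intertwiners G V W" for T
  proof
    fix x
    have "T \<in> extensional (carrier (space V))" using T by (simp add: intertwiners_iff)
    then show "unconj (conj_op V V' U U' T) x = T x"
      using is_unitary_closed[OF u] is_unitary_inv_left[OF u] is_unitary_inv_left[OF u']
        intertwiners_closed[OF T] by (cases "x \<in> carrier (space V)") (auto simp: unconj_def conj_op_def extensional_def)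
  qed
  have cb: "conj_op V V' U U' (unconj S) = S" if S: "S \<in> intertwiners G V' W'" for S
  proof
    fix x
    have "S \<in> extensional (carrier (space V'))" using S by (simp add: intertwiners_iff)
    then show "conj_op V V' U U' (unconj S) x = S x"
      using is_unitary_inv_closed[OF u] is_unitary_inv_right[OF u] is_unitary_inv_right[OF u']
        intertwiners_closed[OF S] by (cases "x \<in> carrier (space V')") (auto simp: unconj_def conj_op_def extensional_def)
  qed
  show ?thesis
    using bc cb unconj conj_op_intertwiner[OF cl(1-3) U U']
    by (intro bij_betw_byWitness[where f' = unconj]) auto
qed

lemma unitary_intertwiner_iso_arr:
  assumes V: "V \<in> fd_reps G" and W: "W \<in> fd_reps G" and U: "unitary_intertwiner G V W U"
  shows "is_iso_arr (Rep G TYPE('v)) V W (restrict U (carrier (space V)))"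
proof -
  let ?U' = "inv_into (carrier (space V)) U"
  note cl = fd_rep_act_closed[OF V] fd_rep_act_closed[OF W]
  have u: "is_unitary (space V) (space W) U" using U by (simp add: unitary_intertwiner_def)
  have "rep_comp V (restrict ?U' (carrier (space W))) (restrict U (carrier (space V))) = rep_id V"
    "rep_comp W (restrict U (carrier (space V))) (restrict ?U' (carrier (space W))) = rep_id W"
    using is_unitary_closed[OF u] is_unitary_inv_left[OF u] is_unitary_inv_closed[OF u] is_unitary_inv_right[OF u]
    by (auto simp: rep_comp_def rep_id_def compose_def fun_eq_iff)
  moreover have "restrict U (carrier (space V)) \<in> intertwiners G V W"
    "restrict ?U' (carrier (space W)) \<in> intertwiners G W V"
    using unitary_intertwiner_intertwining[OF U]
      unitary_intertwiner_intertwining[OF unitary_intertwiner_inv[OF cl(1) U]]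
    by (auto intro: restrict_intertwiners cl)
  ultimately show ?thesis
    unfolding is_iso_arr_def Rep_def by auto
qed

lemma unitary_intertwiner_compose:
  assumes "unitary_intertwiner G U V T" "unitary_intertwiner G V W S"
  shows "unitary_intertwiner G U W (\<lambda>x. S (T x))"
  using assms is_unitary_compose[of "space U" "space V" T "space W" S]
  by (auto simp: unitary_intertwiner_def dest: is_unitary_closed)

text \<open>The same variance as in \<open>is_hilb_tensor_unitary\<close>: intertwiners into the old
  factors and out of the old product.\<close>

lemma is_rep_tensor_unitary:
  assumes U: "unitary_intertwiner G U' U A" and V: "unitary_intertwiner G V' V B"
    and W: "unitary_intertwiner G W W' C" and H: "hilbert_space (space W)" "hilbert_space (space W')"
    and t: "is_rep_tensor G U V W"
  shows "is_rep_tensor G U' V' W'"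
proof -
  obtain t where t: "is_hilb_tensor (space U) (space V) (space W) t"
    and eq: "\<And>g x y. \<lbrakk>g \<in> carrier G; x \<in> carrier (space U); y \<in> carrier (space V)\<rbrakk> \<Longrightarrow>
      act W g (t x y) = t (act U g x) (act V g y)"
    using t unfolding is_rep_tensor_def by blast
  have un: "is_unitary (space U') (space U) A" "is_unitary (space V') (space V) B"
    "is_unitary (space W) (space W') C"
    using U V W by (auto simp: unitary_intertwiner_def)
  have tcl: "t x y \<in> carrier (space W)" if "x \<in> carrier (space U)" "y \<in> carrier (space V)" for x y
    using t that by (auto simp: is_hilb_tensor_def intro: is_linear_closed)
  show ?thesis
    unfolding is_rep_tensor_def
  proof (intro exI[of _ "\<lambda>x y. C (t (A x) (B y))"] conjI ballI)
    show "is_hilb_tensor (space U') (space V') (space W') (\<lambda>x y. C (t (A x) (B y)))"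
      by (rule is_hilb_tensor_unitary[OF un H t])
    fix g x y assume g: "g \<in> carrier G" and x: "x \<in> carrier (space U')" and y: "y \<in> carrier (space V')"
    have AB: "A x \<in> carrier (space U)" "B y \<in> carrier (space V)"
      using is_unitary_closed[OF un(1) x] is_unitary_closed[OF un(2) y] by auto
    have "act W' g (C (t (A x) (B y))) = C (act W g (t (A x) (B y)))"
      using W g tcl[OF AB] by (simp add: unitary_intertwiner_def)
    also have "\<dots> = C (t (A (act U' g x)) (B (act V' g y)))"
      using U V g x y eq[OF g AB] by (simp add: unitary_intertwiner_def)
    finally show "act W' g (C (t (A x) (B y))) = C (t (A (act U' g x)) (B (act V' g y)))" .
  qed
qed

section \<open>The equivalence and the ring isomorphism for fixed universes\<close>

context
  fixes a :: "'k::order"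
  assumes connected: "pathwise_connected TYPE('k)"
    and large_e: "(UNIV :: ('k \<times> complex) set) \<lesssim> (UNIV :: 'e set)"
    and large_v: "(UNIV :: complex set) \<lesssim> (UNIV :: 'v set)"
begin

lemma categories_equivalent:
  "equivalent_categories (V_net TYPE('k) TYPE('e)) (Rep (pi1 a) TYPE('v))"
proof -
  let ?G = "pi1 a" and ?hol = "holonomy a :: ('k, 'e) net_bundle \<Rightarrow> _"
  \<comment> \<open>The holonomy acts on fibres in type \<open>'e\<close>, so a unitary copy
    \<open>W X\<close> in type \<open>'v\<close> is chosen for each bundle. The functor sends
    \<open>X\<close> to this copy and conjugates the component at \<open>a\<close> of a
    morphism.\<close>
  have "\<exists>W u. W \<in> (fd_reps ?G :: (_, 'v) rep set) \<and> unitary_intertwiner ?G (?hol X) W u"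
    if "X \<in> fd_net_bundles" for X
    using fd_rep_copy[OF large_v holonomy_fd[OF that]] by blast
  then obtain W :: "('k, 'e) net_bundle \<Rightarrow> (_, 'v) rep" and u
    where W: "\<And>X. X \<in> fd_net_bundles \<Longrightarrow> W X \<in> fd_reps ?G"
      and u: "\<And>X. X \<in> fd_net_bundles \<Longrightarrow> unitary_intertwiner ?G (?hol X) (W X) (u X)"
    by metis
  define Fm where "Fm X Y T = conj_op (?hol X) (W X) (u X) (u Y) (T a)" for X Y and T :: "'k \<Rightarrow> 'e \<Rightarrow> 'e"
  have uu: "is_unitary (fibre X a) (space (W X)) (u X)" if "X \<in> fd_net_bundles" for X
    using u[OF that] by (simp add: unitary_intertwiner_def)
  note cl = isometric_net.act_closed_holonomy[OF fd_net_isometric] fd_rep_act_closed[OF W]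
  have bij: "bij_betw (Fm X Y) (net_morphisms X Y) (intertwiners ?G (W X) (W Y))"
    if X: "X \<in> fd_net_bundles" and Y: "Y \<in> fd_net_bundles" for X Y
  proof -
    have "Fm X Y = conj_op (?hol X) (W X) (u X) (u Y) \<circ> (\<lambda>T. T a)"
      by (simp add: Fm_def fun_eq_iff)
    then show ?thesis
      using bij_betw_trans[OF net_morphisms_bij[OF connected fd_net_isometric[OF X] fd_net_isometric[OF Y]]
          conj_op_bij[OF cl(1)[OF X] cl(2)[OF X] cl(1)[OF Y] cl(2)[OF Y] u[OF X] u[OF Y]]]
      by simp
  qed
  interpret fully_faithful_functor "V_net TYPE('k) TYPE('e)" "Rep ?G TYPE('v)" W Fm
  proof (rule fully_faithful_functor.intro)
    show "is_functor (V_net TYPE('k) TYPE('e)) (Rep ?G TYPE('v)) W Fm"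
      unfolding is_functor_def V_net_def Rep_def category.simps
    proof (intro conjI ballI)
      fix X Y :: "('k, 'e) net_bundle" and T assume "X \<in> fd_net_bundles" "Y \<in> fd_net_bundles" "T \<in> net_morphisms X Y"
      then show "Fm X Y T \<in> intertwiners ?G (W X) (W Y)"
        using bij by (auto simp: bij_betw_def)
    next
      fix X :: "('k, 'e) net_bundle" assume X: "X \<in> fd_net_bundles"
      show "Fm X X (net_id X) = rep_id (W X)"
        using is_unitary_inv_closed[OF uu[OF X]] is_unitary_inv_right[OF uu[OF X]]
        by (auto simp: Fm_def conj_op_def net_id_def rep_id_def fun_eq_iff)
    next
      fix X Y Z :: "('k, 'e) net_bundle" and T S
      assume X: "X \<in> fd_net_bundles" "Y \<in> fd_net_bundles" "Z \<in> fd_net_bundles"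
        and T: "T \<in> net_morphisms X Y" and S: "S \<in> net_morphisms Y Z"
      show "Fm X Z (net_comp X S T) = rep_comp (W X) (Fm Y Z S) (Fm X Y T)"
        using is_unitary_inv_closed[OF uu[OF X(1)]] net_morphisms_closed[OF T, of _ a]
          is_unitary_closed[OF uu[OF X(2)]] is_unitary_inv_left[OF uu[OF X(2)]]
        by (auto simp: Fm_def conj_op_def net_comp_def rep_comp_def compose_def fun_eq_iff)
    qed (rule W)
  qed (rule is_category_V_net, rule is_category_Rep, use bij in \<open>simp add: V_net_def Rep_def\<close>)
  show ?thesis
  proof (rule equivalent)
    fix V assume "V \<in> Obj (Rep ?G TYPE('v))"
    then have V: "V \<in> fd_reps ?G" by (simp add: Rep_def)
    obtain X :: "('k, 'e) net_bundle" and t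
      where X: "X \<in> fd_net_bundles" and t: "unitary_intertwiner ?G (?hol X) V t"
      using holonomy_ess_surj[OF connected large_e V] by blast
    have "unitary_intertwiner ?G (W X) V (\<lambda>x. t (inv_into (carrier (space (?hol X))) (u X) x))"
      by (rule unitary_intertwiner_compose[OF unitary_intertwiner_inv[OF cl(1)[OF X] u[OF X]] t])
    from unitary_intertwiner_iso_arr[OF W[OF X] V this] X
    show "\<exists>X\<in>Obj (V_net TYPE('k) TYPE('e)). \<exists>f. is_iso_arr (Rep ?G TYPE('v)) (W X) V f"
      by (auto simp: V_net_def)
  qed
qed

text \<open>Isomorphism rather than unitary equivalence, so that the relation is stable under
  isomorphism of representations, as \<open>class_correspondence\<close> demands.\<close>

definition realises :: "('k, 'e) net_bundle \<Rightarrow> ('k simplex1 list set, 'v) rep \<Rightarrow> bool" where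
  "realises X V \<longleftrightarrow> rep_isomorphic (pi1 a) (holonomy a X) V"

lemma unitary_realises:
  "\<lbrakk>X \<in> fd_net_bundles; V \<in> fd_reps (pi1 a); unitary_intertwiner (pi1 a) (holonomy a X) V U\<rbrakk> \<Longrightarrow> realises X V"
  unfolding realises_def
  by (intro unitary_intertwiner_isomorphic isometric_net.act_closed_holonomy fd_net_isometric fd_rep_act_closed)

lemma holonomy_closed: "X \<in> fd_net_bundles \<Longrightarrow> act_closed (pi1 a) (holonomy a X)"
  by (rule isometric_net.act_closed_holonomy[OF fd_net_isometric])

interpretation class_correspondence "fd_net_bundles :: ('k, 'e) net_bundle set" net_isomorphic
  "fd_reps (pi1 a) :: (_, 'v) rep set" "rep_isomorphic (pi1 a)" realises
proof
  fix X :: "('k, 'e) net_bundle" assume "X \<in> fd_net_bundles"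
  then show "\<exists>V\<in>fd_reps (pi1 a). realises X V"
    using fd_rep_copy[OF large_v holonomy_fd] unitary_realises by blast
next
  fix V :: "(_, 'v) rep" assume "V \<in> fd_reps (pi1 a)"
  then show "\<exists>X\<in>fd_net_bundles. realises X V"
    using holonomy_ess_surj[OF connected large_e] unitary_realises by blast
next
  fix X Y :: "('k, 'e) net_bundle" and V W :: "(_, 'v) rep"
  assume X: "X \<in> fd_net_bundles" "Y \<in> fd_net_bundles" "V \<in> fd_reps (pi1 a)" "W \<in> fd_reps (pi1 a)"
    "realises X V" "realises Y W"
  note cl = holonomy_closed[OF X(1)] holonomy_closed[OF X(2)] fd_rep_act_closed[OF X(3)] fd_rep_act_closed[OF X(4)]
  have "rep_isomorphic (pi1 a) (holonomy a X) (holonomy a Y) \<longleftrightarrow> rep_isomorphic (pi1 a) V W"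
    using X(5,6) rep_isomorphic_sym rep_isomorphic_trans cl unfolding realises_def by meson
  then show "net_isomorphic X Y \<longleftrightarrow> rep_isomorphic (pi1 a) V W"
    using net_isomorphic_iff[OF connected fd_net_isometric[OF X(1)] fd_net_isometric[OF X(2)]] by simp
qed (auto simp: realises_def intro: rep_isomorphic_refl rep_isomorphic_sym fd_rep_act_closed
    rep_isomorphic_trans[OF holonomy_closed fd_rep_act_closed fd_rep_act_closed]
    rep_isomorphic_trans[OF fd_rep_act_closed fd_rep_act_closed fd_rep_act_closed])

text \<open>Here \<open>X\<close> and \<open>W\<close> may live outside the types \<open>'e\<close>
  and \<open>'v\<close>; direct sums and trivial objects are the cases of interest.\<close>

lemma net_isomorphic_realises:
  assumes X: "isometric_net X" and Z: "Z \<in> fd_net_bundles" "V \<in> fd_reps (pi1 a)" "realises Z V"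
    and W: "act_closed (pi1 a) W" "rep_isomorphic (pi1 a) (holonomy a X) W"
  shows "net_isomorphic X Z \<longleftrightarrow> rep_isomorphic (pi1 a) W V"
proof -
  note cl = holonomy_closed[OF Z(1)] fd_rep_act_closed[OF Z(2)] isometric_net.act_closed_holonomy[OF X, of a] W(1)
  have "rep_isomorphic (pi1 a) (holonomy a X) (holonomy a Z) \<longleftrightarrow> rep_isomorphic (pi1 a) W V"
    using Z(3) W(2) rep_isomorphic_sym rep_isomorphic_trans cl unfolding realises_def by meson
  then show ?thesis
    using net_isomorphic_iff[OF connected X fd_net_isometric[OF Z(1)]] by simp
qed

text \<open>Three type variables, since \<open>X\<close> may be a direct sum. The composition takes
  place on the holonomies.\<close>

lemma net_isomorphic_trans:
  fixes X :: "('k, 'x) net_bundle" and Y :: "('k, 'y) net_bundle" and Z :: "('k, 'z) net_bundle"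
  assumes "isometric_net X" "isometric_net Y" "isometric_net Z" "net_isomorphic X Y" "net_isomorphic Y Z"
  shows "net_isomorphic X Z"
proof -
  note cl = isometric_net.act_closed_holonomy[where a = a]
  show ?thesis
    using assms net_isomorphic_iff[OF connected assms(1,2), of a] net_isomorphic_iff[OF connected assms(2,3), of a]
      net_isomorphic_iff[OF connected assms(1,3), of a] rep_isomorphic_trans[OF cl cl cl, of X Y Z]
    by simp
qed

lemma net_sum_realises:
  assumes X: "X \<in> fd_net_bundles" "Y \<in> fd_net_bundles" "Z \<in> fd_net_bundles"
    and U: "U \<in> fd_reps (pi1 a)" "V \<in> fd_reps (pi1 a)" "W \<in> fd_reps (pi1 a)"
    and r: "realises X U" "realises Y V" "realises Z W"
  shows "net_isomorphic (net_sum X Y) Z \<longleftrightarrow> rep_isomorphic (pi1 a) (rep_sum U V) W"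
proof (rule net_isomorphic_realises)
  note i = fd_net_isometric[OF X(1)] fd_net_isometric[OF X(2)]
  note cl = holonomy_closed[OF X(1)] fd_rep_act_closed[OF U(1)] holonomy_closed[OF X(2)] fd_rep_act_closed[OF U(2)]
  show s: "isometric_net (net_sum X Y)" by (rule isometric_net_sum[OF i])
  show "act_closed (pi1 a) (rep_sum U V)" by (rule act_closed_sum[OF cl(2,4)])
  show "rep_isomorphic (pi1 a) (holonomy a (net_sum X Y)) (rep_sum U V)"
    using r cl unfolding realises_def
    by (intro rep_isomorphic_trans[OF _ _ _ holonomy_sum[OF i] rep_isomorphic_sum[OF cl]]
        isometric_net.act_closed_holonomy[OF s] act_closed_sum) auto
qed fact+

lemma matches_sum:
  "matches (\<lambda>X Y Z. net_isomorphic (net_sum X Y) Z) (\<lambda>U V W. rep_isomorphic (pi1 a) (rep_sum U V) W)"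
  unfolding matches_def
proof (intro conjI ballI impI)
  fix X Y Z :: "('k, 'e) net_bundle"
  assume X: "X \<in> fd_net_bundles" "Y \<in> fd_net_bundles" "Z \<in> fd_net_bundles" and "net_isomorphic (net_sum X Y) Z"
  moreover obtain U V W where "U \<in> fd_reps (pi1 a)" "V \<in> fd_reps (pi1 a)" "W \<in> fd_reps (pi1 a)"
    "realises X U" "realises Y V" "realises Z W"
    using total X by meson
  ultimately show "\<exists>U\<in>fd_reps (pi1 a). \<exists>V\<in>fd_reps (pi1 a). \<exists>W\<in>fd_reps (pi1 a).
      realises X U \<and> realises Y V \<and> realises Z W \<and> rep_isomorphic (pi1 a) (rep_sum U V) W"
    using net_sum_realises by blast
next
  fix U V W :: "(_, 'v) rep"
  assume U: "U \<in> fd_reps (pi1 a)" "V \<in> fd_reps (pi1 a)" "W \<in> fd_reps (pi1 a)"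
    and "rep_isomorphic (pi1 a) (rep_sum U V) W"
  moreover obtain X Y Z where "X \<in> fd_net_bundles" "Y \<in> fd_net_bundles" "Z \<in> fd_net_bundles"
    "realises X U" "realises Y V" "realises Z W"
    using surj U by meson
  ultimately show "\<exists>X\<in>fd_net_bundles. \<exists>Y\<in>fd_net_bundles. \<exists>Z\<in>fd_net_bundles.
      realises X U \<and> realises Y V \<and> realises Z W \<and> net_isomorphic (net_sum X Y) Z"
    using net_sum_realises by blast
next
  fix X Y Z Z' :: "('k, 'e) net_bundle"
  assume "X \<in> fd_net_bundles" "Y \<in> fd_net_bundles" "Z \<in> fd_net_bundles" "Z' \<in> fd_net_bundles"
    "net_isomorphic (net_sum X Y) Z \<and> net_isomorphic Z Z'"
  then show "net_isomorphic (net_sum X Y) Z'"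
    using net_isomorphic_trans isometric_net_sum fd_net_isometric by meson
next
  fix U V W W' :: "(_, 'v) rep"
  assume "U \<in> fd_reps (pi1 a)" "V \<in> fd_reps (pi1 a)" "W \<in> fd_reps (pi1 a)" "W' \<in> fd_reps (pi1 a)"
    "rep_isomorphic (pi1 a) (rep_sum U V) W \<and> rep_isomorphic (pi1 a) W W'"
  then show "rep_isomorphic (pi1 a) (rep_sum U V) W'"
    using rep_isomorphic_trans act_closed_sum fd_rep_act_closed by meson
qed

text \<open>\<open>Z\<close> is merely isomorphic to an actual tensor product \<open>P\<close>, so
  unitary copies are chosen for \<open>X\<close>, \<open>Y\<close> and \<open>P\<close>. The tensor
  structure moves along these, and \<open>Z\<close> is reattached through
  \<open>isom_iff\<close>.\<close>

lemma matches_tensor: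
  "matches (\<lambda>X Y Z. \<exists>P\<in>fd_net_bundles :: ('k, 'e) net_bundle set. is_net_tensor X Y P \<and> net_isomorphic P Z)
     (\<lambda>U V W. \<exists>Q\<in>fd_reps (pi1 a) :: (_, 'v) rep set. is_rep_tensor (pi1 a) U V Q \<and> rep_isomorphic (pi1 a) Q W)"
  unfolding matches_def
proof (intro conjI ballI impI)
  fix X Y Z :: "('k, 'e) net_bundle"
  assume X: "X \<in> fd_net_bundles" "Y \<in> fd_net_bundles" "Z \<in> fd_net_bundles"
    and "\<exists>P\<in>fd_net_bundles :: ('k, 'e) net_bundle set. is_net_tensor X Y P \<and> net_isomorphic P Z"
  then obtain P :: "('k, 'e) net_bundle"
    where P: "P \<in> fd_net_bundles" "is_net_tensor X Y P" "net_isomorphic P Z" by blast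
  obtain U V Q W :: "(_, 'v) rep" and u v q w
    where U: "U \<in> fd_reps (pi1 a)" "V \<in> fd_reps (pi1 a)" "Q \<in> fd_reps (pi1 a)" "W \<in> fd_reps (pi1 a)"
      and u: "unitary_intertwiner (pi1 a) (holonomy a X) U u" "unitary_intertwiner (pi1 a) (holonomy a Y) V v"
        "unitary_intertwiner (pi1 a) (holonomy a P) Q q" "unitary_intertwiner (pi1 a) (holonomy a Z) W w"
    using fd_rep_copy[OF large_v holonomy_fd] X P(1) by meson
  have "is_rep_tensor (pi1 a) (holonomy a X) (holonomy a Y) (holonomy a P)"
    by (intro net_tensor_holonomy fd_net_isometric X P)
  then have "is_rep_tensor (pi1 a) U V Q"
    using U holonomy_fd[OF P(1), of a]
    by (intro is_rep_tensor_unitary[OF unitary_intertwiner_inv[OF holonomy_closed[OF X(1)] u(1)]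
          unitary_intertwiner_inv[OF holonomy_closed[OF X(2)] u(2)] u(3)])
      (auto simp: fd_reps_def unitary_rep_def)
  moreover have r: "realises X U" "realises Y V" "realises P Q" "realises Z W"
    using unitary_realises X P(1) U u by auto
  moreover have "rep_isomorphic (pi1 a) Q W"
    using isom_iff[OF P(1) X(3) U(3,4) r(3,4)] P(3) by simp
  ultimately show "\<exists>U\<in>fd_reps (pi1 a). \<exists>V\<in>fd_reps (pi1 a). \<exists>W\<in>fd_reps (pi1 a).
      realises X U \<and> realises Y V \<and> realises Z W \<and>
      (\<exists>Q\<in>fd_reps (pi1 a) :: (_, 'v) rep set. is_rep_tensor (pi1 a) U V Q \<and> rep_isomorphic (pi1 a) Q W)"
    using U by blast
next
  fix U V W :: "(_, 'v) rep"
  assume U: "U \<in> fd_reps (pi1 a)" "V \<in> fd_reps (pi1 a)" "W \<in> fd_reps (pi1 a)"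
    and "\<exists>Q\<in>fd_reps (pi1 a) :: (_, 'v) rep set. is_rep_tensor (pi1 a) U V Q \<and> rep_isomorphic (pi1 a) Q W"
  then obtain Q :: "(_, 'v) rep" where Q: "Q \<in> fd_reps (pi1 a)" "is_rep_tensor (pi1 a) U V Q" "rep_isomorphic (pi1 a) Q W"
    by blast
  \<comment> \<open>Essential surjectivity up to unitary intertwiners; an arbitrary isomorphism from
    the holonomy need not preserve the condition on inner products.\<close>
  obtain X Y P Z :: "('k, 'e) net_bundle" and u v q w
    where X: "X \<in> fd_net_bundles" "Y \<in> fd_net_bundles" "P \<in> fd_net_bundles" "Z \<in> fd_net_bundles"
      and u: "unitary_intertwiner (pi1 a) (holonomy a X) U u" "unitary_intertwiner (pi1 a) (holonomy a Y) V v"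
        "unitary_intertwiner (pi1 a) (holonomy a P) Q q" "unitary_intertwiner (pi1 a) (holonomy a Z) W w"
    using holonomy_ess_surj[OF connected large_e] U Q(1) by meson
  have "is_rep_tensor (pi1 a) (holonomy a X) (holonomy a Y) (holonomy a P)"
    using Q(1,2) holonomy_fd[OF X(3), of a]
    by (intro is_rep_tensor_unitary[OF u(1,2) unitary_intertwiner_inv[OF holonomy_closed[OF X(3)] u(3)]])
      (auto simp: fd_reps_def unitary_rep_def)
  then have "is_net_tensor X Y P"
    using X(3) by (intro holonomy_tensor_net[OF connected fd_net_isometric[OF X(1)] fd_net_isometric[OF X(2)]])
      (auto simp: fd_net_bundles_def)
  moreover have r: "realises X U" "realises Y V" "realises P Q" "realises Z W"
    using unitary_realises X Q(1) U u by auto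
  moreover have "net_isomorphic P Z"
    using isom_iff[OF X(3,4) Q(1) U(3) r(3,4)] Q(3) by simp
  ultimately show "\<exists>X\<in>fd_net_bundles. \<exists>Y\<in>fd_net_bundles. \<exists>Z\<in>fd_net_bundles.
      realises X U \<and> realises Y V \<and> realises Z W \<and>
      (\<exists>P\<in>fd_net_bundles :: ('k, 'e) net_bundle set. is_net_tensor X Y P \<and> net_isomorphic P Z)"
    using X by blast
next
  fix X Y Z Z' :: "('k, 'e) net_bundle"
  assume "Z \<in> fd_net_bundles" "Z' \<in> fd_net_bundles"
    "(\<exists>P\<in>fd_net_bundles :: ('k, 'e) net_bundle set. is_net_tensor X Y P \<and> net_isomorphic P Z) \<and> net_isomorphic Z Z'"
  then show "\<exists>P\<in>fd_net_bundles :: ('k, 'e) net_bundle set. is_net_tensor X Y P \<and> net_isomorphic P Z'"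
    using net_isomorphic_trans fd_net_isometric by meson
next
  fix U V W W' :: "(_, 'v) rep"
  assume "W \<in> fd_reps (pi1 a)" "W' \<in> fd_reps (pi1 a)"
    "(\<exists>Q\<in>fd_reps (pi1 a) :: (_, 'v) rep set. is_rep_tensor (pi1 a) U V Q \<and> rep_isomorphic (pi1 a) Q W) \<and>
     rep_isomorphic (pi1 a) W W'"
  then show "\<exists>Q\<in>fd_reps (pi1 a) :: (_, 'v) rep set. is_rep_tensor (pi1 a) U V Q \<and> rep_isomorphic (pi1 a) Q W'"
    using trans' by blast
qed

lemma trivial_realises:
  assumes "pre_hilb H" "Z \<in> fd_net_bundles" "W \<in> fd_reps (pi1 a)" "realises Z W"
  shows "net_isomorphic (trivial_bundle H) Z \<longleftrightarrow> rep_isomorphic (pi1 a) (trivial_rep H) W"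
proof (rule net_isomorphic_realises[OF isometric_net_trivial])
  show "act_closed (pi1 a) (trivial_rep H)"
    using assms(1) by (simp add: act_closed_def trivial_rep_def)
  show "rep_isomorphic (pi1 a) (holonomy a (trivial_bundle H)) (trivial_rep H)"
    by (rule holonomy_trivial[OF assms(1)])
qed fact+

lemma rings_isomorphic: "K0 TYPE('k) TYPE('e) \<simeq> representation_ring (pi1 a) TYPE('v)"
  unfolding K0_def representation_ring_def net_semiring_def rep_semiring_def
  by (rule grothendieck_rings_isomorphic[OF matches_sum matches_tensor])
    (simp_all add: trivial_realises pre_hilb_zero pre_hilb_complex)

end

theorem theorem5p11:
  fixes a :: "'k::order"
  assumes connected: "pathwise_connected TYPE('k)"
    and large_e: "(UNIV :: ('k \<times> complex) set) \<lesssim> (UNIV :: 'e set)"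
    and large_v: "(UNIV :: complex set) \<lesssim> (UNIV :: 'v set)"
  shows "equivalent_categories (V_net TYPE('k) TYPE('e)) (Rep (pi1 a) TYPE('v)) \<and>
         K0 TYPE('k) TYPE('e) \<simeq> representation_ring (pi1 a) TYPE('v)"
  using categories_equivalent[OF assms] rings_isomorphic[OF assms] by (rule conjI)

end
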